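(* Let $A$ be a finite-dimensional algebra over a field $k$, let $M$ be a finite-dimensional right $A$-module and put $d=\dim_k M$. Then the following hold. (1) For every $0\leq s\leq d$ and every $U\in\mathcal S_A(M)$ of dimension $s$, the point $U$ is isolated in $\operatorname{Gr}_A(s,M)$. (2) The set $\mathcal S_A(M)$ is finite. (3) The fibers of the map $\mathcal T\mapsto t_{\mathcal T}(M)$ partition $\mathsf{tors}\,A$ into finitely many intervals indexed by $U\in\mathcal S_A(M)$.
   Context: $\mathcal S_A(M)=\{U\subseteq M \text{ submodule}\mid \operatorname{Hom}_A(U,M/U)=0\}$. $\operatorname{Gr}_A(s,M)$ is the algebraic subset of the Grassmannian $\operatorname{Gr}(s,M)$ of $s$-dimensional $k$-subspaces of $M$ consisting of the $s$-dimensional $A$-submodules; it is the set of $k$-rational points with its Zariski topology. A torsion class is a full subcategory, closed under isomorphism, of the category $\mathsf{mod}\,A$ of finite-dimensional right $A$-modules that is closed under finite direct sums, factor modules and extensions. $\mathsf{tors}\,A$ is the set of torsion classes ordered by inclusion; an interval in it is a subset of the form $[\mathcal T_1,\mathcal T_2]=\{\mathcal T\mid \mathcal T_1\subseteq\mathcal T\subseteq\mathcal T_2\}$. For a torsion class $\mathcal T$, $t_{\mathcal T}(M)$ is the largest submodule of $M$ belonging to $\mathcal T$. *)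

theory Defs
  imports
    "HOL-Analysis.Function_Topology"
    "HOL-Algebra.AbelCoset"
    "HOL-Library.Disjoint_Sets"
    "HOL-Library.Poly_Mapping"
    "Jordan_Normal_Form.VS_Connect"
    "Jordan_Normal_Form.DL_Submatrix"
begin

section \<open>Finite-dimensional algebras and right modules\<close>

text \<open>
  The ground field is a type \<open>'k\<close> of class \<open>field\<close>, seen as a ring record through
  \<^const>\<open>class_ring\<close>. Algebras and modules have explicit carriers. An algebra is a
  \<^typ>\<open>('k, 'a) module\<close> record, which contains a ring structure. It is associative and unital, not
  necessarily commutative, and the zero algebra is allowed. (The library locale
  \<^locale>\<open>algebra\<close> is about commutative algebras.)
\<close>

locale fd_algebra =
  fixes A :: "('k::field, 'a, 'z) module_scheme"
  assumes ring: "ring A"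
    and vectorspace: "vectorspace class_ring A"
    and fin_dim: "vectorspace.fin_dim class_ring A"
    and smult_mult_left:
      "\<lbrakk>x \<in> carrier A; y \<in> carrier A\<rbrakk> \<Longrightarrow>
        c \<odot>\<^bsub>A\<^esub> (x \<otimes>\<^bsub>A\<^esub> y) = (c \<odot>\<^bsub>A\<^esub> x) \<otimes>\<^bsub>A\<^esub> y"
    and smult_mult_right:
      "\<lbrakk>x \<in> carrier A; y \<in> carrier A\<rbrakk> \<Longrightarrow>
        c \<odot>\<^bsub>A\<^esub> (x \<otimes>\<^bsub>A\<^esub> y) = x \<otimes>\<^bsub>A\<^esub> (c \<odot>\<^bsub>A\<^esub> y)"

text \<open>
  As usual for records extending \<^typ>\<open>('k, 'm) module\<close>, the inherited fields \<open>mult\<close> and \<open>one\<close>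
  carry no meaning for a module.
\<close>

record ('k, 'a, 'm) rmod = "('k, 'm) module" +
  ract :: "'m \<Rightarrow> 'a \<Rightarrow> 'm"  (infixl \<open>\<star>\<index>\<close> 70)

locale fd_right_module = fd_algebra A
  for A :: "('k::field, 'a, 'z) module_scheme" +
  fixes M :: "('k, 'a, 'm, 'y) rmod_scheme"
  assumes vectorspace_M: "vectorspace class_ring M"
    and fin_dim_M: "vectorspace.fin_dim class_ring M"
    and ract_closed: "\<lbrakk>m \<in> carrier M; a \<in> carrier A\<rbrakk> \<Longrightarrow> m \<star>\<^bsub>M\<^esub> a \<in> carrier M"
    and ract_add_left:
      "\<lbrakk>m \<in> carrier M; n \<in> carrier M; a \<in> carrier A\<rbrakk> \<Longrightarrow>
        (m \<oplus>\<^bsub>M\<^esub> n) \<star>\<^bsub>M\<^esub> a = m \<star>\<^bsub>M\<^esub> a \<oplus>\<^bsub>M\<^esub> n \<star>\<^bsub>M\<^esub> a"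
    and ract_add_right:
      "\<lbrakk>m \<in> carrier M; a \<in> carrier A; b \<in> carrier A\<rbrakk> \<Longrightarrow>
        m \<star>\<^bsub>M\<^esub> (a \<oplus>\<^bsub>A\<^esub> b) = m \<star>\<^bsub>M\<^esub> a \<oplus>\<^bsub>M\<^esub> m \<star>\<^bsub>M\<^esub> b"
    and ract_mult:
      "\<lbrakk>m \<in> carrier M; a \<in> carrier A; b \<in> carrier A\<rbrakk> \<Longrightarrow>
        m \<star>\<^bsub>M\<^esub> (a \<otimes>\<^bsub>A\<^esub> b) = (m \<star>\<^bsub>M\<^esub> a) \<star>\<^bsub>M\<^esub> b"
    and ract_one: "m \<in> carrier M \<Longrightarrow> m \<star>\<^bsub>M\<^esub> \<one>\<^bsub>A\<^esub> = m"
    and ract_smult_left: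
      "\<lbrakk>m \<in> carrier M; a \<in> carrier A\<rbrakk> \<Longrightarrow>
        (c \<odot>\<^bsub>M\<^esub> m) \<star>\<^bsub>M\<^esub> a = c \<odot>\<^bsub>M\<^esub> (m \<star>\<^bsub>M\<^esub> a)"
    and ract_smult_right:
      "\<lbrakk>m \<in> carrier M; a \<in> carrier A\<rbrakk> \<Longrightarrow>
        m \<star>\<^bsub>M\<^esub> (c \<odot>\<^bsub>A\<^esub> a) = c \<odot>\<^bsub>M\<^esub> (m \<star>\<^bsub>M\<^esub> a)"

definition rsubmodule ::
    "('k::field, 'a, 'z) module_scheme \<Rightarrow> ('k, 'a, 'm, 'y) rmod_scheme \<Rightarrow> 'm set \<Rightarrow> bool" where
  "rsubmodule A M U \<longleftrightarrow>
     VectorSpace.subspace class_ring U M \<and> (\<forall>u\<in>U. \<forall>a\<in>carrier A. u \<star>\<^bsub>M\<^esub> a \<in> U)"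

abbreviation sub_rmod ::
    "('k, 'a, 'm, 'y) rmod_scheme \<Rightarrow> 'm set \<Rightarrow> ('k, 'a, 'm, 'y) rmod_scheme" where
  "sub_rmod M U \<equiv> M\<lparr>carrier := U\<rparr>"

definition quot_rmod ::
    "('k, 'a, 'm, 'y) rmod_scheme \<Rightarrow> 'm set \<Rightarrow> ('k, 'a, 'm set) rmod" where
  "quot_rmod M U =
     \<lparr>carrier = a_rcosets\<^bsub>M\<^esub> U, monoid.mult = (\<lambda>X Y. U), one = U, zero = U, add = set_add M,
      smult = (\<lambda>c X. \<Union>x\<in>X. U +>\<^bsub>M\<^esub> (c \<odot>\<^bsub>M\<^esub> x)),
      ract = (\<lambda>X a. \<Union>x\<in>X. U +>\<^bsub>M\<^esub> (x \<star>\<^bsub>M\<^esub> a))\<rparr>"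

definition sum_rmod ::
    "('k, 'a, 'm, 'y) rmod_scheme \<Rightarrow> ('k, 'a, 'n, 'x) rmod_scheme \<Rightarrow> ('k, 'a, 'm \<times> 'n) rmod" where
  "sum_rmod M N =
     module.extend (direct_sum M N)
       (rmod.fields (\<lambda>v a. (fst v \<star>\<^bsub>M\<^esub> a, snd v \<star>\<^bsub>N\<^esub> a)))"

definition rmod_hom ::
    "('k::field, 'a, 'z) module_scheme \<Rightarrow> ('k, 'a, 'm, 'y) rmod_scheme \<Rightarrow>
     ('k, 'a, 'n, 'x) rmod_scheme \<Rightarrow> ('m \<Rightarrow> 'n) set" where
  "rmod_hom A M N =
     {f \<in> module_hom class_ring M N.
        \<forall>m\<in>carrier M. \<forall>a\<in>carrier A. f (m \<star>\<^bsub>M\<^esub> a) = f m \<star>\<^bsub>N\<^esub> a}"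

definition rmod_iso ::
    "('k::field, 'a, 'z) module_scheme \<Rightarrow> ('k, 'a, 'm, 'y) rmod_scheme \<Rightarrow>
     ('k, 'a, 'n, 'x) rmod_scheme \<Rightarrow> bool" where
  "rmod_iso A M N \<longleftrightarrow> (\<exists>f \<in> rmod_hom A M N. bij_betw f (carrier M) (carrier N))"

text \<open>
  The set of submodules \<open>U\<close> of \<open>M\<close> with \<open>Hom\<^sub>A(U, M/U) = 0\<close>. Homomorphisms are functions on the
  whole type of which only the values on the carrier matter.
\<close>

definition hom_orthogonal_submodules ::
    "('k::field, 'a, 'z) module_scheme \<Rightarrow> ('k, 'a, 'm, 'y) rmod_scheme \<Rightarrow> 'm set set"
    (\<open>\<S>\<close>) where
  "\<S> A M = {U. rsubmodule A M U \<and>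
     (\<forall>f \<in> rmod_hom A (sub_rmod M U) (quot_rmod M U). \<forall>u\<in>U. f u = \<zero>\<^bsub>quot_rmod M U\<^esub>)}"


section \<open>Torsion classes\<close>

text \<open>
  The objects of \<open>mod A\<close> are taken with underlying set contained in the type \<^typ>\<open>'k vec\<close>, which
  contains all the spaces \<open>k\<^sup>n\<close>, so every finite-dimensional module is isomorphic to an object. As
  torsion classes are closed under isomorphism, the choice of this universe does not affect their
  inclusion order. \<open>in_class\<close> extends membership in an isomorphism-closed class to
  modules over arbitrary types.
\<close>

definition mod_cat ::
    "('k::field, 'a, 'z) module_scheme \<Rightarrow> ('k, 'a, 'k vec) rmod set" where
  "mod_cat A = {X. fd_right_module A X}"

definition in_class ::
    "('k::field, 'a, 'z) module_scheme \<Rightarrow> ('k, 'a, 'k vec) rmod set \<Rightarrow>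
     ('k, 'a, 'm, 'y) rmod_scheme \<Rightarrow> bool" where
  "in_class A \<T> X \<longleftrightarrow> (\<exists>Y\<in>\<T>. rmod_iso A X Y)"

definition tors ::
    "('k::field, 'a, 'z) module_scheme \<Rightarrow> ('k, 'a, 'k vec) rmod set set" where
  "tors A = {\<T>. \<T> \<subseteq> mod_cat A
     \<and> (\<forall>X\<in>\<T>. \<forall>Y\<in>mod_cat A. rmod_iso A X Y \<longrightarrow> Y \<in> \<T>)
     \<and> (\<forall>Z\<in>mod_cat A. carrier Z = {\<zero>\<^bsub>Z\<^esub>} \<longrightarrow> Z \<in> \<T>)
     \<and> (\<forall>X\<in>\<T>. \<forall>Y\<in>\<T>. in_class A \<T> (sum_rmod X Y))
     \<and> (\<forall>X\<in>\<T>. \<forall>U. rsubmodule A X U \<longrightarrow> in_class A \<T> (quot_rmod X U))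
     \<and> (\<forall>Y\<in>mod_cat A. \<forall>U. rsubmodule A Y U \<and> in_class A \<T> (sub_rmod Y U)
            \<and> in_class A \<T> (quot_rmod Y U) \<longrightarrow> Y \<in> \<T>)}"

definition tors_interval ::
    "('k::field, 'a, 'z) module_scheme \<Rightarrow> ('k, 'a, 'k vec) rmod set \<Rightarrow>
     ('k, 'a, 'k vec) rmod set \<Rightarrow> ('k, 'a, 'k vec) rmod set set" where
  "tors_interval A \<T>\<^sub>1 \<T>\<^sub>2 = {\<T> \<in> tors A. \<T>\<^sub>1 \<subseteq> \<T> \<and> \<T> \<subseteq> \<T>\<^sub>2}"

definition torsion_part ::
    "('k::field, 'a, 'z) module_scheme \<Rightarrow> ('k, 'a, 'k vec) rmod set \<Rightarrow>
     ('k, 'a, 'm, 'y) rmod_scheme \<Rightarrow> 'm set" where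
  "torsion_part A \<T> M = (GREATEST U. rsubmodule A M U \<and> in_class A \<T> (sub_rmod M U))"


section \<open>Grassmannians and their Zariski topology\<close>

definition grassmannian :: "nat \<Rightarrow> ('k::field, 'm, 'y) module_scheme \<Rightarrow> 'm set set" where
  "grassmannian s V =
     {U. VectorSpace.subspace class_ring U V \<and>
         vectorspace.dim class_ring (V\<lparr>carrier := U\<rparr>) = s}"

definition rmod_grassmannian ::
    "('k::field, 'a, 'z) module_scheme \<Rightarrow> nat \<Rightarrow> ('k, 'a, 'm, 'y) rmod_scheme \<Rightarrow> 'm set set" where
  "rmod_grassmannian A s M = {U \<in> grassmannian s M. rsubmodule A M U}"

definition ordered_basis :: "('k::field, 'm, 'y) module_scheme \<Rightarrow> 'm list \<Rightarrow> bool" where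
  "ordered_basis V bs \<longleftrightarrow> distinct bs \<and> vectorspace.basis class_ring V (set bs)"

definition coords :: "('k::field, 'm, 'y) module_scheme \<Rightarrow> 'm list \<Rightarrow> 'm \<Rightarrow> 'k vec" where
  "coords V bs v =
     (THE x. x \<in> carrier_vec (length bs) \<and> v = module.lincomb_list V (\<lambda>i. x $ i) bs)"

text \<open>
  The Pluecker coordinates of the span of \<open>us\<close> with respect to the basis \<open>bs\<close> of \<open>V\<close>: the
  coordinate vectors of \<open>us\<close> are the rows of a matrix, and the coordinate at an index set \<open>I\<close> of
  size \<open>length us\<close> is the maximal minor on the columns in \<open>I\<close>.
\<close>

definition pluecker ::
    "('k::field, 'm, 'y) module_scheme \<Rightarrow> 'm list \<Rightarrow> 'm list \<Rightarrow> nat set \<Rightarrow> 'k" where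
  "pluecker V bs us I =
     Determinant.det (submatrix (mat_of_rows (length bs) (map (coords V bs) us)) UNIV I)"

text \<open>
  Multivariate polynomials over \<open>'k\<close> with variables indexed by \<open>'i\<close>; monomials are
  finitely supported exponent functions.
\<close>

definition poly_eval :: "('i \<Rightarrow> 'k) \<Rightarrow> (('i \<Rightarrow>\<^sub>0 nat) \<Rightarrow>\<^sub>0 'k) \<Rightarrow> 'k::comm_semiring_1" where
  "poly_eval x f =
     (\<Sum>m\<in>Poly_Mapping.keys f. Poly_Mapping.lookup f m * (\<Prod>i\<in>Poly_Mapping.keys m. x i ^ Poly_Mapping.lookup m i))"

definition homogeneous :: "nat \<Rightarrow> (('i \<Rightarrow>\<^sub>0 nat) \<Rightarrow>\<^sub>0 'k::zero) \<Rightarrow> bool" where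
  "homogeneous n f \<longleftrightarrow> (\<forall>m\<in>Poly_Mapping.keys f. (\<Sum>i\<in>Poly_Mapping.keys m. Poly_Mapping.lookup m i) = n)"

definition poly_vars :: "(('i \<Rightarrow>\<^sub>0 nat) \<Rightarrow>\<^sub>0 'k::zero) \<Rightarrow> 'i set" where
  "poly_vars f = (\<Union>m\<in>Poly_Mapping.keys f. Poly_Mapping.keys m)"

text \<open>
  The Zariski topology on the set of \<open>k\<close>-rational points of the Grassmannian of
  \<open>s\<close>-dimensional subspaces, induced by the Pluecker embedding: the nonvanishing loci of homogeneous
  polynomials in the Pluecker coordinates form a base of the open sets. Changing the
  basis of \<open>U\<close> multiplies all Pluecker coordinates by the same nonzero scalar, so (non)vanishing of
  a homogeneous polynomial does not depend on it; changing the basis \<open>bs\<close> of \<open>V\<close> transforms the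
  coordinates by an invertible linear substitution, so the topology does not depend on \<open>bs\<close>.
\<close>

definition pluecker_basic_open ::
    "('k::field, 'm, 'y) module_scheme \<Rightarrow> 'm list \<Rightarrow> nat \<Rightarrow> ((nat set \<Rightarrow>\<^sub>0 nat) \<Rightarrow>\<^sub>0 'k) \<Rightarrow>
     'm set set" where
  "pluecker_basic_open V bs s f =
     {U \<in> grassmannian s V.
        \<forall>us. ordered_basis (V\<lparr>carrier := U\<rparr>) us \<longrightarrow> poly_eval (pluecker V bs us) f \<noteq> 0}"

definition grassmannian_topology ::
    "('k::field, 'm, 'y) module_scheme \<Rightarrow> 'm list \<Rightarrow> nat \<Rightarrow> 'm set topology" where
  "grassmannian_topology V bs s =
     topology_generated_by
       {pluecker_basic_open V bs s f | f n.
          homogeneous n f \<and> poly_vars f \<subseteq> {I. I \<subseteq> {..<length bs} \<and> card I = s}}"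

definition isolated_point :: "'p topology \<Rightarrow> 'p \<Rightarrow> bool" where
  "isolated_point X p \<longleftrightarrow> openin X {p}"

end

theory Submission
  imports Defs
begin

text \<open>
  The tangent space of \<open>Gr\<^sub>A(s, M)\<close> at \<open>U\<close> is \<open>Hom\<^sub>A(U, M/U)\<close>. Concretely, in an affine chart around \<open>U\<close>
  with coordinate vector \<open>y\<close>, being a submodule amounts to equations \<open>L y = Q(y) y\<close> with \<open>L\<close> and \<open>Q\<close>
  linear, and \<open>Hom\<^sub>A(U, M/U) = 0\<close> says that \<open>L\<close> is injective. Choosing a square subsystem with
  \<open>det L \<noteq> 0\<close>, the polynomial \<open>det (L - Q(y))\<close> is nonzero at \<open>y = 0\<close> and vanishes at every other
  submodule of the chart; homogenized in the Pluecker coordinates, it isolates \<open>U\<close>. The degree of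
  this form depends only on \<open>s\<close> and \<open>dim M\<close>, and the forms belonging to distinct \<open>U\<close> are linearly
  independent, so there are only finitely many \<open>U\<close>.

  A torsion part \<open>U\<close> of \<open>M\<close> satisfies \<open>Hom\<^sub>A(U, M/U) = 0\<close> because the preimage in \<open>M\<close> of the image of
  \<open>U \<rightarrow> M/U\<close> is an extension of torsion modules. Conversely the torsion classes with torsion part \<open>U\<close>
  form the interval from the torsion class generated by \<open>U\<close> to the class of all \<open>X\<close> with
  \<open>Hom\<^sub>A(X, M/U) = 0\<close>.
\<close>

section \<open>Homogeneous polynomial functions\<close>

text \<open>The field is arbitrary, possibly finite, and only rational points are considered, so
  isolation and finiteness are both read off from explicit forms instead of from scheme theory.
  Several choices keep these forms uniform. All \<open>s * d\<close> entries of a chart matrix stay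
  unknowns, and the \<open>s\<close> columns normalized to the identity are fixed by extra linear
  equations; the size of the determinant is then the same for every \<open>U\<close>. Its entries
  are linear forms because Cramer's rule writes each chart coordinate as a quotient of two Pluecker
  coordinates with common denominator \<open>h\<close>. Outside the chart, where \<open>h\<close>
  vanishes, the determinant carries no information, so it is multiplied by \<open>h\<close>; hence
  the degree \<open>s * d + 1\<close>. The algebra may be an infinite set, and so may the system of
  equations; a trivial kernel survives in finitely many of them. In the part on torsion classes the
  obstacle is the fixed universe: submodules and quotients of \<open>M\<close> are not objects of
  \<open>mod_cat\<close>, so each closure property is first restated for
  \<open>in_class\<close>.\<close>

definition monomial_eval :: "('i \<Rightarrow> 'k) \<Rightarrow> ('i \<Rightarrow>\<^sub>0 nat) \<Rightarrow> 'k::comm_semiring_1" where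
  "monomial_eval x m = (\<Prod>i\<in>Poly_Mapping.keys m. x i ^ Poly_Mapping.lookup m i)"

definition monomial_degree :: "('i \<Rightarrow>\<^sub>0 nat) \<Rightarrow> nat" where
  "monomial_degree m = (\<Sum>i\<in>Poly_Mapping.keys m. Poly_Mapping.lookup m i)"

lemma monomial_eval_superset:
  assumes "finite S" "Poly_Mapping.keys m \<subseteq> S"
  shows "monomial_eval x m = (\<Prod>i\<in>S. x i ^ Poly_Mapping.lookup m i)"
  unfolding monomial_eval_def
  by (rule prod.mono_neutral_left) (use assms in \<open>auto simp: in_keys_iff\<close>)

lemma monomial_degree_superset:
  assumes "finite S" "Poly_Mapping.keys m \<subseteq> S"
  shows "monomial_degree m = (\<Sum>i\<in>S. Poly_Mapping.lookup m i)"
  unfolding monomial_degree_def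
  by (rule sum.mono_neutral_left) (use assms in \<open>auto simp: in_keys_iff\<close>)

lemma monomial_eval_add: "monomial_eval x (m + m') = monomial_eval x m * monomial_eval x m'"
proof -
  let ?S = "Poly_Mapping.keys m \<union> Poly_Mapping.keys m'"
  have "Poly_Mapping.keys (m + m') \<subseteq> ?S" by (rule keys_add)
  then show ?thesis
    by (simp add: monomial_eval_superset[of ?S] lookup_add power_add prod.distrib)
qed

lemma monomial_degree_add: "monomial_degree (m + m') = monomial_degree m + monomial_degree m'"
proof -
  let ?S = "Poly_Mapping.keys m \<union> Poly_Mapping.keys m'"
  have "Poly_Mapping.keys (m + m') \<subseteq> ?S" by (rule keys_add)
  then show ?thesis
    by (simp add: monomial_degree_superset[of ?S] lookup_add sum.distrib)
qed

lemma poly_eval_superset: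
  assumes "finite S" "Poly_Mapping.keys f \<subseteq> S"
  shows "poly_eval x f = (\<Sum>m\<in>S. Poly_Mapping.lookup f m * monomial_eval x m)"
  unfolding poly_eval_def monomial_eval_def
  by (rule sum.mono_neutral_left) (use assms in \<open>auto simp: in_keys_iff\<close>)

lemma poly_eval_eq: "poly_eval x f = (\<Sum>m\<in>Poly_Mapping.keys f. Poly_Mapping.lookup f m * monomial_eval x m)"
  by (rule poly_eval_superset) auto

lemma poly_eval_add: "poly_eval x (f + g) = poly_eval x f + poly_eval x g"
proof -
  let ?S = "Poly_Mapping.keys f \<union> Poly_Mapping.keys g"
  have "Poly_Mapping.keys (f + g) \<subseteq> ?S" by (rule keys_add)
  then show ?thesis
    by (simp add: poly_eval_superset[of ?S] lookup_add sum.distrib distrib_right)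
qed

lemma poly_eval_single: "poly_eval x (Poly_Mapping.single m c) = c * monomial_eval x m"
  by (subst poly_eval_superset[of "{m}"]) auto

text \<open>Functions instead of polynomials: closure under sums, products and determinants becomes
  a pointwise statement, and outside this section a polynomial is recovered only to name a basic
  open set. Over a finite field several polynomials give the same function, which is harmless since
  only values at Pluecker vectors are compared.\<close>

definition forms :: "'i set \<Rightarrow> nat \<Rightarrow> (('i \<Rightarrow> 'k) \<Rightarrow> 'k::comm_semiring_1) set" where
  "forms V n = {g. \<exists>f. homogeneous n f \<and> poly_vars f \<subseteq> V \<and> g = (\<lambda>x. poly_eval x f)}"

lemma formsE:
  assumes "g \<in> forms V n"
  obtains f where "homogeneous n f" "poly_vars f \<subseteq> V" "g = (\<lambda>x. poly_eval x f)"
  using assms by (auto simp: forms_def)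

lemma forms_monomial:
  assumes "Poly_Mapping.keys m \<subseteq> V" "monomial_degree m = n"
  shows "(\<lambda>x. c * monomial_eval x m) \<in> forms V n"
  unfolding forms_def mem_Collect_eq
  by (rule exI[of _ "Poly_Mapping.single m c"])
    (use assms in \<open>auto simp: poly_eval_single homogeneous_def poly_vars_def monomial_degree_def\<close>)

lemma forms_zero: "(\<lambda>x. 0) \<in> forms V n"
  unfolding forms_def mem_Collect_eq
  by (rule exI[of _ 0]) (auto simp: poly_eval_def homogeneous_def poly_vars_def)

lemma forms_add:
  assumes "f \<in> forms V n" "g \<in> forms V n"
  shows "(\<lambda>x. f x + g x) \<in> forms V n"
proof -
  obtain f' where f': "homogeneous n f'" "poly_vars f' \<subseteq> V" "f = (\<lambda>x. poly_eval x f')"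
    using assms(1) by (rule formsE)
  obtain g' where g': "homogeneous n g'" "poly_vars g' \<subseteq> V" "g = (\<lambda>x. poly_eval x g')"
    using assms(2) by (rule formsE)
  have k: "Poly_Mapping.keys (f' + g') \<subseteq> Poly_Mapping.keys f' \<union> Poly_Mapping.keys g'" by (rule keys_add)
  have "homogeneous n (f' + g')" using f' g' k unfolding homogeneous_def by blast
  moreover have "poly_vars (f' + g') \<subseteq> V" using f' g' k unfolding poly_vars_def by blast
  ultimately show ?thesis
    unfolding forms_def f' g' poly_eval_add[symmetric] by blast
qed

lemma forms_sum:
  assumes "\<And>i. i \<in> S \<Longrightarrow> g i \<in> forms V n"
  shows "(\<lambda>x. \<Sum>i\<in>S. g i x) \<in> forms V n"
  using assms
  by (induction S rule: infinite_finite_induct)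
    (auto simp: forms_zero forms_add)

text \<open>Expanding both factors gives a double sum of monomials whose degrees add, so
  \<open>forms_monomial\<close> and \<open>forms_sum\<close> suffice and no product of polynomials
  is formed.\<close>

lemma forms_mult:
  assumes "f \<in> forms V n" "g \<in> forms V n'"
  shows "(\<lambda>x. f x * g x) \<in> forms V (n + n')"
proof -
  obtain f' where f': "homogeneous n f'" "poly_vars f' \<subseteq> V" "f = (\<lambda>x. poly_eval x f')"
    using assms(1) by (rule formsE)
  obtain g' where g': "homogeneous n' g'" "poly_vars g' \<subseteq> V" "g = (\<lambda>x. poly_eval x g')"
    using assms(2) by (rule formsE)
  have "(\<lambda>x. f x * g x) =
      (\<lambda>x. \<Sum>m\<in>Poly_Mapping.keys f'. \<Sum>m'\<in>Poly_Mapping.keys g'. (Poly_Mapping.lookup f' m * Poly_Mapping.lookup g' m') * monomial_eval x (m + m'))"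
    unfolding f' g' poly_eval_eq sum_product
    by (intro ext sum.cong refl) (simp add: monomial_eval_add mult_ac)
  also have "\<dots> \<in> forms V (n + n')"
  proof (intro forms_sum forms_monomial)
    fix m m' assume m: "m \<in> Poly_Mapping.keys f'" "m' \<in> Poly_Mapping.keys g'"
    show "Poly_Mapping.keys (m + m') \<subseteq> V"
      using keys_add[of m m'] m f' g' unfolding poly_vars_def by blast
    show "monomial_degree (m + m') = n + n'"
      using m f' g' unfolding monomial_degree_add by (simp add: monomial_degree_def homogeneous_def)
  qed
  finally show ?thesis .
qed

lemma forms_const: "(\<lambda>x. c) \<in> forms V 0"
  using forms_monomial[of 0 V 0 c]
  by (simp add: monomial_eval_def monomial_degree_def)

lemma forms_var: "i \<in> V \<Longrightarrow> (\<lambda>x. x i) \<in> forms V 1"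
  using forms_monomial[of "Poly_Mapping.single i 1" V 1 1]
  by (simp add: monomial_eval_def monomial_degree_def)

lemma forms_scale:
  "f \<in> forms V n \<Longrightarrow> (\<lambda>x. c * f x) \<in> forms V n"
  using forms_mult[OF forms_const, of f V n c] by simp

lemma forms_diff:
  fixes f g :: "('i \<Rightarrow> 'k) \<Rightarrow> 'k::comm_ring_1"
  assumes "f \<in> forms V n" "g \<in> forms V n"
  shows "(\<lambda>x. f x - g x) \<in> forms V n"
  using forms_add[OF assms(1) forms_scale[OF assms(2), of "-1"]]
  by simp

lemma forms_prod:
  assumes "\<And>i. i \<in> S \<Longrightarrow> g i \<in> forms V n"
  shows "(\<lambda>x. \<Prod>i\<in>S. g i x) \<in> forms V (card S * n)"
  using assms
proof (induction S rule: infinite_finite_induct)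
  case (insert i S)
  then show ?case
    using forms_mult[of "g i" V n "\<lambda>x. \<Prod>i\<in>S. g i x" "card S * n"] by simp
qed (auto simp: forms_const)

text \<open>By the Leibniz formula each summand is a signed product of \<open>N\<close> entries,
  each of degree \<open>n\<close>.\<close>

lemma forms_det:
  fixes G :: "nat \<Rightarrow> nat \<Rightarrow> ('i \<Rightarrow> 'k) \<Rightarrow> 'k::comm_ring_1"
  assumes "\<And>i j. \<lbrakk>i < N; j < N\<rbrakk> \<Longrightarrow> G i j \<in> forms V n"
  shows "(\<lambda>x. Determinant.det (mat N N (\<lambda>(i, j). G i j x))) \<in> forms V (N * n)"
proof -
  have "(\<lambda>x. Determinant.det (mat N N (\<lambda>(i, j). G i j x))) =
      (\<lambda>x. \<Sum>p | p permutes {0..<N}. signof p * (\<Prod>i = 0..<N. G i (p i) x))"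
    by (intro ext, subst det_def', rule mat_carrier, intro sum.cong refl arg_cong[of _ _ "(*) _"] prod.cong)
      (use permutes_in_image in fastforce)
  also have "\<dots> \<in> forms V (N * n)"
  proof (intro forms_sum forms_scale)
    fix p assume "p \<in> {p. p permutes {0..<N}}"
    then have "p i < N" if "i < N" for i
      using permutes_in_image[of p "{0..<N}" i] that by simp
    then show "(\<lambda>x. \<Prod>i = 0..<N. G i (p i) x) \<in> forms V (N * n)"
      using forms_prod[of "{0..<N}" "\<lambda>i. G i (p i)" V n] assms by simp
  qed
  finally show ?thesis .
qed

section \<open>The finite-dimensional space of forms of a fixed degree\<close>

lemma finite_monomials:
  assumes "finite V"
  shows "finite {m. Poly_Mapping.keys m \<subseteq> V \<and> monomial_degree m = n}" (is "finite ?M")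
proof -
  have "Poly_Mapping.lookup ` ?M \<subseteq> {f. \<forall>i. (i \<in> V \<longrightarrow> f i \<in> {..n}) \<and> (i \<notin> V \<longrightarrow> f i = 0)}"
  proof (intro subsetI, clarsimp, intro conjI impI)
    fix m i assume m: "Poly_Mapping.keys m \<subseteq> V" "n = monomial_degree m"
    show "Poly_Mapping.lookup m i \<le> monomial_degree m" if "i \<in> V"
      using member_le_sum[OF that, of "Poly_Mapping.lookup m"] assms m
      by (simp add: monomial_degree_superset[OF assms])
    show "Poly_Mapping.lookup m i = 0" if "i \<notin> V"
      using that m by (auto simp: in_keys_iff)
  qed
  moreover have "finite {f. \<forall>i. (i \<in> V \<longrightarrow> f i \<in> {..n}) \<and> (i \<notin> V \<longrightarrow> f i = (0::nat))}"
    by (rule finite_set_of_finite_funs) (use assms in auto)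
  ultimately have "finite (Poly_Mapping.lookup ` ?M)" by (rule finite_subset)
  then show ?thesis
    by (rule finite_imageD) (simp add: inj_on_def lookup_inject)
qed

lemma forms_expand:
  assumes "finite V" "g \<in> forms V n"
  shows "\<exists>c. \<forall>x. g x = (\<Sum>m | Poly_Mapping.keys m \<subseteq> V \<and> monomial_degree m = n. c m * monomial_eval x m)"
proof -
  obtain f where f: "homogeneous n f" "poly_vars f \<subseteq> V" "g = (\<lambda>x. poly_eval x f)"
    using assms(2) by (rule formsE)
  have "Poly_Mapping.keys f \<subseteq> {m. Poly_Mapping.keys m \<subseteq> V \<and> monomial_degree m = n}"
    using f unfolding homogeneous_def poly_vars_def monomial_degree_def by blast
  from poly_eval_superset[OF finite_monomials[OF assms(1)] this] show ?thesis
    by (intro exI[of _ "Poly_Mapping.lookup f"] allI) (simp only: f(3))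
qed

text \<open>A rank argument: the matrix indexed by \<open>p\<close> and \<open>q\<close> is diagonal
  with nonzero diagonal, hence of rank \<open>card P\<close>, and it factors through
  \<open>R\<close>. It is carried out as elimination, removing one \<open>r\<close> and at most one
  row \<open>p\<close> at a time.\<close>

lemma card_le_of_diagonal_factorization:
  fixes c :: "'p \<Rightarrow> 'r \<Rightarrow> 'k::field"
  assumes "finite P" "finite R"
    and diag: "\<And>p q. \<lbrakk>p \<in> P; q \<in> P\<rbrakk> \<Longrightarrow> (\<Sum>r\<in>R. c p r * e r q) \<noteq> 0 \<longleftrightarrow> p = q"
  shows "card P \<le> card R"
  using assms(2,1) diag
proof (induction R arbitrary: P c rule: finite_induct)
  case empty
  have "P = {}"
  proof (rule ccontr)
    assume "P \<noteq> {}"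
    then obtain p where "p \<in> P" by blast
    from empty.prems(2)[OF this this] show False by simp
  qed
  then show ?case by simp
next
  case (insert r R)
  show ?case
  proof (cases "\<exists>p\<in>P. c p r \<noteq> 0")
    case False
    have "card P \<le> card R"
    proof (rule insert.IH[of P c])
      fix p q assume pq: "p \<in> P" "q \<in> P"
      then have "c p r = 0" using False by blast
      then show "(\<Sum>r\<in>R. c p r * e r q) \<noteq> 0 \<longleftrightarrow> p = q"
        using insert.prems(2)[OF pq] insert.hyps(1,2) by simp
    qed (rule insert.prems)
    then show ?thesis using insert.hyps(1,2) by simp
  next
    case True
    then obtain p0 where p0: "p0 \<in> P" "c p0 r \<noteq> 0" by blast
    \<comment> \<open>Row \<open>p0\<close> serves as pivot: the other rows lose their entry at
      \<open>r\<close>, and \<open>p0\<close> is given up together with \<open>r\<close>.\<close>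
    define c' where "c' p r' = c p r' - c p r / c p0 r * c p0 r'" for p r'
    have "card (P - {p0}) \<le> card R"
    proof (rule insert.IH[of _ c'])
      show "finite (P - {p0})" using insert.prems(1) by simp
      fix p q assume pq: "p \<in> P - {p0}" "q \<in> P - {p0}"
      have "c' p r = 0" using p0(2) by (simp add: c'_def)
      then have "(\<Sum>r\<in>R. c' p r * e r q) = (\<Sum>r\<in>insert r R. c' p r * e r q)"
        using insert.hyps(1,2) by simp
      also have "\<dots> = (\<Sum>r\<in>insert r R. c p r * e r q)
          - c p r / c p0 r * (\<Sum>r\<in>insert r R. c p0 r * e r q)"
        unfolding c'_def sum_distrib_left sum_subtractf[symmetric]
        by (rule sum.cong) (simp_all only: left_diff_distrib mult.assoc)
      \<comment> \<open>The pivot row has value zero at \<open>q\<close> because \<open>q\<close>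
        differs from \<open>p0\<close>, so the elimination keeps the diagonal shape.\<close>
      also have "(\<Sum>r\<in>insert r R. c p0 r * e r q) = 0"
        using insert.prems(2)[of p0 q] p0(1) pq by blast
      finally show "(\<Sum>r\<in>R. c' p r * e r q) \<noteq> 0 \<longleftrightarrow> p = q"
        using insert.prems(2)[of p q] pq by simp
    qed
    then show ?thesis
      unfolding card.remove[OF insert.prems(1) p0(1)] card.insert_remove[OF insert.hyps(1)]
      using insert.hyps(2) by simp
  qed
qed

text \<open>The value of \<open>g p\<close> at \<open>x q\<close> is the coefficient vector of
  \<open>g p\<close> times the vector of monomial values at \<open>x q\<close>; the diagonal shape
  bounds every finite part of \<open>P\<close> by the number of monomials of degree
  \<open>n\<close>. A common degree for all \<open>p\<close> is what makes this bound
  uniform.\<close>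

lemma finite_of_diagonal_forms:
  fixes g :: "'p \<Rightarrow> ('i \<Rightarrow> 'k) \<Rightarrow> 'k::field"
  assumes V: "finite V"
    and g: "\<And>p. p \<in> P \<Longrightarrow> g p \<in> forms V n"
    and diag: "\<And>p q. \<lbrakk>p \<in> P; q \<in> P\<rbrakk> \<Longrightarrow> g p (x q) \<noteq> 0 \<longleftrightarrow> p = q"
  shows "finite P"
proof -
  let ?M = "{m. Poly_Mapping.keys m \<subseteq> V \<and> monomial_degree m = n}"
  have "\<forall>p\<in>P. \<exists>c. \<forall>x. g p x = (\<Sum>m\<in>?M. c m * monomial_eval x m)"
  proof
    fix p assume "p \<in> P"
    then show "\<exists>c. \<forall>x. g p x = (\<Sum>m\<in>?M. c m * monomial_eval x m)"
      by (intro forms_expand V g)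
  qed
  from bchoice[OF this] obtain c
    where c: "\<And>p x. p \<in> P \<Longrightarrow> g p x = (\<Sum>m\<in>?M. c p m * monomial_eval x m)"
    by (elim exE) simp
  have "card Q \<le> card ?M" if "finite Q" "Q \<subseteq> P" for Q
  proof (rule card_le_of_diagonal_factorization[OF that(1) finite_monomials[OF V]])
    fix p q assume "p \<in> Q" "q \<in> Q"
    then show "(\<Sum>m\<in>?M. c p m * monomial_eval (x q) m) \<noteq> 0 \<longleftrightarrow> p = q"
      using diag[of p q] c[of p "x q"] that(2) by (simp add: subset_iff)
  qed
  then show ?thesis
    by (rule finite_if_finite_subsets_card_bdd[THEN conjunct1])
qed

section \<open>Isolated row spaces\<close>

text \<open>Gaussian elimination, by induction on the number of unknowns. \<open>E\<close> may be
  infinite, since the equations will come from all elements of the algebra.\<close>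

lemma exists_square_subsystem:
  fixes L :: "'e \<Rightarrow> nat \<Rightarrow> 'k::field"
  assumes "\<And>y. (\<forall>e\<in>E. (\<Sum>j<N. L e j * y j) = 0) \<Longrightarrow> \<forall>j<N. y j = 0"
  shows "\<exists>F. (\<forall>i<N. F i \<in> E) \<and>
    (\<forall>y. (\<forall>i<N. (\<Sum>j<N. L (F i) j * y j) = 0) \<longrightarrow> (\<forall>j<N. y j = 0))"
  using assms
proof (induction N arbitrary: L)
  case 0
  then show ?case by simp
next
  case (Suc N)
  \<comment> \<open>Otherwise the last unit vector would be a nonzero solution.\<close>
  have "\<exists>e\<in>E. L e N \<noteq> 0"
  proof (rule ccontr)
    assume "\<not> (\<exists>e\<in>E. L e N \<noteq> 0)"
    then have "\<forall>e\<in>E. (\<Sum>j<Suc N. L e j * (if j = N then 1 else 0)) = 0" by simp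
    then have "\<forall>j<Suc N. (if j = N then 1 else 0 :: 'k) = 0" by (rule Suc.prems)
    from this[rule_format, of N] show False by simp
  qed
  then obtain e0 where e0: "e0 \<in> E" "L e0 N \<noteq> 0" by blast
  \<comment> \<open>\<open>L'\<close> is the system with the last unknown eliminated by means of
    \<open>e0\<close>, and \<open>ext\<close> adds the value that \<open>e0\<close> dictates for the
    last unknown; so \<open>ext\<close> turns solutions of \<open>L'\<close> into solutions of
    \<open>L\<close>.\<close>
  define L' where "L' e j = L e j - L e N / L e0 N * L e0 j" for e j
  define ext where "ext y j = (if j = N then - (\<Sum>j<N. L e0 j * y j) / L e0 N else y j)" for y j
  have ext_N: "ext y N = - (\<Sum>j<N. L e0 j * y j) / L e0 N" for y by (simp add: ext_def)
  have ext_less: "(\<Sum>j<N. L e j * ext y j) = (\<Sum>j<N. L e j * y j)" for e y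
    by (rule sum.cong) (auto simp: ext_def)
  have L': "(\<Sum>j<N. L' e j * y j) = (\<Sum>j<N. L e j * y j) - L e N / L e0 N * (\<Sum>j<N. L e0 j * y j)" for e y
    by (simp only: L'_def left_diff_distrib sum_subtractf sum_distrib_left mult.assoc)
  have L_ext: "(\<Sum>j<Suc N. L e j * ext y j) = (\<Sum>j<N. L' e j * y j)" for e y
    unfolding sum.lessThan_Suc ext_less ext_N L' by simp
  have "\<exists>F. (\<forall>i<N. F i \<in> E) \<and>
      (\<forall>y. (\<forall>i<N. (\<Sum>j<N. L' (F i) j * y j) = 0) \<longrightarrow> (\<forall>j<N. y j = 0))"
  proof (rule Suc.IH)
    fix y :: "nat \<Rightarrow> 'k" assume "\<forall>e\<in>E. (\<Sum>j<N. L' e j * y j) = 0"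
    then have "\<forall>j<Suc N. ext y j = 0"
      by (intro Suc.prems) (simp only: L_ext)
    then have "ext y j = 0" if "j < N" for j using that less_SucI by blast
    moreover have "ext y j = y j" if "j < N" for j using that by (simp add: ext_def)
    ultimately show "\<forall>j<N. y j = 0" by metis
  qed
  then obtain F where F: "\<forall>i<N. F i \<in> E"
    "\<And>y. \<forall>i<N. (\<Sum>j<N. L' (F i) j * y j) = 0 \<Longrightarrow> \<forall>j<N. y j = 0" by blast
  let ?F = "F(N := e0)"
  have "\<forall>j<Suc N. y j = 0" if y: "\<forall>i<Suc N. (\<Sum>j<Suc N. L (?F i) j * y j) = 0" for y
  proof -
    have "(\<Sum>j<N. L e0 j * y j) + L e0 N * y N = 0"
      using y[rule_format, of N] by simp
    then have yN: "(\<Sum>j<N. L e0 j * y j) = - (L e0 N * y N)"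
      by (simp only: eq_neg_iff_add_eq_0)
    have "(\<Sum>j<N. L' (F i) j * y j) = 0" if "i < N" for i
    proof -
      have "(\<Sum>j<N. L (F i) j * y j) + L (F i) N * y N = 0"
        using y[rule_format, of i] that by simp
      then have "(\<Sum>j<N. L (F i) j * y j) = - (L (F i) N * y N)"
        by (simp only: eq_neg_iff_add_eq_0)
      then show ?thesis unfolding L' yN using e0(2) by simp
    qed
    then have "\<forall>i<N. (\<Sum>j<N. L' (F i) j * y j) = 0" by blast
    then have "\<forall>j<N. y j = 0" by (rule F(2))
    moreover from this have "(\<Sum>j<N. L e0 j * y j) = 0" by simp
    then have "L e0 N * y N = 0" using yN by simp
    ultimately show ?thesis using e0(2) by (metis less_SucE mult_eq_0_iff)
  qed
  moreover have "\<forall>i<Suc N. ?F i \<in> E" using F(1) e0(1) by (simp add: less_Suc_eq)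
  ultimately show ?case by blast
qed

lemma det_nonzero_iff_trivial_kernel:
  fixes G :: "nat \<Rightarrow> nat \<Rightarrow> 'k::field"
  shows "det (mat N N (\<lambda>(i, j). G i j)) \<noteq> 0 \<longleftrightarrow>
    (\<forall>y. (\<forall>i<N. (\<Sum>j<N. G i j * y j) = 0) \<longrightarrow> (\<forall>j<N. y j = 0))" (is "det ?A \<noteq> 0 \<longleftrightarrow> ?R")
proof -
  have A: "?A \<in> carrier_mat N N" by simp
  have mv: "?A *\<^sub>v vec N y = vec N (\<lambda>i. \<Sum>j<N. G i j * y j)" for y
    by (rule eq_vecI) (auto simp: scalar_prod_def atLeast0LessThan)
  have "det ?A = 0 \<longleftrightarrow> \<not> ?R"
    unfolding det_0_iff_vec_prod_zero_field[OF A]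
  proof (intro iffI)
    assume "\<exists>v. v \<in> carrier_vec N \<and> v \<noteq> 0\<^sub>v N \<and> ?A *\<^sub>v v = 0\<^sub>v N"
    then obtain v where v: "v \<in> carrier_vec N" "v \<noteq> 0\<^sub>v N" "?A *\<^sub>v v = 0\<^sub>v N" by blast
    have v': "v = vec N (($) v)" using v(1) by (intro eq_vecI) auto
    have "\<forall>i<N. (\<Sum>j<N. G i j * v $ j) = 0"
    proof (intro allI impI)
      fix i assume i: "i < N"
      have "(\<Sum>j<N. G i j * v $ j) = (?A *\<^sub>v vec N (($) v)) $ i" unfolding mv using i by simp
      also have "\<dots> = 0" using v(3) v' i by simp
      finally show "(\<Sum>j<N. G i j * v $ j) = 0" .
    qed
    moreover have "\<not> (\<forall>j<N. v $ j = 0)"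
    proof
      assume "\<forall>j<N. v $ j = 0"
      then have "v = 0\<^sub>v N" using v(1) by (intro eq_vecI) simp_all
      then show False using v(2) by contradiction
    qed
    ultimately show "\<not> ?R" by blast
  next
    assume "\<not> ?R"
    then obtain y j where y: "\<forall>i<N. (\<Sum>j<N. G i j * y j) = 0" "j < N" "y j \<noteq> 0" by blast
    have "vec N y \<noteq> 0\<^sub>v N" using y(2,3) by (metis index_vec index_zero_vec(1))
    moreover have "?A *\<^sub>v vec N y = 0\<^sub>v N" unfolding mv using y(1) by (intro eq_vecI) auto
    ultimately show "\<exists>v. v \<in> carrier_vec N \<and> v \<noteq> 0\<^sub>v N \<and> ?A *\<^sub>v v = 0\<^sub>v N"
      by (intro exI[of _ "vec N y"]) simp
  qed
  then show ?thesis by blast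
qed

text \<open>An element \<open>e\<close> of \<open>E\<close> encodes an equation with linear
  coefficients \<open>fst e\<close>, in which \<open>y q * y p\<close> has coefficient
  \<open>snd e p q\<close> on the right. Absorbing one factor of the quadratic part into the
  coefficients puts a solution \<open>y\<close> into the kernel of a matrix that depends on
  \<open>y\<close>. The condition \<open>z p x = h x * y p\<close> says that \<open>z\<close> and
  \<open>h\<close> are homogeneous coordinates of \<open>y\<close>. The degree counts one linear
  form for each row of the determinant and one more factor \<open>h\<close>, which makes
  \<open>g\<close> vanish off the chart.\<close>

lemma isolating_determinant:
  fixes P :: "'p set" and E :: "(('p \<Rightarrow> 'k::field) \<times> ('p \<Rightarrow> 'p \<Rightarrow> 'k)) set"
    and z :: "'p \<Rightarrow> ('i \<Rightarrow> 'k) \<Rightarrow> 'k"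
  assumes P: "finite P"
    and ker: "\<And>y. (\<forall>e\<in>E. (\<Sum>p\<in>P. fst e p * y p) = 0) \<Longrightarrow> \<forall>p\<in>P. y p = 0"
    and z: "\<And>p. p \<in> P \<Longrightarrow> z p \<in> forms V 1"
    and h: "h \<in> forms V 1"
  shows "\<exists>g\<in>forms V (card P + 1).
    (\<forall>x. h x = 0 \<longrightarrow> g x = 0) \<and>
    (\<forall>x y. h x \<noteq> 0 \<longrightarrow> (\<forall>p\<in>P. z p x = h x * y p) \<longrightarrow>
      (\<forall>e\<in>E. (\<Sum>p\<in>P. fst e p * y p) = (\<Sum>p\<in>P. (\<Sum>q\<in>P. snd e p q * y q) * y p)) \<longrightarrow>
      (g x \<noteq> 0 \<longleftrightarrow> (\<forall>p\<in>P. y p = 0)))"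
proof -
  define N where "N = card P"
  obtain b where b: "bij_betw b {..<N} P"
    using ex_bij_betw_nat_finite[OF P] unfolding N_def atLeast0LessThan by blast
  have sum_b: "(\<Sum>j<N. f (b j)) = (\<Sum>p\<in>P. f p)" for f :: "'p \<Rightarrow> 'k"
    by (rule sum.reindex_bij_betw[OF b])
  have bP: "b j \<in> P" if "j < N" for j using bij_betwE[OF b] that by simp
  have all_b: "(\<forall>j<N. f (b j)) \<longleftrightarrow> (\<forall>p\<in>P. f p)" for f
    using b unfolding bij_betw_def by auto
  have "\<exists>F. (\<forall>i<N. F i \<in> E) \<and>
    (\<forall>y. (\<forall>i<N. (\<Sum>j<N. fst (F i) (b j) * y j) = 0) \<longrightarrow> (\<forall>j<N. y j = 0))"
  proof (rule exists_square_subsystem)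
    fix y :: "nat \<Rightarrow> 'k" assume y: "\<forall>e\<in>E. (\<Sum>j<N. fst e (b j) * y j) = 0"
    have inv: "inv_into {..<N} b (b j) = j" if "j < N" for j
      using b that unfolding bij_betw_def by simp
    have "\<forall>p\<in>P. y (inv_into {..<N} b p) = 0"
    proof (rule ker)
      have "(\<Sum>p\<in>P. fst e p * y (inv_into {..<N} b p)) = (\<Sum>j<N. fst e (b j) * y j)" for e :: "('p \<Rightarrow> 'k) \<times> ('p \<Rightarrow> 'p \<Rightarrow> 'k)"
        unfolding sum_b[symmetric] by (rule sum.cong) (simp_all add: inv)
      then show "\<forall>e\<in>E. (\<Sum>p\<in>P. fst e p * y (inv_into {..<N} b p)) = 0" using y by simp
    qed
    then show "\<forall>j<N. y j = 0" using inv bP by metis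
  qed
  then obtain F where F: "\<And>i. i < N \<Longrightarrow> F i \<in> E"
    and F_ker: "\<forall>y. (\<forall>i<N. (\<Sum>j<N. fst (F i) (b j) * y j) = 0) \<longrightarrow> (\<forall>j<N. y j = 0)" by blast
  \<comment> \<open>On the chart this is \<open>h x\<close> times an entry of
    \<open>L - Q(y)\<close>; written with \<open>z\<close> it is a linear form in
    \<open>x\<close>.\<close>
  define G where "G i j x = fst (F i) (b j) * h x - (\<Sum>q\<in>P. snd (F i) (b j) q * z q x)" for i j x
  define D where "D x = det (mat N N (\<lambda>(i, j). G i j x))" for x
  have "D \<in> forms V (N * 1)"
    unfolding D_def
  proof (rule forms_det)
    fix i j
    show "G i j \<in> forms V 1"
      unfolding G_def
      by (intro forms_diff forms_scale forms_sum h z)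
  qed
  then have "(\<lambda>x. D x * h x) \<in> forms V (N * 1 + 1)"
    by (rule forms_mult[OF _ h])
  then have g: "(\<lambda>x. D x * h x) \<in> forms V (card P + 1)"
    by (simp only: N_def mult_1_right)
  have "D x \<noteq> 0 \<longleftrightarrow> (\<forall>p\<in>P. y p = 0)"
    if hx: "h x \<noteq> 0" and zx: "\<forall>p\<in>P. z p x = h x * y p"
      and eqs: "\<forall>e\<in>E. (\<Sum>p\<in>P. fst e p * y p) = (\<Sum>p\<in>P. (\<Sum>q\<in>P. snd e p q * y q) * y p)" for x y
  proof -
    have G: "G i j x = h x * (fst (F i) (b j) - (\<Sum>q\<in>P. snd (F i) (b j) q * y q))" for i j
      unfolding G_def right_diff_distrib sum_distrib_left using zx
      by (intro arg_cong2[of _ _ _ _ "(-)"] sum.cong) (simp_all add: mult_ac)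
    show ?thesis
    proof
      \<comment> \<open>The solution \<open>y\<close> itself lies in the kernel of the matrix with
        entries \<open>G i j x\<close>.\<close>
      assume "D x \<noteq> 0"
      then have ker_G: "\<forall>y. (\<forall>i<N. (\<Sum>j<N. G i j x * y j) = 0) \<longrightarrow> (\<forall>j<N. y j = 0)"
        unfolding D_def det_nonzero_iff_trivial_kernel .
      have "(\<Sum>j<N. G i j x * y (b j)) = 0" if i: "i < N" for i
      proof -
        have "(\<Sum>j<N. G i j x * y (b j)) =
          h x * ((\<Sum>j<N. fst (F i) (b j) * y (b j)) - (\<Sum>j<N. (\<Sum>q\<in>P. snd (F i) (b j) q * y q) * y (b j)))"
          unfolding G sum_subtractf[symmetric] sum_distrib_left
          by (rule sum.cong) (simp_all only: left_diff_distrib mult.assoc)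
        also have "\<dots> = h x * ((\<Sum>p\<in>P. fst (F i) p * y p) - (\<Sum>p\<in>P. (\<Sum>q\<in>P. snd (F i) p q * y q) * y p))"
          by (simp only: sum_b[of "\<lambda>p. fst (F i) p * y p"] sum_b[of "\<lambda>p. (\<Sum>q\<in>P. snd (F i) p q * y q) * y p"])
        also have "\<dots> = 0" using eqs F[OF i] by simp
        finally show ?thesis .
      qed
      then have "\<forall>j<N. y (b j) = 0" using ker_G[rule_format, of "\<lambda>j. y (b j)"] by blast
      then show "\<forall>p\<in>P. y p = 0" using all_b[of "\<lambda>p. y p = 0"] by blast
    next
      \<comment> \<open>At \<open>y = 0\<close> the quadratic contribution disappears, and only
        \<open>h x\<close> times the chosen square system remains.\<close>
      assume y0: "\<forall>p\<in>P. y p = 0"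
      have G': "G i j x = h x * fst (F i) (b j)" for i j
        unfolding G using y0 by simp
      show "D x \<noteq> 0"
        unfolding D_def det_nonzero_iff_trivial_kernel
      proof (intro allI impI)
        fix y' j assume y': "\<forall>i<N. (\<Sum>j<N. G i j x * y' j) = 0" and j: "j < N"
        have "(\<Sum>j<N. fst (F i) (b j) * y' j) = 0" if "i < N" for i
        proof -
          have "h x * (\<Sum>j<N. fst (F i) (b j) * y' j) = (\<Sum>j<N. G i j x * y' j)"
            unfolding G' sum_distrib_left mult.assoc ..
          then show ?thesis using y' that hx by simp
        qed
        then show "y' j = 0" using F_ker j by blast
      qed
    qed
  qed
  then show ?thesis by (intro bexI[OF _ g]) simp
qed

section \<open>Minors along lists of columns and Pluecker coordinates\<close>

definition select_cols :: "nat \<Rightarrow> nat list \<Rightarrow> 'k::comm_ring_1 mat" where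
  "select_cols d js = mat d (length js) (\<lambda>(j, k). if j = js ! k then 1 else 0)"

lemma select_cols_carrier [simp]: "select_cols d js \<in> carrier_mat d (length js)"
  by (simp add: select_cols_def)

lemma mult_select_cols_index:
  assumes "X \<in> carrier_mat s d" "set js \<subseteq> {..<d}" "i < s" "k < length js"
  shows "(X * select_cols d js) $$ (i, k) = X $$ (i, js ! k)"
proof -
  have k: "js ! k < d" using assms(2,4) nth_mem by blast
  have "(X * select_cols d js) $$ (i, k) =
      (\<Sum>j = 0..<d. X $$ (i, j) * (if j = js ! k then 1 else 0))"
    using assms by (simp add: scalar_prod_def select_cols_def)
  also have "\<dots> = (\<Sum>j = 0..<d. if j = js ! k then X $$ (i, j) else 0)"
    by (rule sum.cong) auto
  also have "\<dots> = X $$ (i, js ! k)" using k by simp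
  finally show ?thesis .
qed

abbreviation index_sets :: "nat \<Rightarrow> nat \<Rightarrow> nat set set" where
  "index_sets d s \<equiv> {I. I \<subseteq> {..<d} \<and> card I = s}"

text \<open>Columns are given by a list, not by a set, so that a single column can be replaced in
  place; the resulting list may be unsorted or repeat an index. Selecting columns by a matrix
  product turns compatibility with row operations into associativity.\<close>

definition column_minor :: "'k::comm_ring_1 mat \<Rightarrow> nat list \<Rightarrow> 'k" where
  "column_minor X js = det (X * select_cols (dim_col X) js)"

lemma column_minor_mult:
  assumes "G \<in> carrier_mat s s" "X \<in> carrier_mat s d" "length js = s"
  shows "column_minor (G * X) js = det G * column_minor X js"
proof -
  have E: "select_cols d js \<in> carrier_mat d s"
    using assms(3) select_cols_carrier by blast
  have "G * X * select_cols d js = G * (X * select_cols d js)"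
    by (rule assoc_mult_mat[OF assms(1,2) E])
  then show ?thesis
    using det_mult[OF assms(1) mult_carrier_mat[OF assms(2) E]] assms(2)
    by (simp add: column_minor_def)
qed

text \<open>Both matrices have the same columns, once in the order of \<open>js\<close> and once in
  increasing order; \<open>c\<close> is the sign of the sorting permutation and so does not depend
  on \<open>X\<close>.\<close>

lemma column_minor_eq_submatrix_det:
  assumes js: "distinct js" "set js \<subseteq> {..<d}"
  shows "\<exists>c::'k::comm_ring_1. \<forall>X\<in>carrier_mat (length js) d.
    column_minor X js = c * det (submatrix X UNIV (set js))"
proof -
  define s where "s = length js"
  define I where "I = set js"
  \<comment> \<open>The position of \<open>js ! k\<close> in the increasing enumeration of
    \<open>I\<close>; from \<open>s\<close> on it is the identity, as a permutation of
    \<open>{0..<s}\<close> has to be.\<close>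
  define \<sigma> where "\<sigma> k = (if k < s then card {a \<in> I. a < js ! k} else k)" for k
  have card_I: "card I = s" using js(1) by (simp add: I_def s_def distinct_card)
  have I_lt: "card {j. j < d \<and> j \<in> I} = s"
  proof -
    have "{j. j < d \<and> j \<in> I} = I" using js(2) by (auto simp: I_def)
    then show ?thesis using card_I by simp
  qed
  have pick: "pick I (\<sigma> k) = js ! k" if "k < s" for k
    using that pick_card_in_set[of "js ! k" I] by (simp add: \<sigma>_def I_def s_def)
  have \<sigma>_lt: "\<sigma> k < s" if "k < s" for k
  proof -
    have "js ! k \<in> I" using that by (simp add: I_def s_def)
    then have "{a \<in> I. a < js ! k} \<subset> I" by blast
    then have "card {a \<in> I. a < js ! k} < card I" by (intro psubset_card_mono) (simp_all add: I_def)
    then show ?thesis using that card_I by (simp add: \<sigma>_def)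
  qed
  have inj: "inj_on \<sigma> {0..<s}"
  proof (rule inj_onI)
    fix k k' assume k: "k \<in> {0..<s}" "k' \<in> {0..<s}" "\<sigma> k = \<sigma> k'"
    then have "js ! k = js ! k'" using pick[of k] pick[of k'] by simp
    then show "k = k'" using nth_eq_iff_index_eq[OF js(1)] k(1,2) by (simp add: s_def)
  qed
  have "\<sigma> ` {0..<s} = {0..<s}"
    using \<sigma>_lt by (intro endo_inj_surj inj) auto
  then have "bij_betw \<sigma> {0..<s} {0..<s}"
    using inj by (simp add: bij_betw_def)
  then have perm: "\<sigma> permutes {0..<s}"
    by (rule bij_imp_permutes) (simp add: \<sigma>_def)
  have "column_minor X js = signof \<sigma> * det (submatrix X UNIV I)" if X: "X \<in> carrier_mat s d" for X :: "'k mat"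
  proof -
    let ?S = "submatrix X UNIV I"
    have S: "?S \<in> carrier_mat s s"
      using X I_lt by (intro carrier_matI) (simp_all add: dim_submatrix)
    have S_ij: "?S $$ (i, j) = X $$ (i, pick I j)" if "i < s" "j < s" for i j
      using submatrix_index[of i X UNIV j I] that X I_lt by (simp add: pick_UNIV)
    have XE: "X * select_cols d js \<in> carrier_mat s s"
      unfolding s_def by (rule mult_carrier_mat[OF X[unfolded s_def] select_cols_carrier])
    \<comment> \<open>The comparison is transposed because the permutation lemma for determinants
      acts on rows.\<close>
    have "(X * select_cols d js)\<^sup>T = mat s s (\<lambda>(i, j). ?S\<^sup>T $$ (\<sigma> i, j))"
    proof (rule eq_matI)
      fix k i assume "k < dim_row (mat s s (\<lambda>(i, j). ?S\<^sup>T $$ (\<sigma> i, j)))"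
        "i < dim_col (mat s s (\<lambda>(i, j). ?S\<^sup>T $$ (\<sigma> i, j)))"
      then have ki: "k < s" "i < s" by auto
      have "(X * select_cols d js)\<^sup>T $$ (k, i) = X $$ (i, js ! k)"
        using mult_select_cols_index[OF X js(2), of i k] ki
        by (subst index_transpose_mat(1)) (simp_all only: carrier_matD[OF XE] s_def)
      also have "\<dots> = ?S\<^sup>T $$ (\<sigma> k, i)"
        using S S_ij[of i "\<sigma> k"] ki \<sigma>_lt[OF ki(1)] pick[OF ki(1)] by simp
      finally show "(X * select_cols d js)\<^sup>T $$ (k, i) = mat s s (\<lambda>(i, j). ?S\<^sup>T $$ (\<sigma> i, j)) $$ (k, i)"
        using ki by simp
    qed (use XE in auto)
    then have "det ((X * select_cols d js)\<^sup>T) = signof \<sigma> * det (?S\<^sup>T)"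
      using det_permute_rows[of "?S\<^sup>T" s \<sigma>] S perm by simp
    then show ?thesis
      using X by (simp add: column_minor_def det_transpose[OF XE] det_transpose[OF S])
  qed
  then show ?thesis unfolding s_def I_def by blast
qed

text \<open>For distinct indices this is a Pluecker coordinate up to sign; for a repeated index two
  columns agree and the zero form serves. Either way \<open>h\<close> is chosen before
  \<open>X\<close>.\<close>

lemma column_minor_homogeneous:
  assumes js: "length js = s" "set js \<subseteq> {..<d}"
  shows "\<exists>h\<in>forms (index_sets d s) 1.
    \<forall>X\<in>carrier_mat s d. column_minor X js = (h (\<lambda>I. det (submatrix X UNIV I)) :: 'k::comm_ring_1)"
proof (cases "distinct js")
  case True
  obtain c :: 'k where c: "\<forall>X\<in>carrier_mat s d. column_minor X js = c * det (submatrix X UNIV (set js))"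
    using column_minor_eq_submatrix_det[OF True js(2)] js(1) by blast
  have "(\<lambda>x. c * x (set js)) \<in> forms (index_sets d s) 1"
    using js True distinct_card by (intro forms_scale forms_var) auto
  then show ?thesis using c by (intro bexI) auto
next
  case False
  then obtain k k' where k: "k < s" "k' < s" "k \<noteq> k'" "js ! k = js ! k'"
    using js(1) by (auto simp: distinct_conv_nth)
  have "column_minor X js = 0" if X: "X \<in> carrier_mat s d" for X :: "'k mat"
  proof -
    have XE: "X * select_cols d js \<in> carrier_mat s s"
      using mult_carrier_mat[OF X select_cols_carrier[of d js]] js(1) by simp
    have "col (X * select_cols d js) k = col (X * select_cols d js) k'"
    proof (rule eq_vecI)
      fix i assume "i < dim_vec (col (X * select_cols d js) k')"
      then have i: "i < s" by (simp only: dim_col carrier_matD[OF XE])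
      have "col (X * select_cols d js) l $ i = X $$ (i, js ! l)" if "l < s" for l
        using mult_select_cols_index[OF X js(2) i, of l] XE i that js(1)
        by (subst index_col) (simp_all only: carrier_matD[OF XE])
      then show "col (X * select_cols d js) k $ i = col (X * select_cols d js) k' $ i"
        using k by (simp only:)
    qed (simp only: dim_col)
    then have "det (X * select_cols d js) = 0"
      by (rule det_identical_columns[OF XE k(3,1,2)])
    then show ?thesis using X by (simp add: column_minor_def)
  qed
  then show ?thesis by (intro bexI[OF _ forms_zero]) simp
qed


section \<open>The affine chart in matrix entries\<close>

lemma mult_mat_index_sum:
  assumes "A \<in> carrier_mat m n" "B \<in> carrier_mat n q" "i < m" "j < q"
  shows "(A * B) $$ (i, j) = (\<Sum>k<n. A $$ (i, k) * B $$ (k, j))"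
  using assms by (simp add: scalar_prod_def atLeast0LessThan)

lemma sum_Times_row:
  fixes f :: "'b \<Rightarrow> 'k::comm_ring_1"
  assumes "finite S" "i \<in> S"
  shows "(\<Sum>p\<in>S \<times> T. (if fst p = i then f (snd p) else 0) * y p) = (\<Sum>j\<in>T. f j * y (i, j))"
proof -
  have "(\<Sum>p\<in>S \<times> T. (if fst p = i then f (snd p) else 0) * y p) =
      (\<Sum>a\<in>S. \<Sum>b\<in>T. (if a = i then f b else 0) * y (a, b))"
    by (simp add: sum.cartesian_product case_prod_unfold)
  also have "\<dots> = (\<Sum>a\<in>S. if a = i then \<Sum>b\<in>T. f b * y (i, b) else 0)"
    by (rule sum.cong) auto
  finally show ?thesis using assms by simp
qed

lemma sum_Times_column:
  fixes f :: "'a \<Rightarrow> 'k::comm_ring_1"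
  assumes "finite T" "j \<in> T"
  shows "(\<Sum>p\<in>S \<times> T. (if snd p = j then f (fst p) else 0) * y p) = (\<Sum>i\<in>S. f i * y (i, j))"
proof -
  have "(\<Sum>p\<in>S \<times> T. (if snd p = j then f (fst p) else 0) * y p) =
      (\<Sum>a\<in>S. \<Sum>b\<in>T. (if b = j then f a else 0) * y (a, b))"
    by (simp add: sum.cartesian_product case_prod_unfold)
  also have "\<dots> = (\<Sum>a\<in>S. \<Sum>b\<in>T. if b = j then f a * y (a, b) else 0)"
    by (intro sum.cong refl) simp
  finally show ?thesis using assms by simp
qed

lemma matrix_inverse_exists:
  fixes A :: "'k::field mat"
  assumes A: "A \<in> carrier_mat s s" and "det A \<noteq> 0"
  obtains B where "B \<in> carrier_mat s s" "A * B = 1\<^sub>m s" "B * A = 1\<^sub>m s"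
  using det_non_zero_imp_unit[OF assms, of "()"]
  unfolding Units_def ring_mat_def by auto

text \<open>
  Row spaces of full-rank matrices are compared in the affine chart where the columns \<open>js\<close> form
  the identity matrix. There, with \<open>Y = X - X0\<close>, stability under \<open>R\<close> reads
  \<open>Y R - (X0 R E) Y - (Y R E) X0 = (Y R E) Y\<close>, a linear form in \<open>Y\<close> equal to a quadratic one.
\<close>

lemma chart_equation:
  fixes X X0 R :: "'k::field mat"
  assumes X: "X \<in> carrier_mat s d" and X0: "X0 \<in> carrier_mat s d" and R: "R \<in> carrier_mat d d"
    and E: "E \<in> carrier_mat d s" and XE: "X * E = 1\<^sub>m s" and X0E: "X0 * E = 1\<^sub>m s"
    and C: "C \<in> carrier_mat s s" "X * R = C * X"
    and C0: "C0 \<in> carrier_mat s s" "X0 * R = C0 * X0"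
    and Y: "Y \<in> carrier_mat s d" "X = X0 + Y"
  shows "Y * R = (X0 * (R * E)) * Y + (Y * (R * E)) * X0 + (Y * (R * E)) * Y"
proof -
  have RE: "R * E \<in> carrier_mat d s" by (rule mult_carrier_mat[OF R E])
  \<comment> \<open>The matrix of the action is determined by the stable row space: multiply by
    \<open>E\<close> and use that \<open>Z * E\<close> is the identity.\<close>
  have C_eq: "C' = Z * (R * E)" if "Z \<in> carrier_mat s d" "C' \<in> carrier_mat s s" "Z * R = C' * Z" "Z * E = 1\<^sub>m s" for Z C'
  proof -
    have "Z * (R * E) = Z * R * E" by (rule assoc_mult_mat[OF that(1) R E, symmetric])
    also have "\<dots> = C' * (Z * E)" unfolding that(3) by (rule assoc_mult_mat[OF that(2,1) E])
    also have "\<dots> = C'" unfolding that(4) by (rule right_mult_one_mat[OF that(2)])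
    finally show ?thesis by simp
  qed
  have c0: "C0 = X0 * (R * E)" by (rule C_eq[OF X0 C0 X0E])
  have YRE: "Y * (R * E) \<in> carrier_mat s s" by (rule mult_carrier_mat[OF Y(1) RE])
  have c: "C = C0 + Y * (R * E)"
    using C_eq[OF X C XE] add_mult_distrib_mat[OF X0 Y(1) RE] unfolding c0 Y(2) by simp
  have lhs: "X * R = C0 * X0 + Y * R"
    unfolding Y(2) add_mult_distrib_mat[OF X0 Y(1) R] C0(2) ..
  have rhs: "C * X = C0 * X0 + C0 * Y + (Y * (R * E) * X0 + Y * (R * E) * Y)"
    unfolding c Y(2) add_mult_distrib_mat[OF C0(1) YRE add_carrier_mat[OF Y(1), of X0]]
      mult_add_distrib_mat[OF C0(1) X0 Y(1)] mult_add_distrib_mat[OF YRE X0 Y(1)] ..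
  have car: "C0 * X0 \<in> carrier_mat s d" "C0 * Y \<in> carrier_mat s d" "Y * (R * E) * X0 \<in> carrier_mat s d"
    "Y * (R * E) * Y \<in> carrier_mat s d" "Y * R \<in> carrier_mat s d"
    using mult_carrier_mat[OF C0(1) X0] mult_carrier_mat[OF C0(1) Y(1)] mult_carrier_mat[OF YRE X0]
      mult_carrier_mat[OF YRE Y(1)] mult_carrier_mat[OF Y(1) R] by blast+
  \<comment> \<open>Matrices of all shapes share one type and form no group, so cancellation is done
    entrywise.\<close>
  have key: "V = P + Q + T"
    if eq: "U + V = U + P + (Q + T)" and "U \<in> carrier_mat s d" "V \<in> carrier_mat s d"
      "P \<in> carrier_mat s d" "Q \<in> carrier_mat s d" "T \<in> carrier_mat s d" for U V P Q T :: "'k mat"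
  proof (rule eq_matI)
    fix i j assume "i < dim_row (P + Q + T)" "j < dim_col (P + Q + T)"
    then have ij: "i < s" "j < d" using that by auto
    have "(U + V) $$ (i, j) = (U + P + (Q + T)) $$ (i, j)" by (simp only: eq)
    then show "V $$ (i, j) = (P + Q + T) $$ (i, j)" using ij that(2-) by (simp add: algebra_simps)
  qed (use that in auto)
  have "C0 * X0 + Y * R = C0 * X0 + C0 * Y + (Y * (R * E) * X0 + Y * (R * E) * Y)"
    using lhs rhs C(2) by simp
  from key[OF this car(1,5,2,3,4)] show ?thesis unfolding c0[symmetric] .
qed

text \<open>Cramer's rule for \<open>A\<close>, with column \<open>i\<close> replaced by
  \<open>A\<close> times column \<open>j\<close> of \<open>Z\<close>. It exhibits the chart
  coordinate as the ratio of two minors of \<open>X\<close>, along \<open>js[i := j]\<close> and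
  along \<open>js\<close>.\<close>

lemma column_minor_replace:
  fixes X Z A :: "'k::field mat"
  assumes Z: "Z \<in> carrier_mat s d" and A: "A \<in> carrier_mat s s" and X: "X = A * Z"
    and XE: "X * select_cols d js = A"
    and js: "length js = s" "set js \<subseteq> {..<d}" and i: "i < s" and j: "j < d"
  shows "column_minor X (js[i := j]) = Z $$ (i, j) * det A"
proof -
  have Xc: "X \<in> carrier_mat s d" unfolding X by (rule mult_carrier_mat[OF A Z])
  have js': "set (js[i := j]) \<subseteq> {..<d}" using set_update_subset_insert[of js i j] js(2) j by auto
  have XE': "X * select_cols d (js[i := j]) \<in> carrier_mat s s"
    using mult_carrier_mat[OF Xc select_cols_carrier[of d "js[i := j]"]] js(1) by simp
  have col: "A *\<^sub>v col Z j = col X j"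
    unfolding X using col_mult2[OF A Z j] by simp
  have "X * select_cols d (js[i := j]) = replace_col A (A *\<^sub>v col Z j) i"
  proof (rule eq_matI)
    fix a b assume "a < dim_row (replace_col A (A *\<^sub>v col Z j) i)" "b < dim_col (replace_col A (A *\<^sub>v col Z j) i)"
    then have ab: "a < s" "b < s" using A by (auto simp: replace_col_def)
    have 1: "(X * select_cols d (js[i := j])) $$ (a, b) = X $$ (a, js[i := j] ! b)"
      using mult_select_cols_index[OF Xc js' ab(1), of b] ab(2) js(1) by simp
    have 2: "A $$ (a, b) = X $$ (a, js ! b)"
      using mult_select_cols_index[OF Xc js(2) ab(1), of b] ab(2) js(1) unfolding XE by simp
    have 3: "replace_col A (A *\<^sub>v col Z j) i $$ (a, b) = (if b = i then X $$ (a, j) else A $$ (a, b))"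
      unfolding col using ab A Xc j by (simp add: replace_col_def)
    show "(X * select_cols d (js[i := j])) $$ (a, b) = replace_col A (A *\<^sub>v col Z j) i $$ (a, b)"
      unfolding 1 3 2 using ab js(1) by (simp add: nth_list_update)
  next
    show "dim_row (X * select_cols d (js[i := j])) = dim_row (replace_col A (A *\<^sub>v col Z j) i)"
      using A by (simp only: carrier_matD[OF XE'] replace_col_def dim_row_mat carrier_matD[OF A])
    show "dim_col (X * select_cols d (js[i := j])) = dim_col (replace_col A (A *\<^sub>v col Z j) i)"
      using A by (simp only: carrier_matD[OF XE'] replace_col_def dim_col_mat carrier_matD[OF A])
  qed
  then have "column_minor X (js[i := j]) = det (replace_col A (A *\<^sub>v col Z j) i)"
    using Xc by (simp add: column_minor_def)
  also have "\<dots> = col Z j $ i * det A"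
    using Z i j by (intro cramer_lemma_mat[OF A]) auto
  finally show ?thesis using Z i j by simp
qed

text \<open>The linear part of the chart equation at position \<open>(i, l)\<close>: the products
  \<open>Y R\<close> and \<open>Y RE X0\<close> involve only row \<open>i\<close> of
  \<open>Y\<close>, the product \<open>X0 RE Y\<close> only its column \<open>l\<close>. This
  explains the two conditionals.\<close>

lemma linear_part_sum:
  fixes y :: "nat \<times> nat \<Rightarrow> 'k::field"
  assumes R: "R \<in> carrier_mat d d" and RE: "RE \<in> carrier_mat d s" and X0: "X0 \<in> carrier_mat s d"
    and i: "i < s" and l: "l < d"
  defines "Y \<equiv> mat s d y"
  shows "(\<Sum>p\<in>{..<s} \<times> {..<d}. ((if fst p = i then R $$ (snd p, l) - (RE * X0) $$ (snd p, l) else 0)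
      - (if snd p = l then (X0 * RE) $$ (i, fst p) else 0)) * y p) =
    (Y * R) $$ (i, l) - (Y * RE * X0) $$ (i, l) - (X0 * RE * Y) $$ (i, l)"
proof -
  have Y: "Y \<in> carrier_mat s d" by (simp add: Y_def)
  have Yy: "Y $$ (a, b) = y (a, b)" if "a < s" "b < d" for a b
    using that by (simp add: Y_def)
  have REX: "RE * X0 \<in> carrier_mat d d" by (rule mult_carrier_mat[OF RE X0])
  have XRE: "X0 * RE \<in> carrier_mat s s" by (rule mult_carrier_mat[OF X0 RE])
  have "(\<Sum>p\<in>{..<s} \<times> {..<d}. ((if fst p = i then R $$ (snd p, l) - (RE * X0) $$ (snd p, l) else 0)
      - (if snd p = l then (X0 * RE) $$ (i, fst p) else 0)) * y p) =
    (\<Sum>j<d. (R $$ (j, l) - (RE * X0) $$ (j, l)) * y (i, j)) - (\<Sum>a<s. (X0 * RE) $$ (i, a) * y (a, l))"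
  proof -
    have "(\<Sum>p\<in>{..<s} \<times> {..<d}. (if fst p = i then R $$ (snd p, l) - (RE * X0) $$ (snd p, l) else 0) * y p)
        = (\<Sum>j<d. (R $$ (j, l) - (RE * X0) $$ (j, l)) * y (i, j))"
      using i by (intro sum_Times_row[where f = "\<lambda>j. R $$ (j, l) - (RE * X0) $$ (j, l)"]) auto
    moreover have "(\<Sum>p\<in>{..<s} \<times> {..<d}. (if snd p = l then (X0 * RE) $$ (i, fst p) else 0) * y p)
        = (\<Sum>a<s. (X0 * RE) $$ (i, a) * y (a, l))"
      using l by (intro sum_Times_column[where f = "\<lambda>a. (X0 * RE) $$ (i, a)"]) auto
    ultimately show ?thesis
      by (simp only: left_diff_distrib[of "if _ then _ else _"] sum_subtractf)
  qed
  also have "(\<Sum>j<d. (R $$ (j, l) - (RE * X0) $$ (j, l)) * y (i, j)) =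
      (\<Sum>j<d. Y $$ (i, j) * R $$ (j, l)) - (\<Sum>j<d. Y $$ (i, j) * (RE * X0) $$ (j, l))"
    unfolding sum_subtractf[symmetric] using i by (intro sum.cong refl) (simp add: Yy algebra_simps)
  also have "\<dots> = (Y * R) $$ (i, l) - (Y * (RE * X0)) $$ (i, l)"
    unfolding mult_mat_index_sum[OF Y R i l] mult_mat_index_sum[OF Y REX i l] ..
  also have "Y * (RE * X0) = Y * RE * X0" by (rule assoc_mult_mat[OF Y RE X0, symmetric])
  also have "(\<Sum>a<s. (X0 * RE) $$ (i, a) * y (a, l)) = (X0 * RE * Y) $$ (i, l)"
    unfolding mult_mat_index_sum[OF XRE Y i l] using l by (intro sum.cong refl) (simp add: Yy)
  finally show ?thesis .
qed

text \<open>In the entry \<open>(i, l)\<close> of \<open>Y RE Y\<close> the left factor contributes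
  row \<open>i\<close>, with index \<open>q\<close>, and the right factor column \<open>l\<close>,
  with index \<open>p\<close>.\<close>

lemma quadratic_part_sum:
  fixes y :: "nat \<times> nat \<Rightarrow> 'k::field"
  assumes RE: "RE \<in> carrier_mat d s" and i: "i < s" and l: "l < d"
  defines "Y \<equiv> mat s d y"
  shows "(\<Sum>p\<in>{..<s} \<times> {..<d}. (\<Sum>q\<in>{..<s} \<times> {..<d}.
      (if snd p = l \<and> fst q = i then RE $$ (snd q, fst p) else 0) * y q) * y p) =
    (Y * RE * Y) $$ (i, l)"
proof -
  have Y: "Y \<in> carrier_mat s d" by (simp add: Y_def)
  have Yy: "Y $$ (a, b) = y (a, b)" if "a < s" "b < d" for a b
    using that by (simp add: Y_def)
  have YRE: "Y * RE \<in> carrier_mat s s" by (rule mult_carrier_mat[OF Y RE])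
  have inner: "(\<Sum>q\<in>{..<s} \<times> {..<d}. (if snd p = l \<and> fst q = i then RE $$ (snd q, fst p) else 0) * y q)
      = (if snd p = l then (Y * RE) $$ (i, fst p) else 0)" if "fst p < s" for p
  proof (cases "snd p = l")
    case True
    have "(\<Sum>q\<in>{..<s} \<times> {..<d}. (if fst q = i then RE $$ (snd q, fst p) else 0) * y q)
      = (\<Sum>b<d. RE $$ (b, fst p) * y (i, b))"
      using i by (intro sum_Times_row) auto
    also have "\<dots> = (Y * RE) $$ (i, fst p)"
      unfolding mult_mat_index_sum[OF Y RE i that] using i by (intro sum.cong refl) (simp add: Yy)
    finally show ?thesis using True by simp
  qed simp
  have "(\<Sum>p\<in>{..<s} \<times> {..<d}. (\<Sum>q\<in>{..<s} \<times> {..<d}.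
      (if snd p = l \<and> fst q = i then RE $$ (snd q, fst p) else 0) * y q) * y p) =
    (\<Sum>p\<in>{..<s} \<times> {..<d}. (if snd p = l then (Y * RE) $$ (i, fst p) else 0) * y p)"
    by (intro sum.cong refl arg_cong2[of _ _ _ _ "(*)"] inner) auto
  also have "\<dots> = (\<Sum>a<s. (Y * RE) $$ (i, a) * y (a, l))"
    using l by (intro sum_Times_column) auto
  also have "\<dots> = (Y * RE * Y) $$ (i, l)"
    unfolding mult_mat_index_sum[OF YRE Y i l] using l by (intro sum.cong refl) (simp add: Yy)
  finally show ?thesis .
qed

text \<open>The condition on \<open>g\<close> is asked only of full-rank matrices with row space
  stable under \<open>RR\<close>; these stand for the points of the module Grassmannian.
  Invertibility of \<open>G\<close> follows from the full rank of \<open>X\<close>.\<close>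

abbreviation isolates_rows ::
    "'k::field mat set \<Rightarrow> nat \<Rightarrow> nat \<Rightarrow> 'k mat \<Rightarrow> ((nat set \<Rightarrow> 'k) \<Rightarrow> 'k) \<Rightarrow> bool" where
  "isolates_rows RR d s X0 g \<equiv>
    \<forall>X\<in>carrier_mat s d.
      (\<exists>js'. length js' = s \<and> set js' \<subseteq> {..<d} \<and> column_minor X js' \<noteq> 0) \<longrightarrow>
      (\<forall>R\<in>RR. \<exists>C\<in>carrier_mat s s. X * R = C * X) \<longrightarrow>
      (g (\<lambda>I. det (submatrix X UNIV I)) \<noteq> 0 \<longleftrightarrow> (\<exists>G\<in>carrier_mat s s. X = G * X0))"

text \<open>\<open>rigid\<close> is \<open>Hom(U, M/U) = 0\<close> in matrices: the rows of
  \<open>Y\<close> lift the images of the basis vectors, \<open>C\<close> is the action on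
  \<open>U\<close>, compatibility holds modulo the row space of \<open>X0\<close>, and
  \<open>Y = D * X0\<close> says that all images vanish in the quotient. Here \<open>X0\<close> is
  already normalized at the columns \<open>js\<close>.\<close>

lemma rigid_isolated_reduced:
  fixes X0 :: "'k::field mat" and RR :: "'k mat set"
  assumes RR: "RR \<subseteq> carrier_mat d d" and X0: "X0 \<in> carrier_mat s d"
    and js: "length js = s" "set js \<subseteq> {..<d}" and X0E: "X0 * select_cols d js = 1\<^sub>m s"
    and inv0: "\<And>R. R \<in> RR \<Longrightarrow> \<exists>C\<in>carrier_mat s s. X0 * R = C * X0"
    and rigid: "\<And>Y. \<lbrakk>Y \<in> carrier_mat s d;
        \<And>R C. \<lbrakk>R \<in> RR; C \<in> carrier_mat s s; X0 * R = C * X0\<rbrakk> \<Longrightarrow>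
          \<exists>D\<in>carrier_mat s s. Y * R = C * Y + D * X0\<rbrakk> \<Longrightarrow>
      \<exists>D\<in>carrier_mat s s. Y = D * X0"
  shows "\<exists>g\<in>forms (index_sets d s) (s * d + 1).
    isolates_rows RR d s X0 g"
proof -
  let ?V = "index_sets d s"
  let ?P = "{..<s} \<times> {..<d}"
  define E :: "'k mat" where "E = select_cols d js"
  have E: "E \<in> carrier_mat d s" using select_cols_carrier[of d js] js(1) by (simp add: E_def)
  have X0E': "X0 * E = 1\<^sub>m s" using X0E by (simp add: E_def)
  have E_index: "(X * E) $$ (i, k) = X $$ (i, js ! k)" if "X \<in> carrier_mat s d" "i < s" "k < s" for X i k
    unfolding E_def using mult_select_cols_index[OF that(1) js(2) that(2)] that(3) js(1) by simp
  define mv where "mv X = (\<lambda>I. det (submatrix X UNIV I))" for X :: "'k mat"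
  obtain h where h: "h \<in> forms ?V 1"
    and h_eq: "\<And>X. X \<in> carrier_mat s d \<Longrightarrow> column_minor X js = h (mv X)"
    using column_minor_homogeneous[OF js, where 'k = 'k] unfolding mv_def by blast
  \<comment> \<open>The chart coordinate at \<open>(i, j)\<close> needs the minor in which the
    selected column number \<open>i\<close> is replaced by column \<open>j\<close>.\<close>
  have "\<forall>p\<in>?P. \<exists>c\<in>forms ?V 1.
      \<forall>X\<in>carrier_mat s d. column_minor X (js[fst p := snd p]) = (c (mv X) :: 'k)"
  proof
    fix p assume p: "p \<in> ?P"
    have "length (js[fst p := snd p]) = s" using js(1) by simp
    moreover have "set (js[fst p := snd p]) \<subseteq> {..<d}"
      using set_update_subset_insert[of js "fst p" "snd p"] js(2) p by auto
    ultimately show "\<exists>c\<in>forms ?V 1.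
      \<forall>X\<in>carrier_mat s d. column_minor X (js[fst p := snd p]) = (c (mv X) :: 'k)"
      unfolding mv_def by (rule column_minor_homogeneous)
  qed
  from bchoice[OF this[unfolded Bex_def]] obtain c
    where cc: "\<forall>p\<in>?P. c p \<in> forms ?V 1 \<and>
      (\<forall>X\<in>carrier_mat s d. column_minor X (js[fst p := snd p]) = c p (mv X))" ..
  have c: "c p \<in> forms ?V 1" if "p \<in> ?P" for p
    using cc that by blast
  have c_eq: "column_minor X (js[fst p := snd p]) = c p (mv X)" if "p \<in> ?P" "X \<in> carrier_mat s d" for p X
    using cc that by blast
  \<comment> \<open>Subtracting \<open>X0 $$ p * h x\<close> moves the origin of the chart to
    \<open>X0\<close>: on the chart, \<open>z p\<close> is \<open>h\<close> times an entry of the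
    difference to \<open>X0\<close>.\<close>
  define z where "z p x = c p x - X0 $$ p * h x" for p x
  have z: "z p \<in> forms ?V 1" if "p \<in> ?P" for p
    unfolding z_def by (intro forms_diff forms_scale c h that)
  define lin where "lin R i l p = (if fst p = i then R $$ (snd p, l) - (R * E * X0) $$ (snd p, l) else 0)
      - (if snd p = l then (X0 * (R * E)) $$ (i, fst p) else 0)" for R i l and p :: "nat \<times> nat"
  define quad where "quad R i l p q = (if snd p = l \<and> fst q = i then (R * E) $$ (snd q, fst p) else 0)"
    for R i l and p q :: "nat \<times> nat"
  \<comment> \<open>The second family says that the columns \<open>js\<close> of the difference
    matrix vanish; it has no quadratic part. With it, all \<open>s * d\<close> entries can serve as
    unknowns.\<close>
  define Eqs where "Eqs = {(lin R i l, quad R i l) | R i l. R \<in> RR \<and> i < s \<and> l < d} \<union>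
    {(\<lambda>p. if fst p = i then if snd p = js ! k then 1 else 0 else 0, \<lambda>p q. 0) | i k. i < s \<and> k < s}"
  have lin_sum: "(\<Sum>p\<in>?P. lin R i l p * y p) =
      (mat s d y * R) $$ (i, l) - (mat s d y * (R * E) * X0) $$ (i, l) - (X0 * (R * E) * mat s d y) $$ (i, l)"
    if "R \<in> carrier_mat d d" "i < s" "l < d" for R i l y
    unfolding lin_def using that by (intro linear_part_sum mult_carrier_mat[OF _ E] X0)
  have quad_sum: "(\<Sum>p\<in>?P. (\<Sum>q\<in>?P. quad R i l p q * y q) * y p) = (mat s d y * (R * E) * mat s d y) $$ (i, l)"
    if "R \<in> carrier_mat d d" "i < s" "l < d" for R i l y
    unfolding quad_def using that by (intro quadratic_part_sum mult_carrier_mat[OF _ E])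
  have sel_sum: "(\<Sum>p\<in>?P. (if fst p = i then if snd p = js ! k then 1 else 0 else 0) * y p) = y (i, js ! k)"
    if "i < s" "k < s" for i k and y :: "nat \<times> nat \<Rightarrow> 'k"
  proof -
    have jsk: "js ! k < d" using js that nth_mem by blast
    have "(\<Sum>p\<in>?P. (if fst p = i then if snd p = js ! k then 1 else 0 else 0) * y p)
        = (\<Sum>j<d. (if j = js ! k then 1 else 0) * y (i, j))"
      using that by (intro sum_Times_row) auto
    also have "\<dots> = (\<Sum>j<d. if j = js ! k then y (i, j) else 0)" by (rule sum.cong) auto
    also have "\<dots> = y (i, js ! k)" using jsk by simp
    finally show ?thesis .
  qed
  have ker: "\<forall>p\<in>?P. y p = 0" if y: "\<forall>e\<in>Eqs. (\<Sum>p\<in>?P. fst e p * y p) = 0" for y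
  proof -
    define Y where "Y = mat s d y"
    have Y: "Y \<in> carrier_mat s d" by (simp add: Y_def)
    have YE: "Y * E = 0\<^sub>m s s"
    proof (rule eq_matI)
      fix i k assume "i < dim_row (0\<^sub>m s s :: 'k mat)" "k < dim_col (0\<^sub>m s s :: 'k mat)"
      then have ik: "i < s" "k < s" by auto
      have "(\<lambda>p. if fst p = i then if snd p = js ! k then 1 else 0 else 0, \<lambda>p q. 0) \<in> Eqs"
        unfolding Eqs_def using ik by blast
      from y[rule_format, OF this] have "y (i, js ! k) = 0"
        using sel_sum[OF ik, of y] by simp
      moreover have "js ! k < d" using js ik(2) nth_mem by blast
      ultimately show "(Y * E) $$ (i, k) = 0\<^sub>m s s $$ (i, k)"
        using E_index[OF Y ik] ik by (simp add: Y_def)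
    qed (use carrier_matD[OF Y] carrier_matD[OF E] in simp_all)
    have "\<exists>D\<in>carrier_mat s s. Y = D * X0"
    proof (rule rigid[OF Y])
      fix R C assume R: "R \<in> RR" and C: "C \<in> carrier_mat s s" "X0 * R = C * X0"
      have Rc: "R \<in> carrier_mat d d" using R RR by blast
      have RE: "R * E \<in> carrier_mat d s" by (rule mult_carrier_mat[OF Rc E])
      have YRE: "Y * (R * E) \<in> carrier_mat s s" by (rule mult_carrier_mat[OF Y RE])
      have "X0 * (R * E) = X0 * R * E" by (rule assoc_mult_mat[OF X0 Rc E, symmetric])
      also have "\<dots> = C * (X0 * E)" unfolding C(2) by (rule assoc_mult_mat[OF C(1) X0 E])
      also have "\<dots> = C" unfolding X0E' by (rule right_mult_one_mat[OF C(1)])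
      finally have C_eq: "X0 * (R * E) = C" .
      have car: "C * Y \<in> carrier_mat s d" "Y * (R * E) * X0 \<in> carrier_mat s d" "Y * R \<in> carrier_mat s d"
        using mult_carrier_mat[OF C(1) Y] mult_carrier_mat[OF YRE X0] mult_carrier_mat[OF Y Rc] by blast+
      \<comment> \<open>The correcting matrix that \<open>rigid\<close> asks for is
        \<open>Y * (R * E)\<close>.\<close>
      have "Y * R = C * Y + Y * (R * E) * X0"
      proof (rule eq_matI)
        fix i l assume "i < dim_row (C * Y + Y * (R * E) * X0)" "l < dim_col (C * Y + Y * (R * E) * X0)"
        then have il: "i < s" "l < d"
          by (simp_all only: index_add_mat carrier_matD[OF car(2)])
        have "(lin R i l, quad R i l) \<in> Eqs" unfolding Eqs_def using R il by blast
        from y[rule_format, OF this]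
        have "(Y * R) $$ (i, l) - (Y * (R * E) * X0) $$ (i, l) - (C * Y) $$ (i, l) = 0"
          using lin_sum[OF Rc il, of y] unfolding Y_def[symmetric] C_eq by simp
        moreover have "(C * Y + Y * (R * E) * X0) $$ (i, l) = (C * Y) $$ (i, l) + (Y * (R * E) * X0) $$ (i, l)"
          by (rule index_add_mat(1)) (simp_all only: carrier_matD[OF car(2)] il)
        ultimately show "(Y * R) $$ (i, l) = (C * Y + Y * (R * E) * X0) $$ (i, l)"
          by (simp only: diff_diff_eq right_minus_eq add.commute)
      qed (simp_all only: index_add_mat carrier_matD[OF car(2)] carrier_matD[OF car(3)])
      then show "\<exists>D\<in>carrier_mat s s. Y * R = C * Y + D * X0" using YRE by blast
    qed
    then obtain D where D: "D \<in> carrier_mat s s" "Y = D * X0" by blast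
    \<comment> \<open>Rigidity leaves the directions \<open>D * X0\<close> along the row space
      itself; the normalization \<open>Y * E = 0\<close> removes them.\<close>
    have "D = D * (X0 * E)" unfolding X0E' by (rule right_mult_one_mat[OF D(1), symmetric])
    also have "\<dots> = Y * E" unfolding D(2) by (rule assoc_mult_mat[OF D(1) X0 E, symmetric])
    finally have "D = 0\<^sub>m s s" unfolding YE .
    then have "Y = 0\<^sub>m s d" unfolding D(2) using X0 by (simp add: left_mult_zero_mat)
    then have "y (i, j) = 0" if "i < s" "j < d" for i j
      using that by (metis Y_def index_mat(1) index_zero_mat(1))
    then show ?thesis by auto
  qed
  have "finite ?P" by simp
  from isolating_determinant[where P = ?P and E = Eqs and z = z and h = h and V = ?V, OF this ker z h]
  obtain g where g: "g \<in> forms ?V (card ?P + 1)"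
    and gg: "(\<forall>x. h x = 0 \<longrightarrow> g x = 0) \<and>
    (\<forall>x y. h x \<noteq> 0 \<longrightarrow> (\<forall>p\<in>?P. z p x = h x * y p) \<longrightarrow>
      (\<forall>e\<in>Eqs. (\<Sum>p\<in>?P. fst e p * y p) = (\<Sum>p\<in>?P. (\<Sum>q\<in>?P. snd e p q * y q) * y p)) \<longrightarrow>
      (g x \<noteq> 0 \<longleftrightarrow> (\<forall>p\<in>?P. y p = 0)))"
    by (rule bexE)
  note g0 = gg[THEN conjunct1, rule_format] and g_iff = gg[THEN conjunct2, THEN spec, THEN spec, THEN mp, THEN mp, THEN mp]
  have "g (mv X) \<noteq> 0 \<longleftrightarrow> (\<exists>G\<in>carrier_mat s s. X = G * X0)"
    if X: "X \<in> carrier_mat s d"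
      and full: "\<exists>js'. length js' = s \<and> set js' \<subseteq> {..<d} \<and> column_minor X js' \<noteq> 0"
      and inv: "\<forall>R\<in>RR. \<exists>C\<in>carrier_mat s s. X * R = C * X" for X
  proof (cases "h (mv X) = 0")
    case True
    \<comment> \<open>A full-rank matrix \<open>G * X0\<close> has \<open>det G\<close> as its minor
      along \<open>js\<close>, and this is nonzero; so the row space of \<open>X0\<close> does not
      occur outside the chart.\<close>
    have "\<not> (\<exists>G\<in>carrier_mat s s. X = G * X0)"
    proof
      assume "\<exists>G\<in>carrier_mat s s. X = G * X0"
      then obtain G where G: "G \<in> carrier_mat s s" "X = G * X0" by blast
      obtain js' where js': "length js' = s" "column_minor X js' \<noteq> 0" using full by blast
      have "det G \<noteq> 0" using column_minor_mult[OF G(1) X0 js'(1)] js'(2) G(2) by auto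
      moreover have "column_minor X0 js = 1"
        using X0E X0 by (simp add: column_minor_def)
      ultimately show False
        using h_eq[OF X] True column_minor_mult[OF G(1) X0 js(1)] G(2) by simp
    qed
    then show ?thesis using g0[OF True] by blast
  next
    case False
    define A where "A = X * E"
    have A: "A \<in> carrier_mat s s" unfolding A_def by (rule mult_carrier_mat[OF X E])
    have h_det: "h (mv X) = det A" using h_eq[OF X] X by (simp add: column_minor_def A_def E_def)
    obtain B where B: "B \<in> carrier_mat s s" "A * B = 1\<^sub>m s" "B * A = 1\<^sub>m s"
      using matrix_inverse_exists[OF A] False h_det by metis
    \<comment> \<open>\<open>Z\<close> is the representative of the row space of \<open>X\<close>
      that is normalized at the columns \<open>js\<close>.\<close>
    define Z where "Z = B * X"
    have Z: "Z \<in> carrier_mat s d" unfolding Z_def by (rule mult_carrier_mat[OF B(1) X])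
    have "A * Z = A * B * X" unfolding Z_def by (rule assoc_mult_mat[OF A B(1) X, symmetric])
    also have "\<dots> = X" unfolding B(2) by (rule left_mult_one_mat[OF X])
    finally have AZ: "X = A * Z" by simp
    have ZE: "Z * E = 1\<^sub>m s"
      unfolding Z_def B(3)[symmetric] A_def by (rule assoc_mult_mat[OF B(1) X E])
    define Y where "Y = Z - X0"
    have Y: "Y \<in> carrier_mat s d" unfolding Y_def by (rule minus_carrier_mat[OF X0])
    have ZY: "Z = X0 + Y" unfolding Y_def using Z X0 by (intro eq_matI) auto
    have Y_mat: "mat s d (($$) Y) = Y" using Y by (intro eq_matI) auto
    have z_eq: "z p (mv X) = h (mv X) * Y $$ p" if p: "p \<in> ?P" for p
    proof -
      obtain i j where ij: "p = (i, j)" "i < s" "j < d" using p by auto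
      have "c p (mv X) = Z $$ p * h (mv X)"
        using c_eq[OF p X] column_minor_replace[OF Z A AZ _ js ij(2,3)] unfolding A_def E_def h_det ij(1)
        by (simp add: A_def E_def)
      moreover have "Y $$ p = Z $$ p - X0 $$ p" unfolding Y_def ij(1) using ij X0 by simp
      ultimately show ?thesis by (simp only: z_def mult.commute right_diff_distrib)
    qed
    have eqs: "\<forall>e\<in>Eqs. (\<Sum>p\<in>?P. fst e p * Y $$ p) = (\<Sum>p\<in>?P. (\<Sum>q\<in>?P. snd e p q * Y $$ q) * Y $$ p)"
    proof
      fix e assume "e \<in> Eqs"
      then consider (stable) R i l where "e = (lin R i l, quad R i l)" "R \<in> RR" "i < s" "l < d"
        | (select) i k where "e = (\<lambda>p. if fst p = i then if snd p = js ! k then 1 else 0 else 0, \<lambda>p q. 0)" "i < s" "k < s"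
        unfolding Eqs_def by blast
      then show "(\<Sum>p\<in>?P. fst e p * Y $$ p) = (\<Sum>p\<in>?P. (\<Sum>q\<in>?P. snd e p q * Y $$ q) * Y $$ p)"
      proof cases
        case stable
        have R: "R \<in> carrier_mat d d" using stable(2) RR by blast
        obtain C where C: "C \<in> carrier_mat s s" "X * R = C * X" using inv stable(2) by blast
        obtain C0 where C0: "C0 \<in> carrier_mat s s" "X0 * R = C0 * X0" using inv0[OF stable(2)] by blast
        have CA: "C * A \<in> carrier_mat s s" by (rule mult_carrier_mat[OF C(1) A])
        have "Z * R = B * (X * R)" unfolding Z_def by (rule assoc_mult_mat[OF B(1) X R])
        also have "\<dots> = B * (C * (A * Z))" unfolding C(2) AZ[symmetric] ..
        also have "C * (A * Z) = C * A * Z" by (rule assoc_mult_mat[OF C(1) A Z, symmetric])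
        also have "B * (C * A * Z) = B * (C * A) * Z" by (rule assoc_mult_mat[OF B(1) CA Z, symmetric])
        finally have ZR: "Z * R = B * (C * A) * Z" .
        have RE: "R * E \<in> carrier_mat d s" by (rule mult_carrier_mat[OF R E])
        have YRE: "Y * (R * E) \<in> carrier_mat s s" by (rule mult_carrier_mat[OF Y RE])
        have car: "X0 * (R * E) * Y \<in> carrier_mat s d" "Y * (R * E) * X0 \<in> carrier_mat s d"
          "Y * (R * E) * Y \<in> carrier_mat s d"
          using mult_carrier_mat[OF mult_carrier_mat[OF X0 RE] Y] mult_carrier_mat[OF YRE X0]
            mult_carrier_mat[OF YRE Y] by blast+
        have "Y * R = X0 * (R * E) * Y + Y * (R * E) * X0 + Y * (R * E) * Y"
          by (rule chart_equation[OF Z X0 R E ZE X0E' mult_carrier_mat[OF B(1) CA] ZR C0 Y ZY])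
        then have "(Y * R) $$ (i, l) = (X0 * (R * E) * Y + Y * (R * E) * X0 + Y * (R * E) * Y) $$ (i, l)"
          by (rule arg_cong)
        also have "\<dots> = (X0 * (R * E) * Y) $$ (i, l) + (Y * (R * E) * X0) $$ (i, l) + (Y * (R * E) * Y) $$ (i, l)"
          using stable(3,4) by (simp only: index_add_mat carrier_matD[OF car(2)] carrier_matD[OF car(3)])
        finally have "(Y * R) $$ (i, l) = \<dots>" .
        then show ?thesis
          using lin_sum[OF R stable(3,4), of "($$) Y"] quad_sum[OF R stable(3,4), of "($$) Y"]
          unfolding stable(1) fst_conv snd_conv Y_mat by (simp only: algebra_simps add_left_cancel)
      next
        case select
        have "js ! k < d" using js select(3) nth_mem by blast
        then have "Y $$ (i, js ! k) = (Z * E) $$ (i, k) - (X0 * E) $$ (i, k)"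
          unfolding E_index[OF Z select(2,3)] E_index[OF X0 select(2,3)] Y_def using X0 select(2) by simp
        also have "\<dots> = 0" unfolding ZE X0E' by simp
        finally show ?thesis
          using sel_sum[OF select(2,3), of "($$) Y"] unfolding select(1) fst_conv snd_conv by simp
      qed
    qed
    have "g (mv X) \<noteq> 0 \<longleftrightarrow> (\<forall>p\<in>?P. Y $$ p = 0)"
      by (rule g_iff[OF False _ eqs]) (use z_eq in blast)
    also have "\<dots> \<longleftrightarrow> Z = X0"
    proof
      assume Y0: "\<forall>p\<in>?P. Y $$ p = 0"
      show "Z = X0"
      proof (rule eq_matI)
        fix i j assume "i < dim_row X0" "j < dim_col X0"
        then have "i < s" "j < d" using X0 by auto
        then show "Z $$ (i, j) = X0 $$ (i, j)" using Y0 X0 by (auto simp: Y_def)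
      qed (use X0 Z in auto)
    next
      assume "Z = X0"
      then show "\<forall>p\<in>?P. Y $$ p = 0" using X0 by (auto simp: Y_def)
    qed
    also have "\<dots> \<longleftrightarrow> (\<exists>G\<in>carrier_mat s s. X = G * X0)"
    proof
      assume "Z = X0"
      then show "\<exists>G\<in>carrier_mat s s. X = G * X0" using AZ A by blast
    next
      assume "\<exists>G\<in>carrier_mat s s. X = G * X0"
      then obtain G where G: "G \<in> carrier_mat s s" "X = G * X0" by blast
      \<comment> \<open>Selecting the columns \<open>js\<close> in \<open>X = G * X0\<close> gives
        \<open>A = G\<close>, so the two normalized representatives coincide.\<close>
      have "A = G * (X0 * E)" unfolding A_def G(2) by (rule assoc_mult_mat[OF G(1) X0 E])
      then have "A = G" unfolding X0E' using right_mult_one_mat[OF G(1)] by simp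
      then have "Z = B * A * X0" unfolding Z_def G(2) using assoc_mult_mat[OF B(1) A X0] by simp
      then show "Z = X0" unfolding B(3) using left_mult_one_mat[OF X0] by simp
    qed
    finally show ?thesis .
  qed
  moreover have "card ?P = s * d" by (simp add: card_cartesian_product)
  ultimately show ?thesis using g unfolding mv_def by (intro bexI[of _ g]) simp_all
qed

text \<open>Multiplying \<open>X0\<close> by the inverse of its selected block normalizes the
  columns \<open>js\<close> without changing the row space. The action matrix \<open>C\<close>
  becomes the conjugate \<open>B * (C * A)\<close>, and \<open>rigid\<close> is transported by
  passing from \<open>Y\<close> to \<open>A * Y\<close>.\<close>

lemma rigid_isolated:
  fixes X0 :: "'k::field mat" and RR :: "'k mat set"
  assumes RR: "RR \<subseteq> carrier_mat d d" and X0: "X0 \<in> carrier_mat s d"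
    and js: "length js = s" "set js \<subseteq> {..<d}" "column_minor X0 js \<noteq> 0"
    and inv0: "\<And>R. R \<in> RR \<Longrightarrow> \<exists>C\<in>carrier_mat s s. X0 * R = C * X0"
    and rigid: "\<And>Y. \<lbrakk>Y \<in> carrier_mat s d;
        \<And>R C. \<lbrakk>R \<in> RR; C \<in> carrier_mat s s; X0 * R = C * X0\<rbrakk> \<Longrightarrow>
          \<exists>D\<in>carrier_mat s s. Y * R = C * Y + D * X0\<rbrakk> \<Longrightarrow>
      \<exists>D\<in>carrier_mat s s. Y = D * X0"
  shows "\<exists>g\<in>forms (index_sets d s) (s * d + 1).
    isolates_rows RR d s X0 g"
proof -
  define E :: "'k mat" where "E = select_cols d js"
  have E: "E \<in> carrier_mat d s" using select_cols_carrier[of d js] js(1) by (simp add: E_def)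
  define A where "A = X0 * E"
  have A: "A \<in> carrier_mat s s" unfolding A_def by (rule mult_carrier_mat[OF X0 E])
  have "det A \<noteq> 0" using js(3) X0 by (simp add: column_minor_def A_def E_def)
  then obtain B where B: "B \<in> carrier_mat s s" "A * B = 1\<^sub>m s" "B * A = 1\<^sub>m s"
    using matrix_inverse_exists[OF A] by metis
  define Z where "Z = B * X0"
  have Z: "Z \<in> carrier_mat s d" unfolding Z_def by (rule mult_carrier_mat[OF B(1) X0])
  have "A * Z = A * B * X0" unfolding Z_def by (rule assoc_mult_mat[OF A B(1) X0, symmetric])
  also have "\<dots> = X0" unfolding B(2) by (rule left_mult_one_mat[OF X0])
  finally have AZ: "X0 = A * Z" by simp
  have ZE: "Z * select_cols d js = 1\<^sub>m s"
    unfolding Z_def B(3)[symmetric] A_def E_def[symmetric] by (rule assoc_mult_mat[OF B(1) X0 E])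
  have conj: "Z * R = B * (C * A) * Z"
    if "R \<in> carrier_mat d d" "C \<in> carrier_mat s s" "X0 * R = C * X0" for R C
  proof -
    have CA: "C * A \<in> carrier_mat s s" by (rule mult_carrier_mat[OF that(2) A])
    have "Z * R = B * (X0 * R)" unfolding Z_def by (rule assoc_mult_mat[OF B(1) X0 that(1)])
    also have "\<dots> = B * (C * (A * Z))" unfolding that(3) AZ[symmetric] ..
    also have "C * (A * Z) = C * A * Z" by (rule assoc_mult_mat[OF that(2) A Z, symmetric])
    also have "B * (C * A * Z) = B * (C * A) * Z" by (rule assoc_mult_mat[OF B(1) CA Z, symmetric])
    finally show ?thesis .
  qed
  have "\<exists>g\<in>forms (index_sets d s) (s * d + 1).
    isolates_rows RR d s Z g"
  proof (rule rigid_isolated_reduced[OF RR Z js(1,2) ZE])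
    fix R assume R: "R \<in> RR"
    obtain C where C: "C \<in> carrier_mat s s" "X0 * R = C * X0" using inv0[OF R] by blast
    have "R \<in> carrier_mat d d" using R RR by blast
    from conj[OF this C] show "\<exists>C\<in>carrier_mat s s. Z * R = C * Z"
      using mult_carrier_mat[OF B(1) mult_carrier_mat[OF C(1) A]] by blast
  next
    fix Y assume Y: "Y \<in> carrier_mat s d"
      and lin: "\<And>R C. \<lbrakk>R \<in> RR; C \<in> carrier_mat s s; Z * R = C * Z\<rbrakk> \<Longrightarrow>
          \<exists>D\<in>carrier_mat s s. Y * R = C * Y + D * Z"
    have AY: "A * Y \<in> carrier_mat s d" by (rule mult_carrier_mat[OF A Y])
    have "\<exists>D\<in>carrier_mat s s. A * Y = D * X0"
    proof (rule rigid[OF AY])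
      fix R C assume R: "R \<in> RR" and C: "C \<in> carrier_mat s s" "X0 * R = C * X0"
      have Rc: "R \<in> carrier_mat d d" using R RR by blast
      have CA: "C * A \<in> carrier_mat s s" by (rule mult_carrier_mat[OF C(1) A])
      have BCA: "B * (C * A) \<in> carrier_mat s s" by (rule mult_carrier_mat[OF B(1) CA])
      obtain D where D: "D \<in> carrier_mat s s" "Y * R = B * (C * A) * Y + D * Z"
        using lin[OF R BCA conj[OF Rc C]] by blast
      have DB: "D * B \<in> carrier_mat s s" by (rule mult_carrier_mat[OF D(1) B(1)])
      have "A * Y * R = A * (Y * R)" by (rule assoc_mult_mat[OF A Y Rc])
      also have "\<dots> = A * (B * (C * A) * Y) + A * (D * Z)"
        unfolding D(2) by (rule mult_add_distrib_mat[OF A mult_carrier_mat[OF BCA Y] mult_carrier_mat[OF D(1) Z]])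
      also have "B * (C * A) * Y = B * (C * A * Y)" by (rule assoc_mult_mat[OF B(1) CA Y])
      also have "A * (B * (C * A * Y)) = A * B * (C * A * Y)"
        by (rule assoc_mult_mat[OF A B(1) mult_carrier_mat[OF CA Y], symmetric])
      also have "\<dots> = C * A * Y" unfolding B(2) by (rule left_mult_one_mat[OF mult_carrier_mat[OF CA Y]])
      also have "\<dots> = C * (A * Y)" by (rule assoc_mult_mat[OF C(1) A Y])
      also have "D * Z = D * B * X0" unfolding Z_def by (rule assoc_mult_mat[OF D(1) B(1) X0, symmetric])
      also have "A * (D * B * X0) = A * (D * B) * X0" by (rule assoc_mult_mat[OF A DB X0, symmetric])
      finally show "\<exists>D\<in>carrier_mat s s. A * Y * R = C * (A * Y) + D * X0"
        using mult_carrier_mat[OF A DB] by blast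
    qed
    then obtain D where D: "D \<in> carrier_mat s s" "A * Y = D * X0" by blast
    have DA: "D * A \<in> carrier_mat s s" by (rule mult_carrier_mat[OF D(1) A])
    have "Y = B * A * Y" unfolding B(3) by (rule left_mult_one_mat[OF Y, symmetric])
    also have "\<dots> = B * (A * Y)" by (rule assoc_mult_mat[OF B(1) A Y])
    also have "\<dots> = B * (D * (A * Z))" unfolding D(2) AZ[symmetric] ..
    also have "D * (A * Z) = D * A * Z" by (rule assoc_mult_mat[OF D(1) A Z, symmetric])
    also have "B * (D * A * Z) = B * (D * A) * Z" by (rule assoc_mult_mat[OF B(1) DA Z, symmetric])
    finally show "\<exists>D\<in>carrier_mat s s. Y = D * Z" using mult_carrier_mat[OF B(1) DA] by blast
  qed
  moreover have "(\<exists>G\<in>carrier_mat s s. X = G * Z) \<longleftrightarrow> (\<exists>G\<in>carrier_mat s s. X = G * X0)" for X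
  proof
    assume "\<exists>G\<in>carrier_mat s s. X = G * Z"
    then obtain G where G: "G \<in> carrier_mat s s" "X = G * Z" by blast
    have "X = G * B * X0" unfolding G(2) Z_def by (rule assoc_mult_mat[OF G(1) B(1) X0, symmetric])
    then show "\<exists>G\<in>carrier_mat s s. X = G * X0" using mult_carrier_mat[OF G(1) B(1)] by blast
  next
    assume "\<exists>G\<in>carrier_mat s s. X = G * X0"
    then obtain G where G: "G \<in> carrier_mat s s" "X = G * X0" by blast
    have "X = G * (A * Z)" unfolding G(2) AZ[symmetric] ..
    also have "\<dots> = G * A * Z" by (rule assoc_mult_mat[OF G(1) A Z, symmetric])
    finally show "\<exists>G\<in>carrier_mat s s. X = G * Z" using mult_carrier_mat[OF G(1) A] by blast
  qed
  ultimately show ?thesis by simp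
qed

text \<open>Each column is read as an equation on the coefficients \<open>c\<close>. Independence of
  the rows then means a trivial kernel, and a square subsystem is a choice of \<open>s\<close>
  columns with nonzero minor.\<close>

lemma full_rank_column_minor:
  fixes X :: "'k::field mat"
  assumes X: "X \<in> carrier_mat s d"
    and indep: "\<And>c. \<forall>j<d. (\<Sum>i<s. c i * X $$ (i, j)) = 0 \<Longrightarrow> \<forall>i<s. c i = 0"
  shows "\<exists>js. length js = s \<and> set js \<subseteq> {..<d} \<and> column_minor X js \<noteq> 0"
proof -
  have "\<exists>F. (\<forall>k<s. F k \<in> {..<d}) \<and>
    (\<forall>y. (\<forall>k<s. (\<Sum>i<s. X $$ (i, F k) * y i) = 0) \<longrightarrow> (\<forall>i<s. y i = 0))"
  proof (rule exists_square_subsystem)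
    fix y assume "\<forall>j\<in>{..<d}. (\<Sum>i<s. X $$ (i, j) * y i) = 0"
    then show "\<forall>i<s. y i = 0" by (intro indep) (simp add: mult.commute)
  qed
  then obtain F where F: "\<And>k. k < s \<Longrightarrow> F k < d"
    "\<forall>y. (\<forall>k<s. (\<Sum>i<s. X $$ (i, F k) * y i) = 0) \<longrightarrow> (\<forall>i<s. y i = 0)" by auto
  define js where "js = map F [0..<s]"
  have js: "length js = s" "set js \<subseteq> {..<d}" using F(1) by (auto simp: js_def)
  have XE: "X * select_cols d js \<in> carrier_mat s s"
    using mult_carrier_mat[OF X select_cols_carrier[of d js]] js(1) by simp
  have "(X * select_cols d js)\<^sup>T = mat s s (\<lambda>(k, i). X $$ (i, F k))"
  proof (rule eq_matI)
    fix k i assume "k < dim_row (mat s s (\<lambda>(k, i). X $$ (i, F k)))" "i < dim_col (mat s s (\<lambda>(k, i). X $$ (i, F k)))"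
    then have ki: "k < s" "i < s" by auto
    have "(X * select_cols d js)\<^sup>T $$ (k, i) = (X * select_cols d js) $$ (i, k)"
      by (rule index_transpose_mat(1)) (simp_all only: carrier_matD[OF XE] ki)
    also have "\<dots> = X $$ (i, js ! k)"
      using mult_select_cols_index[OF X js(2) ki(2)] ki(1) js(1) by simp
    finally show "(X * select_cols d js)\<^sup>T $$ (k, i) = mat s s (\<lambda>(k, i). X $$ (i, F k)) $$ (k, i)"
      using ki by (simp add: js_def)
  qed (simp_all only: index_transpose_mat carrier_matD[OF XE] dim_row_mat dim_col_mat)
  then have "det ((X * select_cols d js)\<^sup>T) \<noteq> 0"
    using F(2) det_nonzero_iff_trivial_kernel[of s "\<lambda>k i. X $$ (i, F k)"] by simp
  then have "column_minor X js \<noteq> 0"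
    using X by (simp add: column_minor_def det_transpose[OF XE])
  then show ?thesis using js by blast
qed

section \<open>Coordinates\<close>

abbreviation lin_comb :: "('k::field, 'm, 'y) module_scheme \<Rightarrow> (nat \<Rightarrow> 'k) \<Rightarrow> 'm list \<Rightarrow> 'm" where
  "lin_comb V \<equiv> module.lincomb_list V"

text \<open>Unique coordinates rather than a basis as a set: this is exactly what makes the
  description in \<open>coords\<close> denote, and it fits vectors indexed by position.\<close>

definition frame :: "('k::field, 'm, 'y) module_scheme \<Rightarrow> 'm list \<Rightarrow> bool" where
  "frame V us \<longleftrightarrow> vectorspace class_ring V \<and> set us \<subseteq> carrier V \<and>
    (\<forall>v\<in>carrier V. \<exists>!x. x \<in> carrier_vec (length us) \<and> v = lin_comb V (\<lambda>i. x $ i) us)"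

context
  fixes V :: "('k::field, 'm, 'y) module_scheme"
  assumes V: "vectorspace class_ring V"
begin

interpretation vectorspace class_ring V by (rule V)

lemma lin_comb_Nil: "lin_comb V c [] = \<zero>\<^bsub>V\<^esub>"
  by (rule lincomb_list_Nil)

lemma lin_comb_Cons: "lin_comb V c (u # us) = c 0 \<odot>\<^bsub>V\<^esub> u \<oplus>\<^bsub>V\<^esub> lin_comb V (\<lambda>i. c (Suc i)) us"
  using lincomb_list_Cons[of c u us] by (simp add: comp_def)

lemma lin_comb_cong:
  assumes "\<And>i. i < length us \<Longrightarrow> c i = c' i"
  shows "lin_comb V c us = lin_comb V c' us"
  unfolding lincomb_list_def using assms by (intro arg_cong[of _ _ sumlist]) simp

lemma lin_comb_closed:
  assumes "set us \<subseteq> carrier V"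
  shows "lin_comb V c us \<in> carrier V"
  by (rule lincomb_list_carrier[OF assms]) simp

lemma lin_comb_add:
  assumes "set us \<subseteq> carrier V"
  shows "lin_comb V (\<lambda>i. c i + c' i) us = lin_comb V c us \<oplus>\<^bsub>V\<^esub> lin_comb V c' us"
  using assms
proof (induction us arbitrary: c c')
  case Nil
  then show ?case by (simp add: lin_comb_Nil)
next
  case (Cons u us)
  have u: "u \<in> carrier V" "set us \<subseteq> carrier V" using Cons.prems by auto
  have car: "c 0 \<odot>\<^bsub>V\<^esub> u \<in> carrier V" "c' 0 \<odot>\<^bsub>V\<^esub> u \<in> carrier V"
    "lin_comb V (\<lambda>i. c (Suc i)) us \<in> carrier V" "lin_comb V (\<lambda>i. c' (Suc i)) us \<in> carrier V"
    using u by (simp_all add: lin_comb_closed)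
  have "(c 0 + c' 0) \<odot>\<^bsub>V\<^esub> u = c 0 \<odot>\<^bsub>V\<^esub> u \<oplus>\<^bsub>V\<^esub> c' 0 \<odot>\<^bsub>V\<^esub> u"
    using smult_l_distr[of "c 0" "c' 0" u] u by simp
  then show ?case
    unfolding lin_comb_Cons using Cons.IH[OF u(2)] car by (simp add: M.a_ac)
qed

lemma lin_comb_smult:
  assumes "set us \<subseteq> carrier V"
  shows "lin_comb V (\<lambda>i. a * c i) us = a \<odot>\<^bsub>V\<^esub> lin_comb V c us"
  using assms
proof (induction us arbitrary: c)
  case Nil
  have "a \<odot>\<^bsub>V\<^esub> \<zero>\<^bsub>V\<^esub> = \<zero>\<^bsub>V\<^esub>" by (rule rmult_0) simp
  then show ?case by (simp add: lin_comb_Nil)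
next
  case (Cons u us)
  have u: "u \<in> carrier V" "set us \<subseteq> carrier V" using Cons.prems by auto
  have "(a * c 0) \<odot>\<^bsub>V\<^esub> u = a \<odot>\<^bsub>V\<^esub> (c 0 \<odot>\<^bsub>V\<^esub> u)"
    using smult_assoc1[of a "c 0" u] u by simp
  then show ?case
    unfolding lin_comb_Cons using Cons.IH[OF u(2)] u smult_r_distr[of a] by (simp add: lin_comb_closed)
qed

lemma lin_comb_zero:
  assumes "set us \<subseteq> carrier V"
  shows "lin_comb V (\<lambda>i. 0) us = \<zero>\<^bsub>V\<^esub>"
  using lmult_0[OF lin_comb_closed[OF assms, of "\<lambda>i. 0"]] lin_comb_smult[OF assms, of 0 "\<lambda>i. 0"] by simp

lemma lin_comb_unit:
  assumes "set us \<subseteq> carrier V" "k < length us"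
  shows "lin_comb V (\<lambda>i. if i = k then 1 else 0) us = us ! k"
  using assms
proof (induction us arbitrary: k)
  case (Cons u us)
  have u: "u \<in> carrier V" "set us \<subseteq> carrier V" using Cons.prems by auto
  have one: "1 \<odot>\<^bsub>V\<^esub> u = u" using smult_one[OF u(1)] by simp
  have zero: "0 \<odot>\<^bsub>V\<^esub> u = \<zero>\<^bsub>V\<^esub>" using lmult_0[OF u(1)] by simp
  show ?case
  proof (cases k)
    case 0
    then show ?thesis
      using u one lin_comb_zero[OF u(2)] by (simp add: lin_comb_Cons comp_def)
  next
    case (Suc k')
    have "us ! k' \<in> carrier V" using u(2) Cons.prems(2) Suc nth_mem by force
    then show ?thesis
      using Suc zero Cons.IH[OF u(2), of k'] Cons.prems(2) by (simp add: lin_comb_Cons comp_def)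
  qed
qed simp

lemma lin_comb_in_subspace:
  assumes "VectorSpace.subspace class_ring U V" "set us \<subseteq> U"
  shows "lin_comb V c us \<in> U"
  using assms(2)
proof (induction us arbitrary: c)
  interpret U: submodule class_ring U V using assms(1) by (rule subspace.submod)
  {
    case Nil
    then show ?case by (simp add: lin_comb_Nil)
  next
    case (Cons u us)
    then show ?case by (simp add: lin_comb_Cons)
  }
qed

lemma lin_comb_subspace_eq: "lin_comb (V\<lparr>carrier := U\<rparr>) c us = lin_comb V c us"
  if "VectorSpace.subspace class_ring U V"
proof -
  interpret U: vectorspace class_ring "V\<lparr>carrier := U\<rparr>" by (rule subspace_is_vs[OF that])
  show ?thesis
    unfolding lincomb_list_def U.lincomb_list_def sumlist_def U.M.sumlist_def by simp
qed

lemma lincomb_eq_lin_comb: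
  assumes "distinct us" "set us \<subseteq> carrier V"
  shows "lincomb a (set us) = lin_comb V (\<lambda>i. a (us ! i)) us"
  using assms
proof (induction us)
  case Nil
  then show ?case by (simp add: lin_comb_Nil lincomb_def)
next
  case (Cons u us)
  have "lincomb a (insert u (set us)) = a u \<odot>\<^bsub>V\<^esub> u \<oplus>\<^bsub>V\<^esub> lincomb a (set us)"
    using Cons.prems by (intro lincomb_insert2) auto
  then show ?case using Cons by (simp add: lin_comb_Cons comp_def)
qed

lemma ordered_basis_imp_frame:
  assumes "ordered_basis V us"
  shows "frame V us"
proof -
  have us: "distinct us" "basis (set us)" using assms by (auto simp: ordered_basis_def)
  have sub: "set us \<subseteq> carrier V" using us(2) by (auto simp: basis_def)
  define idx where "idx u = (THE i. i < length us \<and> us ! i = u)" for u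
  have idx: "idx (us ! i) = i" if "i < length us" for i
    unfolding idx_def using that us(1) by (intro the_equality) (auto simp: nth_eq_iff_index_eq)
  have crit: "\<exists>!a. a \<in> set us \<rightarrow>\<^sub>E UNIV \<and> lincomb a (set us) = v" if "v \<in> carrier V" for v
    using basis_criterion[OF _ sub] us(2) that by simp
  \<comment> \<open>Vectors are compared with coefficient functions on the set of basis elements;
    \<open>restrict\<close> appears because the latter are unique only as extensional
    functions.\<close>
  have to_fun: "lincomb (restrict (\<lambda>u. x $ idx u) (set us)) (set us) = lin_comb V (\<lambda>i. x $ i) us" for x :: "'k vec"
    unfolding lincomb_eq_lin_comb[OF us(1) sub] by (rule lin_comb_cong) (simp add: idx)
  have "\<exists>!x. x \<in> carrier_vec (length us) \<and> v = lin_comb V (\<lambda>i. x $ i) us" if v: "v \<in> carrier V" for v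
  proof -
    obtain a where a: "lincomb a (set us) = v" using crit[OF v] by blast
    let ?x = "vec (length us) (\<lambda>i. a (us ! i))"
    show ?thesis
    proof (rule ex1I[of _ ?x])
      have "v = lin_comb V (\<lambda>i. a (us ! i)) us"
        using a lincomb_eq_lin_comb[OF us(1) sub] by simp
      also have "\<dots> = lin_comb V (\<lambda>i. ?x $ i) us" by (rule lin_comb_cong) simp
      finally show x: "?x \<in> carrier_vec (length us) \<and> v = lin_comb V (\<lambda>i. ?x $ i) us" by simp
      fix y assume y: "y \<in> carrier_vec (length us) \<and> v = lin_comb V (\<lambda>i. y $ i) us"
      have "restrict (\<lambda>u. y $ idx u) (set us) = restrict (\<lambda>u. ?x $ idx u) (set us)"
      proof (rule ex1E[OF crit[OF v]])
        fix b assume b: "\<forall>a. a \<in> set us \<rightarrow>\<^sub>E UNIV \<and> lincomb a (set us) = v \<longrightarrow> a = b"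
        have "restrict (\<lambda>u. z $ idx u) (set us) = b" if "v = lin_comb V (\<lambda>i. z $ i) us" for z :: "'k vec"
          using b[rule_format, of "restrict (\<lambda>u. z $ idx u) (set us)"] to_fun[of z] that by simp
        then show ?thesis using x y by metis
      qed
      then have "restrict (\<lambda>u. y $ idx u) (set us) (us ! i) = restrict (\<lambda>u. ?x $ idx u) (set us) (us ! i)" for i
        by simp
      then have "y $ i = ?x $ i" if "i < length us" for i
        using that idx[OF that] nth_mem[OF that] by (metis restrict_apply')
      then show "y = ?x" using y by (intro eq_vecI) auto
    qed
  qed
  then show ?thesis unfolding frame_def using V sub by blast
qed

lemma ordered_basis_exists:
  assumes fin_dim
  obtains us where "ordered_basis V us" "length us = dim"
proof -
  obtain B where B: "finite B" "basis B" using finite_basis_exists[OF assms] by blast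
  obtain us where us: "set us = B" "distinct us" using finite_distinct_list[OF B(1)] by blast
  have "length us = dim" using dim_basis[OF B] us distinct_card by fastforce
  with us B show thesis by (intro that[of us]) (simp_all add: ordered_basis_def)
qed

lemma ordered_basis_length:
  assumes "ordered_basis V us"
  shows "length us = dim"
  using dim_basis[of "set us"] assms distinct_card[of us] by (simp add: ordered_basis_def)

text \<open>Independence does not depend on the ambient space, so independent subsets of
  \<open>U\<close> have at most \<open>dim\<close> elements; a maximal one is a finite
  basis.\<close>

lemma subspace_fin_dim:
  assumes fd: fin_dim and U: "VectorSpace.subspace class_ring U V"
  shows "vectorspace.fin_dim class_ring (V\<lparr>carrier := U\<rparr>)"
proof -
  interpret U: vectorspace class_ring "V\<lparr>carrier := U\<rparr>" by (rule subspace_is_vs[OF U])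
  have sub: "submodule class_ring U V" using U by (rule subspace.submod)
  then have UV: "U \<subseteq> carrier V" by (rule submodule.subset)
  let ?P = "\<lambda>S. S \<subseteq> carrier (V\<lparr>carrier := U\<rparr>) \<and> U.lin_indpt S"
  have "finite S \<and> card S \<le> dim" if "?P S" for S
  proof -
    have "S \<subseteq> U" "lin_indpt S" using that span_li_not_depend(2)[OF _ sub, of S] by auto
    then show ?thesis using li_le_dim[OF fd, of S] UV by auto
  qed
  moreover have "?P {}" using U.lin_dep_def by auto
  ultimately obtain S where S: "finite S" "maximal S ?P"
    using maximal_exists[of ?P dim "{}"] by blast
  have "U.basis S" by (rule U.max_li_is_basis[OF S(2)])
  then show ?thesis using S(1) unfolding U.fin_dim_def U.basis_def by blast
qed

text \<open>A basis of \<open>U\<close> is independent in \<open>V\<close> and has enough elements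
  to be a basis of \<open>V\<close>.\<close>

lemma subspace_eq_of_dim:
  assumes fd: fin_dim and U: "VectorSpace.subspace class_ring U V"
    and "vectorspace.dim class_ring (V\<lparr>carrier := U\<rparr>) \<ge> dim"
  shows "U = carrier V"
proof -
  interpret U: vectorspace class_ring "V\<lparr>carrier := U\<rparr>" by (rule subspace_is_vs[OF U])
  have sub: "submodule class_ring U V" using U by (rule subspace.submod)
  then have UV: "U \<subseteq> carrier V" by (rule submodule.subset)
  obtain B where B: "finite B" "U.basis B"
    using U.finite_basis_exists[OF subspace_fin_dim[OF fd U]] by blast
  have BU: "B \<subseteq> U" using B(2) by (auto simp: U.basis_def)
  have "basis B"
  proof (rule dim_li_is_basis[OF fd B(1)])
    show "B \<subseteq> carrier V" using BU UV by blast
    show "lin_indpt B" using B(2) span_li_not_depend(2)[OF BU sub] by (simp add: U.basis_def)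
    show "dim \<le> card B" using U.dim_basis[OF B] assms(3) by simp
  qed
  then have "span B = carrier V" by (simp add: basis_def)
  moreover have "span B \<subseteq> U" by (rule span_is_subset[OF BU sub])
  ultimately show ?thesis using UV by blast
qed

end

lemma lin_comb_hom:
  assumes V: "vectorspace class_ring V" and W: "vectorspace class_ring W"
    and f: "f \<in> module_hom class_ring V W" and us: "set us \<subseteq> carrier V"
  shows "f (lin_comb V c us) = lin_comb W c (map f us)"
  using us
proof (induction us arbitrary: c)
  interpret V: vectorspace class_ring V by (rule V)
  interpret W: vectorspace class_ring W by (rule W)
  interpret f: mod_hom class_ring V W f by unfold_locales (rule f)
  {
    case Nil
    show ?case using f.f0_is_0 by (simp add: lin_comb_Nil V W)
  next
    case (Cons u us)
    have u: "u \<in> carrier V" "set us \<subseteq> carrier V" using Cons.prems by auto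
    then show ?case
      using Cons.IH[OF u(2)] lin_comb_closed[OF V u(2)] module_hom_add[OF f] module_hom_smult[OF f]
      by (simp add: lin_comb_Cons[OF V] lin_comb_Cons[OF W] comp_def)
  }
qed

section \<open>Coordinate vectors and coordinate matrices\<close>

context
  fixes V :: "('k::field, 'm, 'y) module_scheme" and us :: "'m list"
  assumes fr: "frame V us"
begin

private lemma V: "vectorspace class_ring V" using fr by (simp add: frame_def)
private lemma us: "set us \<subseteq> carrier V" using fr by (simp add: frame_def)

lemma coords_carrier: "v \<in> carrier V \<Longrightarrow> coords V us v \<in> carrier_vec (length us)"
  and lin_comb_coords: "v \<in> carrier V \<Longrightarrow> lin_comb V (\<lambda>i. coords V us v $ i) us = v"
proof -
  assume v: "v \<in> carrier V"
  have "\<exists>!x. x \<in> carrier_vec (length us) \<and> v = lin_comb V (\<lambda>i. x $ i) us"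
    using fr v by (simp add: frame_def)
  from theI'[OF this] show "coords V us v \<in> carrier_vec (length us)"
    "lin_comb V (\<lambda>i. coords V us v $ i) us = v"
    unfolding coords_def by simp_all
qed

lemma coords_lin_comb:
  assumes "x \<in> carrier_vec (length us)"
  shows "coords V us (lin_comb V (\<lambda>i. x $ i) us) = x"
proof -
  let ?v = "lin_comb V (\<lambda>i. x $ i) us"
  have v: "?v \<in> carrier V" by (rule lin_comb_closed[OF V us])
  then have "\<exists>!x. x \<in> carrier_vec (length us) \<and> ?v = lin_comb V (\<lambda>i. x $ i) us"
    using fr by (simp add: frame_def)
  then show ?thesis using assms coords_carrier[OF v] lin_comb_coords[OF v] by metis
qed

lemma coords_inj: "\<lbrakk>v \<in> carrier V; w \<in> carrier V; coords V us v = coords V us w\<rbrakk> \<Longrightarrow> v = w"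
  using lin_comb_coords by metis

lemma coords_hom: "coords V us \<in> module_hom class_ring V (module_vec TYPE('k) (length us))"
proof -
  interpret vectorspace class_ring V by (rule V)
  let ?\<kappa> = "coords V us"
  have add: "?\<kappa> (v \<oplus>\<^bsub>V\<^esub> w) = ?\<kappa> v + ?\<kappa> w" if vw: "v \<in> carrier V" "w \<in> carrier V" for v w
  proof -
    have c: "?\<kappa> v \<in> carrier_vec (length us)" "?\<kappa> w \<in> carrier_vec (length us)"
      using vw by (simp_all add: coords_carrier)
    have "v \<oplus>\<^bsub>V\<^esub> w = lin_comb V (\<lambda>i. ?\<kappa> v $ i + ?\<kappa> w $ i) us"
      using vw by (simp add: lin_comb_add[OF V us] lin_comb_coords)
    also have "\<dots> = lin_comb V (\<lambda>i. (?\<kappa> v + ?\<kappa> w) $ i) us"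
      using c by (intro lin_comb_cong[OF V]) simp
    finally show ?thesis using coords_lin_comb[of "?\<kappa> v + ?\<kappa> w"] c by simp
  qed
  have smult: "?\<kappa> (a \<odot>\<^bsub>V\<^esub> v) = a \<cdot>\<^sub>v ?\<kappa> v" if v: "v \<in> carrier V" for a v
  proof -
    have c: "?\<kappa> v \<in> carrier_vec (length us)" using v by (rule coords_carrier)
    have "a \<odot>\<^bsub>V\<^esub> v = lin_comb V (\<lambda>i. a * ?\<kappa> v $ i) us"
      using v by (simp add: lin_comb_smult[OF V us] lin_comb_coords)
    also have "\<dots> = lin_comb V (\<lambda>i. (a \<cdot>\<^sub>v ?\<kappa> v) $ i) us"
      using c by (intro lin_comb_cong[OF V]) simp
    finally show ?thesis using coords_lin_comb[of "a \<cdot>\<^sub>v ?\<kappa> v"] c by simp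
  qed
  show ?thesis
    unfolding module_hom_def by (auto simp: module_vec_simps coords_carrier add smult)
qed

lemma coords_add:
  "\<lbrakk>v \<in> carrier V; w \<in> carrier V\<rbrakk> \<Longrightarrow> coords V us (v \<oplus>\<^bsub>V\<^esub> w) = coords V us v + coords V us w"
  using module_hom_add[OF coords_hom] by (simp add: module_vec_simps)

lemma coords_smult:
  "v \<in> carrier V \<Longrightarrow> coords V us (a \<odot>\<^bsub>V\<^esub> v) = a \<cdot>\<^sub>v coords V us v"
  using module_hom_smult[OF coords_hom] by (simp add: module_vec_simps)

lemma lin_comb_eqI:
  assumes "lin_comb V c us = lin_comb V c' us" "i < length us"
  shows "c i = c' i"
proof -
  have "lin_comb V c us = lin_comb V (\<lambda>i. vec (length us) c $ i) us" for c
    by (rule lin_comb_cong[OF V]) simp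
  from this[of c] this[of c'] have "vec (length us) c = vec (length us) c'"
    using assms(1) coords_lin_comb[of "vec (length us) c"] coords_lin_comb[of "vec (length us) c'"] by simp
  then show ?thesis using assms(2) by (metis index_vec)
qed

definition coord_mat :: "'m list \<Rightarrow> 'k mat" where
  "coord_mat ws = mat_of_rows (length us) (map (coords V us) ws)"

lemma coord_mat_carrier: "coord_mat ws \<in> carrier_mat (length ws) (length us)"
  using mat_of_rows_carrier(1)[of "length us" "map (coords V us) ws"] by (simp only: coord_mat_def length_map)

lemma coord_mat_index:
  "\<lbrakk>i < length ws; j < length us\<rbrakk> \<Longrightarrow> coord_mat ws $$ (i, j) = coords V us (ws ! i) $ j"
  by (simp add: coord_mat_def mat_of_rows_index)

lemma coords_lin_comb_list:
  assumes ws: "set ws \<subseteq> carrier V" and j: "j < length us"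
  shows "coords V us (lin_comb V c ws) $ j = (\<Sum>i<length ws. c i * coords V us (ws ! i) $ j)"
  using ws
proof (induction ws arbitrary: c)
  case Nil
  interpret vectorspace class_ring V by (rule V)
  have "coords V us (0 \<odot>\<^bsub>V\<^esub> \<zero>\<^bsub>V\<^esub>) = 0 \<cdot>\<^sub>v coords V us \<zero>\<^bsub>V\<^esub>" by (rule coords_smult) simp
  moreover have "0 \<odot>\<^bsub>V\<^esub> \<zero>\<^bsub>V\<^esub> = \<zero>\<^bsub>V\<^esub>" using rmult_0[of 0] by simp
  ultimately have "coords V us \<zero>\<^bsub>V\<^esub> = 0 \<cdot>\<^sub>v coords V us \<zero>\<^bsub>V\<^esub>" by simp
  then have "coords V us \<zero>\<^bsub>V\<^esub> $ j = (0 \<cdot>\<^sub>v coords V us \<zero>\<^bsub>V\<^esub>) $ j" by (rule arg_cong)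
  then have "coords V us \<zero>\<^bsub>V\<^esub> $ j = 0"
    using j coords_carrier[OF M.zero_closed] by (simp only: index_smult_vec carrier_vecD mult_zero_left)
  then show ?case by (simp add: lin_comb_Nil[OF V])
next
  case (Cons w ws)
  interpret vectorspace class_ring V by (rule V)
  have w: "w \<in> carrier V" "set ws \<subseteq> carrier V" using Cons.prems by auto
  have cw: "c 0 \<odot>\<^bsub>V\<^esub> w \<in> carrier V" using w(1) by simp
  have r: "lin_comb V (\<lambda>i. c (Suc i)) ws \<in> carrier V" by (rule lin_comb_closed[OF V w(2)])
  have "coords V us (lin_comb V c (w # ws)) $ j =
      (c 0 \<cdot>\<^sub>v coords V us w + coords V us (lin_comb V (\<lambda>i. c (Suc i)) ws)) $ j"
    by (simp only: lin_comb_Cons[OF V] coords_add[OF cw r] coords_smult[OF w(1)])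
  also have "\<dots> = c 0 * coords V us w $ j + coords V us (lin_comb V (\<lambda>i. c (Suc i)) ws) $ j"
    using j coords_carrier[OF w(1)] coords_carrier[OF r] by simp
  finally show ?case
    unfolding Cons.IH[OF w(2)] by (simp add: sum.lessThan_Suc_shift del: sum.lessThan_Suc)
qed

end

section \<open>Modules and quotients\<close>

lemma rmod_hom_iff:
  "f \<in> rmod_hom A X Y \<longleftrightarrow> f \<in> carrier X \<rightarrow> carrier Y
    \<and> (\<forall>x\<in>carrier X. \<forall>y\<in>carrier X. f (x \<oplus>\<^bsub>X\<^esub> y) = f x \<oplus>\<^bsub>Y\<^esub> f y)
    \<and> (\<forall>c. \<forall>x\<in>carrier X. f (c \<odot>\<^bsub>X\<^esub> x) = c \<odot>\<^bsub>Y\<^esub> f x)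
    \<and> (\<forall>x\<in>carrier X. \<forall>a\<in>carrier A. f (x \<star>\<^bsub>X\<^esub> a) = f x \<star>\<^bsub>Y\<^esub> a)"
  unfolding rmod_hom_def module_hom_def by auto

lemma rmod_homD:
  assumes "f \<in> rmod_hom A X Y"
  shows "x \<in> carrier X \<Longrightarrow> f x \<in> carrier Y"
    and "\<lbrakk>x \<in> carrier X; y \<in> carrier X\<rbrakk> \<Longrightarrow> f (x \<oplus>\<^bsub>X\<^esub> y) = f x \<oplus>\<^bsub>Y\<^esub> f y"
    and "x \<in> carrier X \<Longrightarrow> f (c \<odot>\<^bsub>X\<^esub> x) = c \<odot>\<^bsub>Y\<^esub> f x"
    and "\<lbrakk>x \<in> carrier X; a \<in> carrier A\<rbrakk> \<Longrightarrow> f (x \<star>\<^bsub>X\<^esub> a) = f x \<star>\<^bsub>Y\<^esub> a"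
  using assms unfolding rmod_hom_iff by blast+

lemma rmod_hom_compose:
  assumes "f \<in> rmod_hom A X Y" "g \<in> rmod_hom A Y Z"
  shows "(\<lambda>x. g (f x)) \<in> rmod_hom A X Z"
  unfolding rmod_hom_iff using rmod_homD[OF assms(1)] rmod_homD[OF assms(2)] by simp

context fd_right_module
begin

sublocale VM: vectorspace class_ring M by (rule vectorspace_M)

lemma smult_distrib: "\<lbrakk>x \<in> carrier M; y \<in> carrier M\<rbrakk> \<Longrightarrow> c \<odot>\<^bsub>M\<^esub> (x \<oplus>\<^bsub>M\<^esub> y) = c \<odot>\<^bsub>M\<^esub> x \<oplus>\<^bsub>M\<^esub> c \<odot>\<^bsub>M\<^esub> y"
  using VM.smult_r_distr[of c x y] by simp

lemma smult_zero: "x \<in> carrier M \<Longrightarrow> 0 \<odot>\<^bsub>M\<^esub> x = \<zero>\<^bsub>M\<^esub>"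
  using VM.lmult_0 by simp

lemma smult_neg_one: "x \<in> carrier M \<Longrightarrow> (- 1) \<odot>\<^bsub>M\<^esub> x = \<ominus>\<^bsub>M\<^esub> x"
proof -
  assume x: "x \<in> carrier M"
  have "(- 1 + 1) \<odot>\<^bsub>M\<^esub> x = (- 1) \<odot>\<^bsub>M\<^esub> x \<oplus>\<^bsub>M\<^esub> 1 \<odot>\<^bsub>M\<^esub> x"
    using VM.smult_l_distr[of "- 1" 1 x] x by simp
  moreover have "1 \<odot>\<^bsub>M\<^esub> x = x" using VM.smult_one[OF x] by simp
  ultimately have "(- 1) \<odot>\<^bsub>M\<^esub> x \<oplus>\<^bsub>M\<^esub> x = \<zero>\<^bsub>M\<^esub>" using smult_zero[OF x] by simp
  then show ?thesis using x by (intro VM.M.minus_equality[symmetric]) simp_all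
qed

lemma ract_zero: "a \<in> carrier A \<Longrightarrow> \<zero>\<^bsub>M\<^esub> \<star>\<^bsub>M\<^esub> a = \<zero>\<^bsub>M\<^esub>"
  using ract_smult_left[of "\<zero>\<^bsub>M\<^esub>" a 0] smult_zero[OF VM.M.zero_closed]
    smult_zero[OF ract_closed[OF VM.M.zero_closed]] by simp

lemma hom_zero:
  assumes "f \<in> rmod_hom A M N" "fd_right_module A N"
  shows "f \<zero>\<^bsub>M\<^esub> = \<zero>\<^bsub>N\<^esub>"
proof -
  interpret N: fd_right_module A N by (rule assms(2))
  have "f (0 \<odot>\<^bsub>M\<^esub> \<zero>\<^bsub>M\<^esub>) = 0 \<odot>\<^bsub>N\<^esub> f \<zero>\<^bsub>M\<^esub>" by (rule rmod_homD(3)[OF assms(1)]) simp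
  then show ?thesis
    using smult_zero[OF VM.M.zero_closed] N.smult_zero[OF rmod_homD(1)[OF assms(1) VM.M.zero_closed]] by simp
qed

lemma hom_minus:
  assumes "f \<in> rmod_hom A M N" "fd_right_module A N" "x \<in> carrier M" "y \<in> carrier M"
  shows "f (x \<ominus>\<^bsub>M\<^esub> y) = f x \<ominus>\<^bsub>N\<^esub> f y"
proof -
  interpret N: fd_right_module A N by (rule assms(2))
  show ?thesis
    using assms(3,4) rmod_homD[OF assms(1)]
    by (simp add: a_minus_def smult_neg_one[symmetric] N.smult_neg_one[symmetric])
qed

lemma rsubmoduleI:
  assumes "U \<subseteq> carrier M" "\<zero>\<^bsub>M\<^esub> \<in> U"
    and "\<And>x y. \<lbrakk>x \<in> U; y \<in> U\<rbrakk> \<Longrightarrow> x \<oplus>\<^bsub>M\<^esub> y \<in> U"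
    and "\<And>c x. x \<in> U \<Longrightarrow> c \<odot>\<^bsub>M\<^esub> x \<in> U"
    and "\<And>x a. \<lbrakk>x \<in> U; a \<in> carrier A\<rbrakk> \<Longrightarrow> x \<star>\<^bsub>M\<^esub> a \<in> U"
  shows "rsubmodule A M U"
  unfolding rsubmodule_def subspace_def submodule_def
  using assms vectorspace_M VM.module_axioms by blast

lemma rsubmoduleD:
  assumes "rsubmodule A M U"
  shows "U \<subseteq> carrier M" "\<zero>\<^bsub>M\<^esub> \<in> U"
    and "\<lbrakk>x \<in> U; y \<in> U\<rbrakk> \<Longrightarrow> x \<oplus>\<^bsub>M\<^esub> y \<in> U"
    and "x \<in> U \<Longrightarrow> c \<odot>\<^bsub>M\<^esub> x \<in> U"
    and "\<lbrakk>x \<in> U; a \<in> carrier A\<rbrakk> \<Longrightarrow> x \<star>\<^bsub>M\<^esub> a \<in> U"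
  using assms unfolding rsubmodule_def subspace_def submodule_def by auto

text \<open>Transport of structure: the axioms are carried from \<open>M\<close> to its image by
  \<open>f\<close>. It serves both for quotients, with \<open>f\<close> the coset map, and for
  coordinate copies.\<close>

lemma surj_image_module:
  fixes Y :: "('k, 'a, 'n, 'x) rmod_scheme"
  assumes surj: "f ` carrier M = carrier Y"
    and zero: "\<zero>\<^bsub>Y\<^esub> = f \<zero>\<^bsub>M\<^esub>"
    and add: "\<And>x y. \<lbrakk>x \<in> carrier M; y \<in> carrier M\<rbrakk> \<Longrightarrow> f x \<oplus>\<^bsub>Y\<^esub> f y = f (x \<oplus>\<^bsub>M\<^esub> y)"
    and smult: "\<And>c x. x \<in> carrier M \<Longrightarrow> c \<odot>\<^bsub>Y\<^esub> f x = f (c \<odot>\<^bsub>M\<^esub> x)"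
    and act: "\<And>x a. \<lbrakk>x \<in> carrier M; a \<in> carrier A\<rbrakk> \<Longrightarrow> f x \<star>\<^bsub>Y\<^esub> a = f (x \<star>\<^bsub>M\<^esub> a)"
  shows "fd_right_module A Y"
proof -
  have Y: "(\<forall>y\<in>carrier Y. P y) \<longleftrightarrow> (\<forall>x\<in>carrier M. P (f x))" for P
    unfolding surj[symmetric] by simp
  have Y': "(\<forall>y. y \<in> carrier Y \<longrightarrow> P y) \<longleftrightarrow> (\<forall>x\<in>carrier M. P (f x))" for P
    using Y[of P] by blast
  have mem: "f x \<in> carrier Y" if "x \<in> carrier M" for x using surj that by blast
  have vs: "vectorspace class_ring Y"
  proof (rule vs_criteria)
    show "field (class_ring :: 'k ring)" by (rule class_field[unfolded class_field_def])
    show "\<zero>\<^bsub>Y\<^esub> \<in> carrier Y" by (simp add: zero mem)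
    show "\<forall>v w. v \<in> carrier Y \<and> w \<in> carrier Y \<longrightarrow> v \<oplus>\<^bsub>Y\<^esub> w \<in> carrier Y"
      unfolding surj[symmetric] by (auto simp: add)
    show "\<forall>v\<in>carrier Y. \<exists>n\<in>carrier Y. v \<oplus>\<^bsub>Y\<^esub> n = \<zero>\<^bsub>Y\<^esub>"
    proof (unfold Y, intro ballI)
      fix x assume x: "x \<in> carrier M"
      show "\<exists>n\<in>carrier Y. f x \<oplus>\<^bsub>Y\<^esub> n = \<zero>\<^bsub>Y\<^esub>"
        by (rule bexI[of _ "f (\<ominus>\<^bsub>M\<^esub> x)"]) (use x in \<open>simp_all add: add zero mem VM.M.r_neg\<close>)
    qed
    show "\<forall>c v. c \<in> carrier class_ring \<and> v \<in> carrier Y \<longrightarrow> c \<odot>\<^bsub>Y\<^esub> v \<in> carrier Y"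
      unfolding surj[symmetric] by (auto simp: smult)
    show "\<forall>v w. v \<in> carrier Y \<and> w \<in> carrier Y \<longrightarrow> v \<oplus>\<^bsub>Y\<^esub> w = w \<oplus>\<^bsub>Y\<^esub> v"
      unfolding surj[symmetric] by (auto simp: add VM.M.a_comm)
    show "\<forall>v w x. v \<in> carrier Y \<and> w \<in> carrier Y \<and> x \<in> carrier Y \<longrightarrow>
        v \<oplus>\<^bsub>Y\<^esub> w \<oplus>\<^bsub>Y\<^esub> x = v \<oplus>\<^bsub>Y\<^esub> (w \<oplus>\<^bsub>Y\<^esub> x)"
      unfolding surj[symmetric] by (auto simp: add VM.M.a_assoc)
    show "\<forall>v\<in>carrier Y. v \<oplus>\<^bsub>Y\<^esub> \<zero>\<^bsub>Y\<^esub> = v"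
      unfolding surj[symmetric] by (auto simp: add zero)
    show "\<forall>a b v. a \<in> carrier class_ring \<and> b \<in> carrier class_ring \<and> v \<in> carrier Y \<longrightarrow>
        (a \<otimes>\<^bsub>class_ring\<^esub> b) \<odot>\<^bsub>Y\<^esub> v = a \<odot>\<^bsub>Y\<^esub> (b \<odot>\<^bsub>Y\<^esub> v)"
      unfolding surj[symmetric] using VM.smult_assoc1 by (auto simp: smult)
    show "\<forall>v\<in>carrier Y. \<one>\<^bsub>class_ring\<^esub> \<odot>\<^bsub>Y\<^esub> v = v"
      unfolding surj[symmetric] using VM.smult_one by (auto simp: smult)
    show "\<forall>a b v. a \<in> carrier class_ring \<and> b \<in> carrier class_ring \<and> v \<in> carrier Y \<longrightarrow>
        (a \<oplus>\<^bsub>class_ring\<^esub> b) \<odot>\<^bsub>Y\<^esub> v = a \<odot>\<^bsub>Y\<^esub> v \<oplus>\<^bsub>Y\<^esub> b \<odot>\<^bsub>Y\<^esub> v"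
      unfolding surj[symmetric] using VM.smult_l_distr by (auto simp: smult add)
    show "\<forall>a v w. a \<in> carrier class_ring \<and> v \<in> carrier Y \<and> w \<in> carrier Y \<longrightarrow>
        a \<odot>\<^bsub>Y\<^esub> (v \<oplus>\<^bsub>Y\<^esub> w) = a \<odot>\<^bsub>Y\<^esub> v \<oplus>\<^bsub>Y\<^esub> a \<odot>\<^bsub>Y\<^esub> w"
      unfolding surj[symmetric] using smult_distrib by (auto simp: smult add)
  qed
  have "linear_map class_ring M Y f"
    unfolding linear_map_def mod_hom_def mod_hom_axioms_def module_hom_def
    using vs vectorspace_M mem by (auto simp: add smult vectorspace_def)
  then have "vectorspace.fin_dim class_ring Y"
    by (rule linear_map.surj_fin_dim[OF _ fin_dim_M surj])
  then show ?thesis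
    unfolding fd_right_module_def fd_right_module_axioms_def
  proof (intro conjI allI impI fd_algebra_axioms vs)
    fix y n and a b and c :: 'k
    assume "y \<in> carrier Y"
    then obtain x where x: "x \<in> carrier M" "y = f x" using surj by blast
    {
      assume a: "a \<in> carrier A"
      show "y \<star>\<^bsub>Y\<^esub> a \<in> carrier Y" using x a by (simp add: act mem ract_closed)
      show "(c \<odot>\<^bsub>Y\<^esub> y) \<star>\<^bsub>Y\<^esub> a = c \<odot>\<^bsub>Y\<^esub> (y \<star>\<^bsub>Y\<^esub> a)"
        using x a by (simp add: act smult ract_closed ract_smult_left)
      show "y \<star>\<^bsub>Y\<^esub> (c \<odot>\<^bsub>A\<^esub> a) = c \<odot>\<^bsub>Y\<^esub> (y \<star>\<^bsub>Y\<^esub> a)"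
      proof -
        interpret AV: vectorspace class_ring A by (rule vectorspace)
        have "c \<odot>\<^bsub>A\<^esub> a \<in> carrier A" using a by simp
        then show ?thesis using x a by (simp add: act smult ract_closed ract_smult_right)
      qed
      {
        assume b: "b \<in> carrier A"
        interpret AR: ring A by (rule ring)
        show "y \<star>\<^bsub>Y\<^esub> (a \<oplus>\<^bsub>A\<^esub> b) = y \<star>\<^bsub>Y\<^esub> a \<oplus>\<^bsub>Y\<^esub> y \<star>\<^bsub>Y\<^esub> b"
          using x a b by (simp add: act add ract_closed ract_add_right)
        show "y \<star>\<^bsub>Y\<^esub> (a \<otimes>\<^bsub>A\<^esub> b) = y \<star>\<^bsub>Y\<^esub> a \<star>\<^bsub>Y\<^esub> b"
          using x a b by (simp add: act ract_closed ract_mult)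
      }
      {
        assume "n \<in> carrier Y"
        then obtain x' where x': "x' \<in> carrier M" "n = f x'" using surj by blast
        show "(y \<oplus>\<^bsub>Y\<^esub> n) \<star>\<^bsub>Y\<^esub> a = y \<star>\<^bsub>Y\<^esub> a \<oplus>\<^bsub>Y\<^esub> n \<star>\<^bsub>Y\<^esub> a"
          using x x' a by (simp add: act add ract_closed ract_add_left)
      }
    }
    show "y \<star>\<^bsub>Y\<^esub> \<one>\<^bsub>A\<^esub> = y"
    proof -
      interpret AR: ring A by (rule ring)
      show ?thesis using x by (simp add: act ract_one)
    qed
  qed
qed

lemma sub_rmod_module:
  assumes U: "rsubmodule A M U"
  shows "fd_right_module A (sub_rmod M U)"
proof -
  have UM: "u \<in> carrier M" if "u \<in> U" for u using rsubmoduleD(1)[OF U] that by blast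
  have sub: "VectorSpace.subspace class_ring U M" using U by (simp add: rsubmodule_def)
  have vs: "vectorspace class_ring (sub_rmod M U)" by (rule VM.subspace_is_vs[OF sub])
  have fd: "vectorspace.fin_dim class_ring (sub_rmod M U)"
    by (rule subspace_fin_dim[OF vectorspace_M fin_dim_M sub])
  show ?thesis
    unfolding fd_right_module_def fd_right_module_axioms_def
    by (intro conjI allI impI fd_algebra_axioms vs fd)
      (auto simp: UM ract_add_left ract_add_right ract_mult ract_one ract_smult_left ract_smult_right
        rsubmoduleD[OF U])
qed

section \<open>Cosets and the quotient module\<close>

abbreviation coset :: "'m set \<Rightarrow> 'm \<Rightarrow> 'm set" where
  "coset U x \<equiv> U +>\<^bsub>M\<^esub> x"

context
  fixes U assumes U: "rsubmodule A M U"
begin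

private lemma abelian_subgroup: "abelian_subgroup U M"
proof (rule abelian_subgroupI3)
  show "additive_subgroup U M"
    unfolding additive_subgroup_def
  proof (rule group.subgroupI)
    show "group (add_monoid M)" by (rule VM.M.a_group)
    show "inv\<^bsub>add_monoid M\<^esub> x \<in> U" if "x \<in> U" for x
    proof -
      have "\<ominus>\<^bsub>M\<^esub> x \<in> U"
        using rsubmoduleD(1,4)[OF U] that smult_neg_one[of x] by (metis subsetD)
      then show ?thesis by (simp add: a_inv_def)
    qed
  qed (use rsubmoduleD[OF U] in auto)
  show "abelian_group M" by (rule VM.M.abelian_group_axioms)
qed

interpretation US: abelian_subgroup U M by (rule abelian_subgroup)

lemma coset_eq_iff:
  assumes "x \<in> carrier M" "y \<in> carrier M"
  shows "coset U x = coset U y \<longleftrightarrow> x \<ominus>\<^bsub>M\<^esub> y \<in> U"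
proof -
  have "coset U x = coset U y \<longleftrightarrow> x \<in> coset U y"
    using US.a_rcos_self[OF assms(1)] US.a_repr_independence'[OF _ assms(2), of x] by auto
  also have "\<dots> \<longleftrightarrow> x \<ominus>\<^bsub>M\<^esub> y \<in> U"
    unfolding a_minus_def by (rule US.a_rcos_module[OF assms(2,1)])
  finally show ?thesis .
qed

lemma coset_mem: "x \<in> carrier M \<Longrightarrow> y \<in> coset U x \<Longrightarrow> y \<in> carrier M \<and> coset U y = coset U x"
  using US.a_elemrcos_carrier[of x y] US.a_repr_independence'[of y x] by simp

lemma quot_carrier: "carrier (quot_rmod M U) = coset U ` carrier M"
  by (auto simp: quot_rmod_def A_RCOSETS_def')

lemma quot_zero: "\<zero>\<^bsub>quot_rmod M U\<^esub> = coset U \<zero>\<^bsub>M\<^esub>"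
  using VM.M.a_coset_add_zero[OF US.a_subset] by (simp add: quot_rmod_def)

lemma quot_add:
  "\<lbrakk>x \<in> carrier M; y \<in> carrier M\<rbrakk> \<Longrightarrow> coset U x \<oplus>\<^bsub>quot_rmod M U\<^esub> coset U y = coset U (x \<oplus>\<^bsub>M\<^esub> y)"
  using US.a_rcos_sum by (simp add: quot_rmod_def)

lemma quot_smult:
  assumes x: "x \<in> carrier M"
  shows "c \<odot>\<^bsub>quot_rmod M U\<^esub> coset U x = coset U (c \<odot>\<^bsub>M\<^esub> x)"
proof -
  have "coset U (c \<odot>\<^bsub>M\<^esub> y) = coset U (c \<odot>\<^bsub>M\<^esub> x)" if "y \<in> coset U x" for y
  proof -
    have y: "y \<in> carrier M" "y \<ominus>\<^bsub>M\<^esub> x \<in> U" using coset_mem[OF x that] coset_eq_iff[OF _ x] by auto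
    have "c \<odot>\<^bsub>M\<^esub> y \<ominus>\<^bsub>M\<^esub> c \<odot>\<^bsub>M\<^esub> x = c \<odot>\<^bsub>M\<^esub> (y \<ominus>\<^bsub>M\<^esub> x)"
      using x y(1) VM.smult_r_minus[of c x] by (simp add: a_minus_def smult_distrib)
    then show ?thesis using coset_eq_iff rsubmoduleD(4)[OF U y(2)] x y(1) by simp
  qed
  \<comment> \<open>The scalar multiple in the quotient is a union over representatives; it is a
    single coset because all of them agree and at least one exists.\<close>
  moreover have "coset U x \<noteq> {}" using US.a_rcos_self[OF x] by blast
  ultimately have "(\<Union>y\<in>coset U x. coset U (c \<odot>\<^bsub>M\<^esub> y)) = coset U (c \<odot>\<^bsub>M\<^esub> x)"
    by (intro SUP_eq_const)
  then show ?thesis by (simp add: quot_rmod_def)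
qed

lemma quot_act:
  assumes x: "x \<in> carrier M" and a: "a \<in> carrier A"
  shows "coset U x \<star>\<^bsub>quot_rmod M U\<^esub> a = coset U (x \<star>\<^bsub>M\<^esub> a)"
proof -
  have "coset U (y \<star>\<^bsub>M\<^esub> a) = coset U (x \<star>\<^bsub>M\<^esub> a)" if "y \<in> coset U x" for y
  proof -
    have y: "y \<in> carrier M" "y \<ominus>\<^bsub>M\<^esub> x \<in> U" using coset_mem[OF x that] coset_eq_iff[OF _ x] by auto
    have "y \<star>\<^bsub>M\<^esub> a \<ominus>\<^bsub>M\<^esub> x \<star>\<^bsub>M\<^esub> a = (y \<ominus>\<^bsub>M\<^esub> x) \<star>\<^bsub>M\<^esub> a"
      using x y(1) a by (simp add: a_minus_def smult_neg_one[symmetric] ract_add_left ract_smult_left ract_closed)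
    then show ?thesis using coset_eq_iff rsubmoduleD(5)[OF U y(2) a] x y(1) a by (simp add: ract_closed)
  qed
  moreover have "coset U x \<noteq> {}" using US.a_rcos_self[OF x] by blast
  ultimately have "(\<Union>y\<in>coset U x. coset U (y \<star>\<^bsub>M\<^esub> a)) = coset U (x \<star>\<^bsub>M\<^esub> a)"
    by (intro SUP_eq_const)
  then show ?thesis by (simp add: quot_rmod_def)
qed

lemma quot_rmod_module: "fd_right_module A (quot_rmod M U)"
  by (rule surj_image_module[of "coset U"]) (simp_all add: quot_carrier quot_zero quot_add quot_smult quot_act)

lemma coset_hom: "coset U \<in> rmod_hom A M (quot_rmod M U)"
  unfolding rmod_hom_iff by (simp add: quot_carrier quot_add quot_smult quot_act)

lemma coset_eq_zero_iff: "x \<in> carrier M \<Longrightarrow> coset U x = \<zero>\<^bsub>quot_rmod M U\<^esub> \<longleftrightarrow> x \<in> U"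
proof -
  assume x: "x \<in> carrier M"
  have "\<ominus>\<^bsub>M\<^esub> \<zero>\<^bsub>M\<^esub> = \<zero>\<^bsub>M\<^esub>" by (rule VM.M.minus_equality) simp_all
  then have "x \<ominus>\<^bsub>M\<^esub> \<zero>\<^bsub>M\<^esub> = x" using x by (simp only: a_minus_def VM.M.r_zero)
  then show ?thesis unfolding quot_zero using coset_eq_iff[OF x VM.M.zero_closed] by (simp only:)
qed

text \<open>Representatives of one coset differ by an element of \<open>U\<close>, where
  \<open>f\<close> vanishes, so an arbitrary choice of representative gives a well-defined
  \<open>g\<close>.\<close>

lemma hom_factor:
  assumes f: "f \<in> rmod_hom A M N" and N: "fd_right_module A N" and f0: "\<And>u. u \<in> U \<Longrightarrow> f u = \<zero>\<^bsub>N\<^esub>"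
  obtains g where "g \<in> rmod_hom A (quot_rmod M U) N" "\<And>x. x \<in> carrier M \<Longrightarrow> g (coset U x) = f x"
proof -
  interpret N: fd_right_module A N by (rule N)
  define g where "g C = f (SOME x. x \<in> carrier M \<and> coset U x = C)" for C
  have g: "g (coset U x) = f x" if x: "x \<in> carrier M" for x
  proof -
    let ?y = "SOME y. y \<in> carrier M \<and> coset U y = coset U x"
    have y: "?y \<in> carrier M \<and> coset U ?y = coset U x" by (rule someI[of _ x]) (simp add: x)
    then have "?y \<ominus>\<^bsub>M\<^esub> x \<in> U" using coset_eq_iff x by blast
    then have "f ?y \<ominus>\<^bsub>N\<^esub> f x = \<zero>\<^bsub>N\<^esub>" using hom_minus[OF f N, of ?y x] f0 y x by simp
    then show ?thesis unfolding g_def using rmod_homD(1)[OF f] y x by simp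
  qed
  have "g \<in> rmod_hom A (quot_rmod M U) N"
    unfolding rmod_hom_iff quot_carrier
    by (auto simp: g quot_add quot_smult quot_act rmod_homD[OF f] ract_closed)
  then show thesis using g that by blast
qed

end

end

section \<open>Isomorphisms and copies inside the universe \<open>mod_cat\<close>\<close>

lemma rmod_iso_refl: "rmod_iso A X X"
  unfolding rmod_iso_def by (rule bexI[of _ "\<lambda>x. x"]) (auto simp: bij_betw_def rmod_hom_iff)

lemma rmod_iso_trans:
  assumes "rmod_iso A X Y" "rmod_iso A Y Z"
  shows "rmod_iso A X Z"
proof -
  obtain f where f: "f \<in> rmod_hom A X Y" "bij_betw f (carrier X) (carrier Y)"
    using assms(1) by (auto simp: rmod_iso_def)
  obtain g where g: "g \<in> rmod_hom A Y Z" "bij_betw g (carrier Y) (carrier Z)"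
    using assms(2) by (auto simp: rmod_iso_def)
  show ?thesis
    unfolding rmod_iso_def
    using rmod_hom_compose[OF f(1) g(1)] bij_betw_trans[OF f(2) g(2)] by (auto simp: comp_def)
qed

lemma rmod_iso_inverse:
  assumes X: "fd_right_module A X" and f: "f \<in> rmod_hom A X Y" "bij_betw f (carrier X) (carrier Y)"
  obtains g where "g \<in> rmod_hom A Y X" "bij_betw g (carrier Y) (carrier X)"
    "\<And>x. x \<in> carrier X \<Longrightarrow> g (f x) = x" "\<And>y. y \<in> carrier Y \<Longrightarrow> f (g y) = y"
proof -
  interpret X: fd_right_module A X by (rule X)
  let ?g = "inv_into (carrier X) f"
  have surj: "f ` carrier X = carrier Y" and inj: "inj_on f (carrier X)"
    using f(2) by (auto simp: bij_betw_def)
  have gf: "?g (f x) = x" if "x \<in> carrier X" for x using inj that by simp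
  have fg: "f (?g y) = y" if "y \<in> carrier Y" for y
    using that surj by (intro f_inv_into_f) simp
  have "?g \<in> rmod_hom A Y X"
    unfolding rmod_hom_iff surj[symmetric]
    using inj rmod_homD(2,3,4)[OF f(1), symmetric] by (auto simp: X.ract_closed)
  then show thesis using that[of ?g] bij_betw_inv_into[OF f(2)] gf fg by blast
qed

lemma rmod_iso_sym:
  assumes "fd_right_module A X" "rmod_iso A X Y"
  shows "rmod_iso A Y X"
proof -
  obtain f where f: "f \<in> rmod_hom A X Y" "bij_betw f (carrier X) (carrier Y)"
    using assms(2) by (auto simp: rmod_iso_def)
  obtain g where "g \<in> rmod_hom A Y X" "bij_betw g (carrier Y) (carrier X)"
    by (rule rmod_iso_inverse[OF assms(1) f])
  then show ?thesis by (auto simp: rmod_iso_def)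
qed

text \<open>The structure is transported along the coordinates of a basis. This is how modules on
  arbitrary types reach objects of \<open>mod_cat\<close>, where the axioms of \<open>tors\<close>
  apply.\<close>

lemma mod_cat_copy_exists:
  fixes X :: "('k::field, 'a, 'm, 'y) rmod_scheme"
  assumes "fd_right_module A X"
  obtains Y where "Y \<in> mod_cat A" "rmod_iso A X Y"
proof -
  interpret X: fd_right_module A X by (rule assms)
  obtain us where us: "ordered_basis X us"
    using ordered_basis_exists[OF X.vectorspace_M X.fin_dim_M] by blast
  have fr: "frame X us" by (rule ordered_basis_imp_frame[OF X.vectorspace_M us])
  then have sub: "set us \<subseteq> carrier X" by (simp add: frame_def)
  let ?n = "length us" and ?\<kappa> = "coords X us"
  define Y :: "('k, 'a, 'k vec) rmod" where
    "Y = \<lparr>carrier = carrier_vec ?n, monoid.mult = (\<lambda>v w. v), one = 0\<^sub>v ?n, zero = 0\<^sub>v ?n, add = (+),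
      smult = (\<cdot>\<^sub>v), ract = (\<lambda>v a. ?\<kappa> (lin_comb X (\<lambda>i. v $ i) us \<star>\<^bsub>X\<^esub> a))\<rparr>"
  have surj: "?\<kappa> ` carrier X = carrier Y"
  proof
    show "?\<kappa> ` carrier X \<subseteq> carrier Y" using coords_carrier[OF fr] by (auto simp: Y_def)
    show "carrier Y \<subseteq> ?\<kappa> ` carrier X"
    proof
      fix v assume "v \<in> carrier Y"
      then have "v = ?\<kappa> (lin_comb X (\<lambda>i. v $ i) us)"
        using coords_lin_comb[OF fr, of v] by (simp add: Y_def)
      moreover have "lin_comb X (\<lambda>i. v $ i) us \<in> carrier X" by (rule lin_comb_closed[OF X.vectorspace_M sub])
      ultimately show "v \<in> ?\<kappa> ` carrier X" by (rule image_eqI)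
    qed
  qed
  have zero: "?\<kappa> \<zero>\<^bsub>X\<^esub> = 0\<^sub>v ?n"
  proof -
    have "?\<kappa> \<zero>\<^bsub>X\<^esub> = ?\<kappa> (0 \<odot>\<^bsub>X\<^esub> \<zero>\<^bsub>X\<^esub>)" using X.smult_zero[OF X.VM.M.zero_closed] by simp
    also have "\<dots> = 0 \<cdot>\<^sub>v ?\<kappa> \<zero>\<^bsub>X\<^esub>" by (rule coords_smult[OF fr]) simp
    also have "\<dots> = 0\<^sub>v ?n" using coords_carrier[OF fr X.VM.M.zero_closed] by (intro eq_vecI) auto
    finally show ?thesis .
  qed
  have "fd_right_module A Y"
  proof (rule X.surj_image_module[OF surj])
    show "\<zero>\<^bsub>Y\<^esub> = ?\<kappa> \<zero>\<^bsub>X\<^esub>" by (simp add: Y_def zero)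
  qed (simp_all add: Y_def coords_add[OF fr] coords_smult[OF fr] lin_comb_coords[OF fr])
  moreover have "?\<kappa> \<in> rmod_hom A X Y"
    unfolding rmod_hom_iff
    using coords_carrier[OF fr] by (simp add: Y_def coords_add[OF fr] coords_smult[OF fr] lin_comb_coords[OF fr])
  moreover have "bij_betw ?\<kappa> (carrier X) (carrier Y)"
    using surj coords_inj[OF fr] by (auto simp: bij_betw_def inj_on_def)
  ultimately show thesis using that by (auto simp: mod_cat_def rmod_iso_def)
qed

context fd_right_module
begin

lemma kernel_rsubmodule:
  assumes f: "f \<in> rmod_hom A M N" and N: "fd_right_module A N"
  shows "rsubmodule A M {x \<in> carrier M. f x = \<zero>\<^bsub>N\<^esub>}"
proof -
  interpret N: fd_right_module A N by (rule N)
  show ?thesis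
  proof (rule rsubmoduleI)
    show "c \<odot>\<^bsub>M\<^esub> x \<in> {x \<in> carrier M. f x = \<zero>\<^bsub>N\<^esub>}" if "x \<in> {x \<in> carrier M. f x = \<zero>\<^bsub>N\<^esub>}" for c x
    proof -
      have "c \<odot>\<^bsub>N\<^esub> \<zero>\<^bsub>N\<^esub> = \<zero>\<^bsub>N\<^esub>" using N.VM.rmult_0[of c] by simp
      then show ?thesis using that rmod_homD(3)[OF f] by simp
    qed
  qed (use hom_zero[OF f N] rmod_homD[OF f] ract_closed N.ract_zero in auto)
qed

lemma image_rsubmodule:
  assumes f: "f \<in> rmod_hom A M N" and N: "fd_right_module A N"
  shows "rsubmodule A N (f ` carrier M)"
proof -
  interpret N: fd_right_module A N by (rule N)
  show ?thesis
  proof (rule N.rsubmoduleI)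
    show "f ` carrier M \<subseteq> carrier N" using rmod_homD(1)[OF f] by blast
    show "\<zero>\<^bsub>N\<^esub> \<in> f ` carrier M" using hom_zero[OF f N] by (metis VM.M.zero_closed image_eqI)
    show "x \<oplus>\<^bsub>N\<^esub> y \<in> f ` carrier M" if "x \<in> f ` carrier M" "y \<in> f ` carrier M" for x y
      using that rmod_homD(2)[OF f, symmetric] by auto
    show "c \<odot>\<^bsub>N\<^esub> x \<in> f ` carrier M" if "x \<in> f ` carrier M" for c x
      using that rmod_homD(3)[OF f, symmetric] by auto
    show "x \<star>\<^bsub>N\<^esub> a \<in> f ` carrier M" if "x \<in> f ` carrier M" "a \<in> carrier A" for x a
      using that rmod_homD(4)[OF f, symmetric] ract_closed by auto
  qed
qed

text \<open>The first isomorphism theorem: the map induced on cosets is injective because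
  \<open>U\<close> is the whole kernel.\<close>

lemma quot_iso_image:
  assumes f: "f \<in> rmod_hom A M N" and N: "fd_right_module A N" and surj: "f ` carrier M = carrier N"
    and U: "U = {x \<in> carrier M. f x = \<zero>\<^bsub>N\<^esub>}"
  shows "rmod_iso A (quot_rmod M U) N"
proof -
  interpret N: fd_right_module A N by (rule N)
  have sub: "rsubmodule A M U" unfolding U by (rule kernel_rsubmodule[OF f N])
  obtain g where g: "g \<in> rmod_hom A (quot_rmod M U) N" "\<And>x. x \<in> carrier M \<Longrightarrow> g (coset U x) = f x"
    using hom_factor[OF sub f N] U by blast
  have "inj_on g (carrier (quot_rmod M U))"
  proof (rule inj_onI)
    fix C D assume "C \<in> carrier (quot_rmod M U)" "D \<in> carrier (quot_rmod M U)" and eq: "g C = g D"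
    then obtain x y where xy: "x \<in> carrier M" "y \<in> carrier M" "C = coset U x" "D = coset U y"
      by (auto simp: quot_carrier[OF sub])
    have "f x = f y" using eq g(2) xy by simp
    then have "f (x \<ominus>\<^bsub>M\<^esub> y) = \<zero>\<^bsub>N\<^esub>"
      using hom_minus[OF f N xy(1,2)] rmod_homD(1)[OF f] xy by simp
    then have "x \<ominus>\<^bsub>M\<^esub> y \<in> U" using xy by (simp add: U)
    then show "C = D" using coset_eq_iff[OF sub xy(1,2)] xy by simp
  qed
  moreover have "g ` carrier (quot_rmod M U) = carrier N"
    unfolding quot_carrier[OF sub] image_image using g(2) surj by simp
  ultimately show ?thesis using g(1) by (auto simp: rmod_iso_def bij_betw_def)
qed

lemma rsubmodule_sub_rmod:
  assumes "rsubmodule A M W" "rsubmodule A M U" "U \<subseteq> W"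
  shows "rsubmodule A (sub_rmod M W) U"
  by (rule fd_right_module.rsubmoduleI[OF sub_rmod_module[OF assms(1)]])
    (use assms(3) rsubmoduleD[OF assms(2)] in simp_all)

end

section \<open>Torsion classes\<close>

lemma in_class_iso: "\<lbrakk>rmod_iso A X Y; in_class A T Y\<rbrakk> \<Longrightarrow> in_class A T X"
  unfolding in_class_def using rmod_iso_trans by blast

lemma in_class_iso': "\<lbrakk>fd_right_module A X; rmod_iso A X Y; in_class A T X\<rbrakk> \<Longrightarrow> in_class A T Y"
  by (rule in_class_iso[OF rmod_iso_sym])

lemma in_classI: "X \<in> T \<Longrightarrow> in_class A T X"
  unfolding in_class_def using rmod_iso_refl by blast

lemma in_class_mod_cat:
  assumes T: "T \<in> tors A" and X: "X \<in> mod_cat A" and "in_class A T X"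
  shows "X \<in> T"
proof -
  obtain Y where Y: "Y \<in> T" "rmod_iso A X Y" using assms(3) by (auto simp: in_class_def)
  have "rmod_iso A Y X" using rmod_iso_sym[OF _ Y(2)] X by (simp add: mod_cat_def)
  then show ?thesis using T Y(1) X unfolding tors_def by blast
qed

lemma tors_mod_cat: "\<lbrakk>T \<in> tors A; X \<in> T\<rbrakk> \<Longrightarrow> fd_right_module A X"
  unfolding tors_def mod_cat_def by blast

text \<open>\<open>tors\<close> speaks only of quotients of objects of the class itself. So an
  isomorphic object \<open>X0\<close> of the class is mapped onto \<open>Y\<close>, and its quotient
  by the kernel is \<open>Y\<close> up to isomorphism.\<close>

lemma in_class_image:
  assumes T: "T \<in> tors A" and X: "fd_right_module A X" and Y: "fd_right_module A Y"
    and f: "f \<in> rmod_hom A X Y" "f ` carrier X = carrier Y" and "in_class A T X"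
  shows "in_class A T Y"
proof -
  obtain X0 h where X0: "X0 \<in> T" and h: "h \<in> rmod_hom A X X0" "bij_betw h (carrier X) (carrier X0)"
    using assms(6) by (auto simp: in_class_def rmod_iso_def)
  obtain g where g: "g \<in> rmod_hom A X0 X" "bij_betw g (carrier X0) (carrier X)"
    by (rule rmod_iso_inverse[OF X h])
  interpret X0: fd_right_module A X0 by (rule tors_mod_cat[OF T X0])
  let ?f = "\<lambda>x. f (g x)"
  have f': "?f \<in> rmod_hom A X0 Y" by (rule rmod_hom_compose[OF g(1) f(1)])
  have surj: "?f ` carrier X0 = carrier Y"
    using g(2) f(2) by (metis bij_betw_imp_surj_on image_image)
  let ?K = "{x \<in> carrier X0. ?f x = \<zero>\<^bsub>Y\<^esub>}"
  have K: "rsubmodule A X0 ?K" by (rule X0.kernel_rsubmodule[OF f' Y])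
  then have "in_class A T (quot_rmod X0 ?K)"
    using T X0 unfolding tors_def by blast
  moreover have "rmod_iso A (quot_rmod X0 ?K) Y" by (rule X0.quot_iso_image[OF f' Y surj refl])
  ultimately show ?thesis using in_class_iso' X0.quot_rmod_module[OF K] by blast
qed

text \<open>The extension axiom of \<open>tors\<close> concerns objects of \<open>mod_cat\<close>,
  so the surjection and its kernel are carried over to a copy \<open>Y0\<close>. Describing the
  extension by a surjection lets the third term be any convenient module instead of a literal
  quotient.\<close>

lemma in_class_extension:
  assumes T: "T \<in> tors A" and Y: "fd_right_module A Y" and W: "fd_right_module A W"
    and f: "f \<in> rmod_hom A Y W" "f ` carrier Y = carrier W"
    and U: "U = {y \<in> carrier Y. f y = \<zero>\<^bsub>W\<^esub>}"
    and in_U: "in_class A T (sub_rmod Y U)" and in_W: "in_class A T W"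
  shows "in_class A T Y"
proof -
  interpret Y: fd_right_module A Y by (rule Y)
  have subU: "rsubmodule A Y U" unfolding U by (rule Y.kernel_rsubmodule[OF f(1) W])
  obtain Y0 where Y0: "Y0 \<in> mod_cat A" "rmod_iso A Y Y0" by (rule mod_cat_copy_exists[OF Y])
  then obtain h where h: "h \<in> rmod_hom A Y Y0" "bij_betw h (carrier Y) (carrier Y0)"
    by (auto simp: rmod_iso_def)
  obtain g where g: "g \<in> rmod_hom A Y0 Y" "bij_betw g (carrier Y0) (carrier Y)"
      "\<And>x. x \<in> carrier Y \<Longrightarrow> g (h x) = x" "\<And>y. y \<in> carrier Y0 \<Longrightarrow> h (g y) = y"
    by (rule rmod_iso_inverse[OF Y h]) blast
  interpret Y0: fd_right_module A Y0 using Y0(1) by (simp add: mod_cat_def)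
  let ?f = "\<lambda>x. f (g x)"
  have f': "?f \<in> rmod_hom A Y0 W" by (rule rmod_hom_compose[OF g(1) f(1)])
  have surj: "?f ` carrier Y0 = carrier W"
    using g(2) f(2) by (metis bij_betw_imp_surj_on image_image)
  let ?K = "{x \<in> carrier Y0. ?f x = \<zero>\<^bsub>W\<^esub>}"
  have K: "rsubmodule A Y0 ?K" by (rule Y0.kernel_rsubmodule[OF f' W])
  have hU: "h ` U = ?K"
  proof
    show "h ` U \<subseteq> ?K" using U g(3) rmod_homD(1)[OF h(1)] by auto
    show "?K \<subseteq> h ` U"
    proof
      fix x assume "x \<in> ?K"
      then have "g x \<in> U" "x = h (g x)" using U g(4) rmod_homD(1)[OF g(1)] by auto
      then show "x \<in> h ` U" by (rule rev_image_eqI)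
    qed
  qed
  have "h \<in> rmod_hom A (sub_rmod Y U) (sub_rmod Y0 ?K)"
    unfolding rmod_hom_iff using hU Y.rsubmoduleD(1)[OF subU] rmod_homD[OF h(1)] by (auto simp: subset_iff)
  moreover have "bij_betw h (carrier (sub_rmod Y U)) (carrier (sub_rmod Y0 ?K))"
    using hU h(2) Y.rsubmoduleD(1)[OF subU] by (auto simp: bij_betw_def intro: inj_on_subset)
  ultimately have "rmod_iso A (sub_rmod Y U) (sub_rmod Y0 ?K)" unfolding rmod_iso_def by blast
  then have "in_class A T (sub_rmod Y0 ?K)"
    using in_class_iso'[OF Y.sub_rmod_module[OF subU]] in_U by blast
  moreover have "in_class A T (quot_rmod Y0 ?K)"
    using in_class_iso[OF Y0.quot_iso_image[OF f' W surj refl] in_W] .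
  ultimately have "Y0 \<in> T" using T Y0(1) K unfolding tors_def by blast
  then show ?thesis using Y0(2) by (auto simp: in_class_def)
qed

lemma subspace_dim_le:
  fixes V :: "('k::field, 'm, 'y) module_scheme"
  assumes V: "vectorspace class_ring V" and fd: "vectorspace.fin_dim class_ring V"
    and U: "VectorSpace.subspace class_ring U V"
  shows "vectorspace.dim class_ring (V\<lparr>carrier := U\<rparr>) \<le> vectorspace.dim class_ring V"
proof -
  interpret vectorspace class_ring V by (rule V)
  interpret U: vectorspace class_ring "V\<lparr>carrier := U\<rparr>" by (rule subspace_is_vs[OF U])
  have sub: "submodule class_ring U V" using U by (rule subspace.submod)
  obtain B where B: "finite B" "U.basis B"
    using U.finite_basis_exists[OF subspace_fin_dim[OF V fd U]] by blast
  have BU: "B \<subseteq> U" using B(2) by (auto simp: U.basis_def)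
  have "B \<subseteq> carrier V" using BU submodule.subset[OF sub] by blast
  moreover have "lin_indpt B" using B(2) span_li_not_depend(2)[OF BU sub] by (simp add: U.basis_def)
  ultimately show ?thesis using li_le_dim(2)[OF fd] U.dim_basis[OF B] by simp
qed

section \<open>The torsion part of a module\<close>

context fd_right_module
begin

lemma rsubmodule_sum:
  assumes U: "rsubmodule A M U" and V: "rsubmodule A M V"
  defines "S \<equiv> {u \<oplus>\<^bsub>M\<^esub> v | u v. u \<in> U \<and> v \<in> V}"
  shows "rsubmodule A M S" "U \<subseteq> S" "V \<subseteq> S"
proof -
  have mem: "u \<in> carrier M" if "u \<in> U \<or> u \<in> V" for u
    using that rsubmoduleD(1)[OF U] rsubmoduleD(1)[OF V] by blast
  have SI: "u \<oplus>\<^bsub>M\<^esub> v \<in> S" if "u \<in> U" "v \<in> V" for u v using that by (auto simp: S_def)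
  show US: "U \<subseteq> S"
  proof
    fix u assume u: "u \<in> U"
    have "u \<oplus>\<^bsub>M\<^esub> \<zero>\<^bsub>M\<^esub> \<in> S" by (rule SI[OF u rsubmoduleD(2)[OF V]])
    then show "u \<in> S" using mem u by simp
  qed
  show "V \<subseteq> S"
  proof
    fix v assume v: "v \<in> V"
    have "\<zero>\<^bsub>M\<^esub> \<oplus>\<^bsub>M\<^esub> v \<in> S" by (rule SI[OF rsubmoduleD(2)[OF U] v])
    then show "v \<in> S" using mem v by simp
  qed
  show "rsubmodule A M S"
  proof (rule rsubmoduleI)
    show "S \<subseteq> carrier M" using mem by (auto simp: S_def)
    show "\<zero>\<^bsub>M\<^esub> \<in> S" using US rsubmoduleD(2)[OF U] by blast
  next
    fix x y assume "x \<in> S" "y \<in> S"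
    then obtain u v u' v' where *: "u \<in> U" "v \<in> V" "u' \<in> U" "v' \<in> V" "x = u \<oplus>\<^bsub>M\<^esub> v" "y = u' \<oplus>\<^bsub>M\<^esub> v'"
      by (auto simp: S_def)
    have "x \<oplus>\<^bsub>M\<^esub> y = (u \<oplus>\<^bsub>M\<^esub> u') \<oplus>\<^bsub>M\<^esub> (v \<oplus>\<^bsub>M\<^esub> v')"
      unfolding *(5,6) using * mem by (simp add: VM.M.a_ac)
    then show "x \<oplus>\<^bsub>M\<^esub> y \<in> S"
      using SI[OF rsubmoduleD(3)[OF U *(1,3)] rsubmoduleD(3)[OF V *(2,4)]] by simp
  next
    fix c x assume "x \<in> S"
    then obtain u v where *: "u \<in> U" "v \<in> V" "x = u \<oplus>\<^bsub>M\<^esub> v" by (auto simp: S_def)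
    have "c \<odot>\<^bsub>M\<^esub> x = c \<odot>\<^bsub>M\<^esub> u \<oplus>\<^bsub>M\<^esub> c \<odot>\<^bsub>M\<^esub> v"
      unfolding *(3) using * mem by (simp add: smult_distrib)
    then show "c \<odot>\<^bsub>M\<^esub> x \<in> S"
      using SI[OF rsubmoduleD(4)[OF U *(1), of c] rsubmoduleD(4)[OF V *(2), of c]] by simp
  next
    fix x a assume "x \<in> S" and a: "a \<in> carrier A"
    then obtain u v where *: "u \<in> U" "v \<in> V" "x = u \<oplus>\<^bsub>M\<^esub> v" by (auto simp: S_def)
    have "x \<star>\<^bsub>M\<^esub> a = u \<star>\<^bsub>M\<^esub> a \<oplus>\<^bsub>M\<^esub> v \<star>\<^bsub>M\<^esub> a"
      unfolding *(3) using * mem a by (simp add: ract_add_left)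
    then show "x \<star>\<^bsub>M\<^esub> a \<in> S"
      using SI[OF rsubmoduleD(5)[OF U *(1) a] rsubmoduleD(5)[OF V *(2) a]] by simp
  qed
qed

text \<open>\<open>U + V\<close> is an extension of \<open>(U + V)/U\<close> by \<open>U\<close>,
  and \<open>V\<close> maps onto \<open>(U + V)/U\<close>; closure under factor modules and
  extensions thus suffices.\<close>

lemma in_class_sum:
  assumes T: "T \<in> tors A" and U: "rsubmodule A M U" "in_class A T (sub_rmod M U)"
    and V: "rsubmodule A M V" "in_class A T (sub_rmod M V)"
  defines "S \<equiv> {u \<oplus>\<^bsub>M\<^esub> v | u v. u \<in> U \<and> v \<in> V}"
  shows "in_class A T (sub_rmod M S)"
proof -
  note S = rsubmodule_sum[OF U(1) V(1), folded S_def]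
  let ?S = "sub_rmod M S"
  interpret S: fd_right_module A ?S by (rule sub_rmod_module[OF S(1)])
  have US: "rsubmodule A ?S U" by (rule rsubmodule_sub_rmod[OF S(1) U(1) S(2)])
  note Q = S.quot_rmod_module[OF US] and hom = S.coset_hom[OF US]
  have kernel: "U = {y \<in> carrier ?S. S.coset U y = \<zero>\<^bsub>quot_rmod ?S U\<^esub>}"
    using S.coset_eq_zero_iff[OF US] S(2) by auto
  have surj: "S.coset U ` V = carrier (quot_rmod ?S U)"
  proof
    show "S.coset U ` V \<subseteq> carrier (quot_rmod ?S U)" using S(3) by (auto simp: S.quot_carrier[OF US])
    show "carrier (quot_rmod ?S U) \<subseteq> S.coset U ` V"
    proof
      fix C assume "C \<in> carrier (quot_rmod ?S U)"
      then obtain x where x: "x \<in> S" "C = S.coset U x" by (auto simp: S.quot_carrier[OF US])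
      then obtain u v where uv: "u \<in> U" "v \<in> V" "x = u \<oplus>\<^bsub>M\<^esub> v" by (auto simp: S_def)
      have "S.coset U x = S.coset U u \<oplus>\<^bsub>quot_rmod ?S U\<^esub> S.coset U v"
        using S.quot_add[OF US, of u v] uv S(2,3) by (simp add: subset_iff)
      also have "S.coset U u = \<zero>\<^bsub>quot_rmod ?S U\<^esub>"
        using S.coset_eq_zero_iff[OF US, of u] uv(1) S(2) by (simp add: subset_iff)
      also have "\<zero>\<^bsub>quot_rmod ?S U\<^esub> \<oplus>\<^bsub>quot_rmod ?S U\<^esub> S.coset U v = S.coset U v"
      proof -
        interpret Q: fd_right_module A "quot_rmod ?S U" by (rule Q)
        have "S.coset U v \<in> carrier (quot_rmod ?S U)"
          using uv(2) S(3) by (auto simp: S.quot_carrier[OF US])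
        then show ?thesis by (rule Q.VM.M.l_zero)
      qed
      finally show "C \<in> S.coset U ` V" using x(2) uv(2) by blast
    qed
  qed
  have "S.coset U \<in> rmod_hom A (sub_rmod M V) (quot_rmod ?S U)"
    using rmod_homD[OF hom] S(3) unfolding rmod_hom_iff by (auto simp: subset_iff)
  from in_class_image[OF T sub_rmod_module[OF V(1)] Q this _ V(2)] surj
  have "in_class A T (quot_rmod ?S U)" by simp
  moreover have "in_class A T (sub_rmod ?S U)" using U(2) by simp
  moreover have "S.coset U ` carrier ?S = carrier (quot_rmod ?S U)" by (rule S.quot_carrier[OF US, symmetric])
  ultimately show ?thesis
    using in_class_extension[OF T S.fd_right_module_axioms Q hom _ kernel] by blast
qed

lemma in_class_zero:
  assumes T: "T \<in> tors A" and zero: "carrier M = {\<zero>\<^bsub>M\<^esub>}"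
  shows "in_class A T M"
proof -
  obtain Y where Y: "Y \<in> mod_cat A" "rmod_iso A M Y" by (rule mod_cat_copy_exists[OF fd_right_module_axioms])
  then obtain h where h: "h \<in> rmod_hom A M Y" "bij_betw h (carrier M) (carrier Y)"
    by (auto simp: rmod_iso_def)
  have "carrier Y = {\<zero>\<^bsub>Y\<^esub>}"
    using bij_betw_imp_surj_on[OF h(2)] hom_zero[OF h(1)] Y(1) zero by (simp add: mod_cat_def)
  then have "Y \<in> T" using T Y(1) unfolding tors_def by blast
  then show ?thesis using Y(2) by (auto simp: in_class_def)
qed

lemma zero_rsubmodule: "rsubmodule A M {\<zero>\<^bsub>M\<^esub>}"
proof (rule rsubmoduleI)
  show "c \<odot>\<^bsub>M\<^esub> x \<in> {\<zero>\<^bsub>M\<^esub>}" if "x \<in> {\<zero>\<^bsub>M\<^esub>}" for c x using that VM.rmult_0[of c] by simp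
qed (auto simp: ract_zero)

text \<open>Among the submodules in the class take one of largest dimension; its sum with any other
  is again in the class and has no larger dimension, hence equals it. So the \<open>GREATEST\<close>
  in the definition of \<open>torsion_part\<close> exists.\<close>

lemma torsion_part_greatest:
  assumes T: "T \<in> tors A"
  shows "rsubmodule A M (torsion_part A T M)" "in_class A T (sub_rmod M (torsion_part A T M))"
    and "\<And>V. \<lbrakk>rsubmodule A M V; in_class A T (sub_rmod M V)\<rbrakk> \<Longrightarrow> V \<subseteq> torsion_part A T M"
proof -
  let ?P = "\<lambda>U. rsubmodule A M U \<and> in_class A T (sub_rmod M U)"
  let ?dim = "\<lambda>U. vectorspace.dim class_ring (sub_rmod M U)"
  have "?P {\<zero>\<^bsub>M\<^esub>}"
    using zero_rsubmodule fd_right_module.in_class_zero[OF sub_rmod_module[OF zero_rsubmodule] T] by simp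
  moreover have "\<forall>U. ?P U \<longrightarrow> ?dim U \<le> VM.dim"
    using subspace_dim_le[OF vectorspace_M fin_dim_M] by (auto simp: rsubmodule_def)
  ultimately obtain U where U: "?P U" and max: "\<And>V. ?P V \<Longrightarrow> ?dim V \<le> ?dim U"
    using ex_has_greatest_nat[of ?P "{\<zero>\<^bsub>M\<^esub>}" ?dim "Suc VM.dim"] by (auto simp: less_Suc_eq_le)
  have greatest: "V \<subseteq> U" if V: "?P V" for V
  proof -
    define S where "S = {u \<oplus>\<^bsub>M\<^esub> v | u v. u \<in> U \<and> v \<in> V}"
    have S: "rsubmodule A M S" "U \<subseteq> S" "V \<subseteq> S"
      using rsubmodule_sum[of U V] U V unfolding S_def by blast+
    have "in_class A T (sub_rmod M S)"
      unfolding S_def using in_class_sum[OF T] U V by blast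
    then have dim: "?dim S \<le> ?dim U" using max S(1) by blast
    interpret S: fd_right_module A "sub_rmod M S" by (rule sub_rmod_module[OF S(1)])
    have "VectorSpace.subspace class_ring U (sub_rmod M S)"
      using rsubmodule_sub_rmod[OF S(1) _ S(2)] U by (simp add: rsubmodule_def)
    from subspace_eq_of_dim[OF S.vectorspace_M S.fin_dim_M this] dim have "U = S" by simp
    then show ?thesis using S(3) by simp
  qed
  have "torsion_part A T M = U"
    unfolding torsion_part_def by (rule Greatest_equality) (use U greatest in auto)
  then show "rsubmodule A M (torsion_part A T M)" "in_class A T (sub_rmod M (torsion_part A T M))"
    "\<And>V. \<lbrakk>rsubmodule A M V; in_class A T (sub_rmod M V)\<rbrakk> \<Longrightarrow> V \<subseteq> torsion_part A T M"
    using U greatest by auto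
qed

text \<open>
  The preimage in \<open>M\<close> of the image of a homomorphism \<open>X \<rightarrow> M/U\<close> is an extension of modules in the
  torsion class, hence contained in the torsion part.
\<close>

lemma hom_into_quotient_zero:
  assumes T: "T \<in> tors A" and U: "rsubmodule A M U" "in_class A T (sub_rmod M U)"
    and greatest: "\<And>V. \<lbrakk>rsubmodule A M V; in_class A T (sub_rmod M V)\<rbrakk> \<Longrightarrow> V \<subseteq> U"
    and X: "fd_right_module A X" "in_class A T X"
    and f: "f \<in> rmod_hom A X (quot_rmod M U)" and x: "x \<in> carrier X"
  shows "f x = \<zero>\<^bsub>quot_rmod M U\<^esub>"
proof -
  interpret X: fd_right_module A X by (rule X(1))
  interpret Q: fd_right_module A "quot_rmod M U" by (rule quot_rmod_module[OF U(1)])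
  note Q = Q.fd_right_module_axioms
  define I where "I = f ` carrier X"
  have I: "rsubmodule A (quot_rmod M U) I" unfolding I_def by (rule X.image_rsubmodule[OF f Q])
  define W where "W = {y \<in> carrier M. coset U y \<in> I}"
  note hom = coset_hom[OF U(1)]
  have W: "rsubmodule A M W"
  proof (rule rsubmoduleI)
    show "\<zero>\<^bsub>M\<^esub> \<in> W"
      using Q.rsubmoduleD(2)[OF I] hom_zero[OF hom Q] by (simp add: W_def)
  qed (use rmod_homD[OF hom] Q.rsubmoduleD[OF I] ract_closed in \<open>auto simp: W_def\<close>)
  have UW: "U \<subseteq> W"
  proof
    fix u assume u: "u \<in> U"
    then have "u \<in> carrier M" using rsubmoduleD(1)[OF U(1)] by blast
    then show "u \<in> W"
      using coset_eq_zero_iff[OF U(1), of u] u Q.rsubmoduleD(2)[OF I] by (simp add: W_def)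
  qed
  have surj: "coset U ` W = I"
  proof
    show "I \<subseteq> coset U ` W"
    proof
      fix C assume C: "C \<in> I"
      then have "C \<in> carrier (quot_rmod M U)" using Q.rsubmoduleD(1)[OF I] by blast
      then obtain y where "y \<in> carrier M" "C = coset U y" by (auto simp: quot_carrier[OF U(1)])
      then show "C \<in> coset U ` W" using C by (auto simp: W_def)
    qed
  qed (auto simp: W_def)
  let ?W = "sub_rmod M W" and ?I = "sub_rmod (quot_rmod M U) I"
  have f': "f \<in> rmod_hom A X ?I"
    using f unfolding rmod_hom_iff by (auto simp: I_def)
  have "in_class A T ?I"
    by (rule in_class_image[OF T X(1) Q.sub_rmod_module[OF I] f' _ X(2)]) (simp add: I_def)
  moreover have "coset U \<in> rmod_hom A ?W ?I"
    using rmod_homD[OF hom] rsubmoduleD(1)[OF W] surj unfolding rmod_hom_iff by (auto simp: subset_iff)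
  moreover have "U = {y \<in> carrier ?W. coset U y = \<zero>\<^bsub>?I\<^esub>}"
    using coset_eq_zero_iff[OF U(1)] UW rsubmoduleD(1)[OF W] by auto
  moreover have "in_class A T (sub_rmod ?W U)" using U(2) by simp
  ultimately have "in_class A T ?W"
    using in_class_extension[OF T sub_rmod_module[OF W] Q.sub_rmod_module[OF I], of "coset U" U] surj by simp
  \<comment> \<open>Maximality of \<open>U\<close> forces the preimage into \<open>U\<close>, so
    \<open>I\<close> consists of the zero coset only.\<close>
  then have "W \<subseteq> U" using greatest W by blast
  have "f x \<in> I" using x by (simp add: I_def)
  then obtain y where "y \<in> W" "f x = coset U y" using surj by blast
  then show ?thesis
    using \<open>W \<subseteq> U\<close> coset_eq_zero_iff[OF U(1), of y] rsubmoduleD(1)[OF W] by (simp add: subset_iff)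
qed

lemma torsion_part_hom_orthogonal:
  assumes T: "T \<in> tors A"
  shows "torsion_part A T M \<in> \<S> A M"
  unfolding hom_orthogonal_submodules_def
  using hom_into_quotient_zero[OF T torsion_part_greatest[OF T]
      sub_rmod_module[OF torsion_part_greatest(1)[OF T]] torsion_part_greatest(2)[OF T]]
    torsion_part_greatest(1)[OF T] by simp

end

section \<open>Direct sums as modules\<close>

lemma sum_rmod_simps:
  "carrier (sum_rmod X Y) = carrier X \<times> carrier Y"
  "\<zero>\<^bsub>sum_rmod X Y\<^esub> = (\<zero>\<^bsub>X\<^esub>, \<zero>\<^bsub>Y\<^esub>)"
  "p \<oplus>\<^bsub>sum_rmod X Y\<^esub> q = (fst p \<oplus>\<^bsub>X\<^esub> fst q, snd p \<oplus>\<^bsub>Y\<^esub> snd q)"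
  "c \<odot>\<^bsub>sum_rmod X Y\<^esub> p = (c \<odot>\<^bsub>X\<^esub> fst p, c \<odot>\<^bsub>Y\<^esub> snd p)"
  "p \<star>\<^bsub>sum_rmod X Y\<^esub> a = (fst p \<star>\<^bsub>X\<^esub> a, snd p \<star>\<^bsub>Y\<^esub> a)"
  by (simp_all add: sum_rmod_def direct_sum_def module.defs rmod.defs)

lemma sum_rmod_module:
  fixes X :: "('k::field, 'a, 'm, 'y) rmod_scheme" and Y :: "('k, 'a, 'n, 'x) rmod_scheme"
  assumes X: "fd_right_module A X" and Y: "fd_right_module A Y"
  shows "fd_right_module A (sum_rmod X Y)"
proof -
  let ?S = "sum_rmod X Y"
  interpret X: fd_right_module A X by (rule X)
  interpret Y: fd_right_module A Y by (rule Y)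
  interpret AR: ring A by (rule X.ring)
  interpret AV: vectorspace class_ring A by (rule X.vectorspace)
  have vs: "vectorspace class_ring (?S)"
  proof (rule vs_criteria)
    show "field (class_ring :: 'k ring)" by (rule class_field[unfolded class_field_def])
    show "\<forall>v\<in>carrier (?S). \<exists>n\<in>carrier (?S). v \<oplus>\<^bsub>?S\<^esub> n = \<zero>\<^bsub>?S\<^esub>"
    proof
      fix v assume "v \<in> carrier (?S)"
      then show "\<exists>n\<in>carrier (?S). v \<oplus>\<^bsub>?S\<^esub> n = \<zero>\<^bsub>?S\<^esub>"
        by (intro bexI[of _ "(\<ominus>\<^bsub>X\<^esub> fst v, \<ominus>\<^bsub>Y\<^esub> snd v)"])
          (auto simp: sum_rmod_simps X.VM.M.r_neg Y.VM.M.r_neg)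
    qed
    show "\<forall>a b v. a \<in> carrier class_ring \<and> b \<in> carrier class_ring \<and> v \<in> carrier (?S) \<longrightarrow>
        (a \<otimes>\<^bsub>class_ring\<^esub> b) \<odot>\<^bsub>?S\<^esub> v = a \<odot>\<^bsub>?S\<^esub> (b \<odot>\<^bsub>?S\<^esub> v)"
      using X.VM.smult_assoc1 Y.VM.smult_assoc1 by (auto simp: sum_rmod_simps)
    show "\<forall>v\<in>carrier (?S). \<one>\<^bsub>class_ring\<^esub> \<odot>\<^bsub>?S\<^esub> v = v"
      using X.VM.smult_one Y.VM.smult_one by (auto simp: sum_rmod_simps)
    show "\<forall>a b v. a \<in> carrier class_ring \<and> b \<in> carrier class_ring \<and> v \<in> carrier (?S) \<longrightarrow>
        (a \<oplus>\<^bsub>class_ring\<^esub> b) \<odot>\<^bsub>?S\<^esub> v = a \<odot>\<^bsub>?S\<^esub> v \<oplus>\<^bsub>?S\<^esub> b \<odot>\<^bsub>?S\<^esub> v"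
      using X.VM.smult_l_distr Y.VM.smult_l_distr by (auto simp: sum_rmod_simps)
  qed (auto simp: sum_rmod_simps X.VM.M.a_ac Y.VM.M.a_ac
      X.smult_distrib Y.smult_distrib)
  obtain us where us: "ordered_basis X us"
    using ordered_basis_exists[OF X.vectorspace_M X.fin_dim_M] by blast
  obtain ws where ws: "ordered_basis Y ws"
    using ordered_basis_exists[OF Y.vectorspace_M Y.fin_dim_M] by blast
  note fX = ordered_basis_imp_frame[OF X.vectorspace_M us] and fY = ordered_basis_imp_frame[OF Y.vectorspace_M ws]
  have sX: "set us \<subseteq> carrier X" and sY: "set ws \<subseteq> carrier Y"
    using fX fY by (simp_all add: frame_def)
  let ?m = "length us" and ?n = "length ws"
  \<comment> \<open>Finite dimension comes from a linear surjection defined on vectors of length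
    \<open>?m + ?n\<close>: the first \<open>?m\<close> entries are coordinates for
    \<open>X\<close>, the others for \<open>Y\<close>.\<close>
  define F where "F v = (lin_comb X (\<lambda>i. v $ i) us, lin_comb Y (\<lambda>i. v $ (?m + i)) ws)" for v :: "'k vec"
  interpret W: vec_space "TYPE('k)" "?m + ?n" .
  have closed: "F v \<in> carrier (?S)" for v
    unfolding F_def sum_rmod_simps
    using lin_comb_closed[OF X.vectorspace_M sX] lin_comb_closed[OF Y.vectorspace_M sY] by blast
  have add: "F (v + w) = F v \<oplus>\<^bsub>?S\<^esub> F w" if "v \<in> carrier_vec (?m + ?n)" "w \<in> carrier_vec (?m + ?n)" for v w
  proof -
    have "lin_comb X (\<lambda>i. (v + w) $ i) us = lin_comb X (\<lambda>i. v $ i + w $ i) us"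
      using that by (intro lin_comb_cong[OF X.vectorspace_M]) simp
    moreover have "lin_comb Y (\<lambda>i. (v + w) $ (?m + i)) ws = lin_comb Y (\<lambda>i. v $ (?m + i) + w $ (?m + i)) ws"
      using that by (intro lin_comb_cong[OF Y.vectorspace_M]) simp
    ultimately show ?thesis
      unfolding F_def by (simp add: sum_rmod_simps lin_comb_add[OF X.vectorspace_M sX] lin_comb_add[OF Y.vectorspace_M sY])
  qed
  have smult: "F (c \<cdot>\<^sub>v v) = c \<odot>\<^bsub>?S\<^esub> F v" if "v \<in> carrier_vec (?m + ?n)" for c v
  proof -
    have "lin_comb X (\<lambda>i. (c \<cdot>\<^sub>v v) $ i) us = lin_comb X (\<lambda>i. c * v $ i) us"
      using that by (intro lin_comb_cong[OF X.vectorspace_M]) simp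
    moreover have "lin_comb Y (\<lambda>i. (c \<cdot>\<^sub>v v) $ (?m + i)) ws = lin_comb Y (\<lambda>i. c * v $ (?m + i)) ws"
      using that by (intro lin_comb_cong[OF Y.vectorspace_M]) simp
    ultimately show ?thesis
      unfolding F_def by (simp add: sum_rmod_simps lin_comb_smult[OF X.vectorspace_M sX] lin_comb_smult[OF Y.vectorspace_M sY])
  qed
  have "linear_map class_ring (module_vec TYPE('k) (?m + ?n)) (?S) F"
    unfolding linear_map_def mod_hom_def mod_hom_axioms_def module_hom_def
    using vs vec_vs[of "?m + ?n", where ?'a = 'k] closed add smult
    by (auto simp: vectorspace_def module_vec_simps)
  moreover have "F ` carrier (module_vec TYPE('k) (?m + ?n)) = carrier (?S)"
  proof
    show "carrier (?S) \<subseteq> F ` carrier (module_vec TYPE('k) (?m + ?n))"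
    proof
      fix p assume "p \<in> carrier (?S)"
      then obtain x y where p: "p = (x, y)" "x \<in> carrier X" "y \<in> carrier Y" by (auto simp: sum_rmod_simps)
      let ?v = "vec (?m + ?n) (\<lambda>i. if i < ?m then coords X us x $ i else coords Y ws y $ (i - ?m))"
      have "lin_comb X (\<lambda>i. ?v $ i) us = lin_comb X (\<lambda>i. coords X us x $ i) us"
        by (intro lin_comb_cong[OF X.vectorspace_M]) simp
      moreover have "lin_comb Y (\<lambda>i. ?v $ (?m + i)) ws = lin_comb Y (\<lambda>i. coords Y ws y $ i) ws"
        by (intro lin_comb_cong[OF Y.vectorspace_M]) simp
      ultimately have "p = F ?v"
        unfolding F_def p(1) using lin_comb_coords[OF fX p(2)] lin_comb_coords[OF fY p(3)] by simp
      moreover have "?v \<in> carrier (module_vec TYPE('k) (?m + ?n))" by (simp add: module_vec_simps)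
      ultimately show "p \<in> F ` carrier (module_vec TYPE('k) (?m + ?n))" by (rule image_eqI)
    qed
  qed (use closed in blast)
  ultimately have fd: "vectorspace.fin_dim class_ring (?S)"
    by (rule linear_map.surj_fin_dim[OF _ W.fin_dim])
  show ?thesis
    unfolding fd_right_module_def fd_right_module_axioms_def
    by (intro conjI allI impI X.fd_algebra_axioms vs fd)
      (auto simp: sum_rmod_simps X.ract_closed Y.ract_closed X.ract_add_left Y.ract_add_left
        X.ract_add_right Y.ract_add_right X.ract_mult Y.ract_mult X.ract_one Y.ract_one
        X.ract_smult_left Y.ract_smult_left X.ract_smult_right Y.ract_smult_right)
qed

section \<open>Isolated points of the Grassmannian\<close>

text \<open>Associativity for a row vector \<open>c\<close>: multiplying it by \<open>C\<close> and
  then by \<open>Y\<close> is multiplying it by \<open>C * Y\<close>.\<close>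

lemma sum_swap_mult:
  fixes C Y :: "'k::field mat"
  assumes "C \<in> carrier_mat s t" "Y \<in> carrier_mat t d" "l < d"
  shows "(\<Sum>k<t. (\<Sum>i<s. c i * C $$ (i, k)) * Y $$ (k, l)) = (\<Sum>i<s. c i * (C * Y) $$ (i, l))"
proof -
  have "(\<Sum>k<t. (\<Sum>i<s. c i * C $$ (i, k)) * Y $$ (k, l)) =
      (\<Sum>k<t. \<Sum>i<s. c i * (C $$ (i, k) * Y $$ (k, l)))"
    by (simp only: sum_distrib_right mult.assoc)
  also have "\<dots> = (\<Sum>i<s. \<Sum>k<t. c i * (C $$ (i, k) * Y $$ (k, l)))" by (rule sum.swap)
  also have "\<dots> = (\<Sum>i<s. c i * (C * Y) $$ (i, l))"
    using assms by (intro sum.cong refl) (simp only: sum_distrib_left[symmetric] mult_mat_index_sum lessThan_iff)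
  finally show ?thesis .
qed

section \<open>Matrices of the action and of submodules\<close>

context fd_right_module
begin

lemma ract_hom: "a \<in> carrier A \<Longrightarrow> (\<lambda>m. m \<star>\<^bsub>M\<^esub> a) \<in> module_hom class_ring M M"
  by (simp add: module_hom_def ract_closed ract_add_left ract_smult_left)

text \<open>The rows hold the images of the basis vectors, so coordinates are row vectors multiplied
  from the right, and stability of the row space of \<open>X\<close> takes the form
  \<open>X * R = C * X\<close>.\<close>

definition act_matrix :: "'m list \<Rightarrow> 'a \<Rightarrow> 'k mat" where
  "act_matrix bs a = coord_mat M bs (map (\<lambda>b. b \<star>\<^bsub>M\<^esub> a) bs)"

lemma act_matrix_carrier: "frame M bs \<Longrightarrow> act_matrix bs a \<in> carrier_mat (length bs) (length bs)"
  unfolding act_matrix_def using coord_mat_carrier[of M bs "map (\<lambda>b. b \<star>\<^bsub>M\<^esub> a) bs"] by simp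

lemma coords_act:
  assumes fr: "frame M bs" and m: "m \<in> carrier M" and a: "a \<in> carrier A" and l: "l < length bs"
  shows "coords M bs (m \<star>\<^bsub>M\<^esub> a) $ l = (\<Sum>j<length bs. coords M bs m $ j * act_matrix bs a $$ (j, l))"
proof -
  have bs: "set bs \<subseteq> carrier M" using fr by (simp add: frame_def)
  have bsa: "set (map (\<lambda>b. b \<star>\<^bsub>M\<^esub> a) bs) \<subseteq> carrier M" using bs a by (auto simp: ract_closed)
  have "m \<star>\<^bsub>M\<^esub> a = lin_comb M (\<lambda>j. coords M bs m $ j) (map (\<lambda>b. b \<star>\<^bsub>M\<^esub> a) bs)"
    using lin_comb_hom[OF vectorspace_M vectorspace_M ract_hom[OF a] bs] lin_comb_coords[OF fr m] by metis
  then have "coords M bs (m \<star>\<^bsub>M\<^esub> a) $ l = (\<Sum>j<length bs. coords M bs m $ j * coords M bs (bs ! j \<star>\<^bsub>M\<^esub> a) $ l)"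
    using coords_lin_comb_list[OF fr bsa l] by simp
  also have "\<dots> = (\<Sum>j<length bs. coords M bs m $ j * act_matrix bs a $$ (j, l))"
    unfolding act_matrix_def using l by (intro sum.cong refl) (simp add: coord_mat_index[OF fr])
  finally show ?thesis .
qed

lemma coord_mat_act_index:
  assumes fr: "frame M bs" and us: "set us \<subseteq> carrier M" and a: "a \<in> carrier A"
    and i: "i < length us" and l: "l < length bs"
  shows "(coord_mat M bs us * act_matrix bs a) $$ (i, l) = coords M bs (us ! i \<star>\<^bsub>M\<^esub> a) $ l"
proof -
  have u: "us ! i \<in> carrier M" using us i nth_mem by blast
  show ?thesis
    unfolding mult_mat_index_sum[OF coord_mat_carrier[OF fr] act_matrix_carrier[OF fr] i l] coords_act[OF fr u a l]
    using i by (intro sum.cong refl) (simp add: coord_mat_index[OF fr])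
qed

lemma coords_lin_comb_row:
  assumes fr: "frame M bs" and us: "set us \<subseteq> carrier M" and l: "l < length bs"
    and C: "C \<in> carrier_mat t (length us)" and i: "i < t"
  shows "coords M bs (lin_comb M (\<lambda>k. C $$ (i, k)) us) $ l = (C * coord_mat M bs us) $$ (i, l)"
  unfolding coords_lin_comb_list[OF fr us l] mult_mat_index_sum[OF C coord_mat_carrier[OF fr] i l]
  using l by (intro sum.cong refl) (simp add: coord_mat_index[OF fr])

lemma coord_eqI:
  assumes fr: "frame M bs" and "v \<in> carrier M" "w \<in> carrier M"
    and "\<And>l. l < length bs \<Longrightarrow> coords M bs v $ l = coords M bs w $ l"
  shows "v = w"
proof (rule coords_inj[OF fr assms(2,3)])
  show "coords M bs v = coords M bs w"
    using assms(4) coords_carrier[OF fr assms(2)] coords_carrier[OF fr assms(3)] by (intro eq_vecI) auto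
qed

context
  fixes W us bs
  assumes W: "rsubmodule A M W" and fr: "frame M bs" and frW: "frame (sub_rmod M W) us"
begin

private lemma sub: "VectorSpace.subspace class_ring W M" using W by (simp add: rsubmodule_def)
private lemma us: "set us \<subseteq> W" using frW by (simp add: frame_def)
private lemma usM: "set us \<subseteq> carrier M" using us rsubmoduleD(1)[OF W] by blast

lemma lin_comb_sub_coords: "w \<in> W \<Longrightarrow> lin_comb M (\<lambda>i. coords (sub_rmod M W) us w $ i) us = w"
  using lin_comb_coords[OF frW, of w] lin_comb_subspace_eq[OF vectorspace_M sub] by simp

lemma lin_comb_sub_mem: "lin_comb M c us \<in> W"
  by (rule lin_comb_in_subspace[OF vectorspace_M sub us])

lemma coords_sub_rows:
  assumes ws: "set ws \<subseteq> W"
  shows "coord_mat M bs ws = coord_mat (sub_rmod M W) us ws * coord_mat M bs us"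
proof (rule eq_matI)
  let ?C = "coord_mat (sub_rmod M W) us ws"
  note C = coord_mat_carrier[OF frW, of ws] and X = coord_mat_carrier[OF fr, of us]
  note CX = mult_carrier_mat[OF C X]
  fix i l assume "i < dim_row (?C * coord_mat M bs us)" "l < dim_col (?C * coord_mat M bs us)"
  then have il: "i < length ws" "l < length bs" by (simp_all only: carrier_matD[OF CX])
  have wi: "ws ! i \<in> W" using ws il(1) nth_mem by blast
  have "coord_mat M bs ws $$ (i, l) = coords M bs (ws ! i) $ l"
    by (rule coord_mat_index[OF fr il])
  also have "ws ! i = lin_comb M (\<lambda>k. coords (sub_rmod M W) us (ws ! i) $ k) us"
    by (rule lin_comb_sub_coords[OF wi, symmetric])
  also have "\<dots> = lin_comb M (\<lambda>k. ?C $$ (i, k)) us"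
    by (rule lin_comb_cong[OF vectorspace_M]) (simp add: coord_mat_index[OF frW il(1)])
  also have "coords M bs \<dots> $ l = (?C * coord_mat M bs us) $$ (i, l)"
    by (rule coords_lin_comb_row[OF fr usM il(2) C il(1)])
  finally show "coord_mat M bs ws $$ (i, l) = (?C * coord_mat M bs us) $$ (i, l)" .
next
  note C = coord_mat_carrier[OF frW, of ws] and X = coord_mat_carrier[OF fr, of us]
  note CX = mult_carrier_mat[OF C X]
  show "dim_row (coord_mat M bs ws) = dim_row (coord_mat (sub_rmod M W) us ws * coord_mat M bs us)"
    "dim_col (coord_mat M bs ws) = dim_col (coord_mat (sub_rmod M W) us ws * coord_mat M bs us)"
    by (simp_all only: carrier_matD[OF CX] carrier_matD[OF coord_mat_carrier[OF fr, of ws]])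
qed

text \<open>The images of the elements of \<open>us\<close> stay in \<open>W\<close>; their
  coordinates with respect to \<open>us\<close> form the matrix \<open>C\<close> of the action on
  \<open>W\<close> that occurs in the chart equation.\<close>

lemma coord_mat_stable:
  assumes a: "a \<in> carrier A"
  shows "coord_mat M bs us * act_matrix bs a =
    coord_mat (sub_rmod M W) us (map (\<lambda>u. u \<star>\<^bsub>M\<^esub> a) us) * coord_mat M bs us"
proof -
  let ?ws = "map (\<lambda>u. u \<star>\<^bsub>M\<^esub> a) us"
  note P = mult_carrier_mat[OF coord_mat_carrier[OF fr, of us] act_matrix_carrier[OF fr, of a]]
  note ws = coord_mat_carrier[OF fr, of ?ws, unfolded length_map]
  have "coord_mat M bs us * act_matrix bs a = coord_mat M bs ?ws"
  proof (rule eq_matI)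
    fix i l assume "i < dim_row (coord_mat M bs ?ws)" "l < dim_col (coord_mat M bs ?ws)"
    then have il: "i < length us" "l < length bs" by (simp_all only: carrier_matD[OF ws])
    show "(coord_mat M bs us * act_matrix bs a) $$ (i, l) = coord_mat M bs ?ws $$ (i, l)"
      unfolding coord_mat_act_index[OF fr usM a il] using il by (simp add: coord_mat_index[OF fr])
  qed (simp_all only: carrier_matD[OF P] carrier_matD[OF ws])
  moreover have "set ?ws \<subseteq> W" using us rsubmoduleD(5)[OF W _ a] by auto
  ultimately show ?thesis using coords_sub_rows by simp
qed

lemma coord_mat_full_rank:
  "\<exists>js. length js = length us \<and> set js \<subseteq> {..<length bs} \<and> column_minor (coord_mat M bs us) js \<noteq> 0"
proof (rule full_rank_column_minor[OF coord_mat_carrier[OF fr]])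
  fix c assume c: "\<forall>j<length bs. (\<Sum>i<length us. c i * coord_mat M bs us $$ (i, j)) = 0"
  have lin: "coords M bs (lin_comb M c us) $ j = (\<Sum>i<length us. c i * coord_mat M bs us $$ (i, j))"
    if "j < length bs" for j c
    unfolding coords_lin_comb_list[OF fr usM that] using that
    by (intro sum.cong refl) (simp add: coord_mat_index[OF fr])
  have "lin_comb M c us = lin_comb M (\<lambda>i. 0) us"
    by (rule coord_eqI[OF fr lin_comb_closed[OF vectorspace_M usM] lin_comb_closed[OF vectorspace_M usM]])
      (simp add: lin c)
  then have "lin_comb (sub_rmod M W) c us = lin_comb (sub_rmod M W) (\<lambda>i. 0) us"
    by (simp add: lin_comb_subspace_eq[OF vectorspace_M sub])
  then show "\<forall>i<length us. c i = 0" using lin_comb_eqI[OF frW] by blast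
qed

text \<open>
  The rows of \<open>Y\<close> are the coordinates of lifts to \<open>M\<close> of the images of the basis vectors under a
  homomorphism \<open>W \<rightarrow> M/W\<close>.
\<close>

lemma coord_mat_rigid:
  assumes orth: "W \<in> \<S> A M" and Y: "Y \<in> carrier_mat (length us) (length bs)"
    and lin: "\<And>a. a \<in> carrier A \<Longrightarrow> \<exists>D\<in>carrier_mat (length us) (length us).
      Y * act_matrix bs a = coord_mat (sub_rmod M W) us (map (\<lambda>u. u \<star>\<^bsub>M\<^esub> a) us) * Y + D * coord_mat M bs us"
  shows "\<exists>D\<in>carrier_mat (length us) (length us). Y = D * coord_mat M bs us"
proof -
  let ?s = "length us" and ?d = "length bs" and ?N = "sub_rmod M W"
  let ?X = "coord_mat M bs us"
  have bs: "set bs \<subseteq> carrier M" using fr by (simp add: frame_def)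
  interpret N: fd_right_module A ?N by (rule sub_rmod_module[OF W])
  note X = coord_mat_carrier[OF fr, of us]
  define ys where "ys = map (\<lambda>i. lin_comb M (\<lambda>j. Y $$ (i, j)) bs) [0..<?s]"
  have len: "length ys = ?s" by (simp add: ys_def)
  have ys: "set ys \<subseteq> carrier M" using lin_comb_closed[OF vectorspace_M bs] by (auto simp: ys_def)
  have Y_index: "coords M bs (ys ! i) $ l = Y $$ (i, l)" if "i < ?s" "l < ?d" for i l
  proof -
    have "ys ! i = lin_comb M (\<lambda>j. vec ?d (\<lambda>j. Y $$ (i, j)) $ j) bs"
      unfolding ys_def using that by (simp, intro lin_comb_cong[OF vectorspace_M], simp)
    then show ?thesis using coords_lin_comb[OF fr, of "vec ?d (\<lambda>j. Y $$ (i, j))"] that by simp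
  qed
  define g where "g u = lin_comb M (\<lambda>i. coords ?N us u $ i) ys" for u
  have g_closed: "g u \<in> carrier M" for u unfolding g_def by (rule lin_comb_closed[OF vectorspace_M ys])
  have cc: "coords ?N us u \<in> carrier_vec ?s" if "u \<in> W" for u using coords_carrier[OF frW] that by simp
  have g_add: "g (u \<oplus>\<^bsub>M\<^esub> v) = g u \<oplus>\<^bsub>M\<^esub> g v" if "u \<in> W" "v \<in> W" for u v
  proof -
    have "coords ?N us (u \<oplus>\<^bsub>M\<^esub> v) = coords ?N us u + coords ?N us v"
      using coords_add[OF frW, of u v] that by simp
    then have "g (u \<oplus>\<^bsub>M\<^esub> v) = lin_comb M (\<lambda>i. coords ?N us u $ i + coords ?N us v $ i) ys"
      unfolding g_def using carrier_vecD[OF cc[OF that(2)]] len by (intro lin_comb_cong[OF vectorspace_M]) simp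
    then show ?thesis unfolding g_def by (simp only: lin_comb_add[OF vectorspace_M ys])
  qed
  have g_smult: "g (c \<odot>\<^bsub>M\<^esub> u) = c \<odot>\<^bsub>M\<^esub> g u" if "u \<in> W" for c u
  proof -
    have "coords ?N us (c \<odot>\<^bsub>M\<^esub> u) = c \<cdot>\<^sub>v coords ?N us u"
      using coords_smult[OF frW, of u c] that by simp
    then have "g (c \<odot>\<^bsub>M\<^esub> u) = lin_comb M (\<lambda>i. c * coords ?N us u $ i) ys"
      unfolding g_def using carrier_vecD[OF cc[OF that]] len by (intro lin_comb_cong[OF vectorspace_M]) simp
    then show ?thesis unfolding g_def by (simp only: lin_comb_smult[OF vectorspace_M ys])
  qed
  have g_coords: "coords M bs (g u) $ l = (\<Sum>i<?s. coords ?N us u $ i * Y $$ (i, l))" if "l < ?d" for u l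
    unfolding g_def coords_lin_comb_list[OF fr ys that] len using that Y_index by (intro sum.cong refl) simp
  \<comment> \<open>The linear lift \<open>g\<close> need not commute with the action.
    \<open>D\<close> supplies the coefficients, with respect to \<open>us\<close>, of an error lying
    in \<open>W\<close>, so the induced map into the quotient does commute.\<close>
  have g_act: "g u \<star>\<^bsub>M\<^esub> a \<ominus>\<^bsub>M\<^esub> g (u \<star>\<^bsub>M\<^esub> a) \<in> W" if u: "u \<in> W" and a: "a \<in> carrier A" for u a
  proof -
    let ?C = "coord_mat ?N us (map (\<lambda>u. u \<star>\<^bsub>M\<^esub> a) us)"
    have C: "?C \<in> carrier_mat ?s ?s" using coord_mat_carrier[OF frW, of "map (\<lambda>u. u \<star>\<^bsub>M\<^esub> a) us"] by simp
    obtain D where D: "D \<in> carrier_mat ?s ?s" "Y * act_matrix bs a = ?C * Y + D * ?X" using lin[OF a] by blast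
    let ?c = "\<lambda>i. coords ?N us u $ i"
    let ?w = "lin_comb M (\<lambda>k. \<Sum>i<?s. ?c i * D $$ (i, k)) us"
    have w: "?w \<in> W" by (rule lin_comb_sub_mem)
    then have wM: "?w \<in> carrier M" using rsubmoduleD(1)[OF W] by blast
    have "g u \<star>\<^bsub>M\<^esub> a = g (u \<star>\<^bsub>M\<^esub> a) \<oplus>\<^bsub>M\<^esub> ?w"
    proof (rule coord_eqI[OF fr])
      show "g u \<star>\<^bsub>M\<^esub> a \<in> carrier M" by (rule ract_closed[OF g_closed a])
      show "g (u \<star>\<^bsub>M\<^esub> a) \<oplus>\<^bsub>M\<^esub> ?w \<in> carrier M" using g_closed wM by simp
      fix l assume l: "l < ?d"
      have act: "coords ?N us (u \<star>\<^bsub>M\<^esub> a) $ k = (\<Sum>i<?s. ?c i * ?C $$ (i, k))" if "k < ?s" for k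
        using N.coords_act[OF frW _ a that, of u] u by (simp add: N.act_matrix_def)
      have "coords M bs (g u \<star>\<^bsub>M\<^esub> a) $ l = (\<Sum>j<?d. (\<Sum>i<?s. ?c i * Y $$ (i, j)) * act_matrix bs a $$ (j, l))"
        unfolding coords_act[OF fr g_closed a l] by (intro sum.cong refl) (simp only: g_coords lessThan_iff)
      also have "\<dots> = (\<Sum>i<?s. ?c i * (Y * act_matrix bs a) $$ (i, l))"
        by (rule sum_swap_mult[OF Y act_matrix_carrier[OF fr] l])
      also have "\<dots> = (\<Sum>i<?s. ?c i * (?C * Y) $$ (i, l) + ?c i * (D * ?X) $$ (i, l))"
      proof (rule sum.cong[OF refl])
        fix i assume "i \<in> {..<?s}"
        then have "(?C * Y + D * ?X) $$ (i, l) = (?C * Y) $$ (i, l) + (D * ?X) $$ (i, l)"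
          using l by (intro index_add_mat(1)) (simp_all only: carrier_matD[OF mult_carrier_mat[OF D(1) X]] lessThan_iff)
        then show "?c i * (Y * act_matrix bs a) $$ (i, l) = ?c i * (?C * Y) $$ (i, l) + ?c i * (D * ?X) $$ (i, l)"
          unfolding D(2) by (simp only: distrib_left)
      qed
      also have "\<dots> = (\<Sum>k<?s. (\<Sum>i<?s. ?c i * ?C $$ (i, k)) * Y $$ (k, l)) + (\<Sum>k<?s. (\<Sum>i<?s. ?c i * D $$ (i, k)) * ?X $$ (k, l))"
        unfolding sum.distrib sum_swap_mult[OF C Y l] sum_swap_mult[OF D(1) X l] ..
      also have "(\<Sum>k<?s. (\<Sum>i<?s. ?c i * ?C $$ (i, k)) * Y $$ (k, l)) = coords M bs (g (u \<star>\<^bsub>M\<^esub> a)) $ l"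
        unfolding g_coords[OF l] by (intro sum.cong refl) (simp only: act lessThan_iff)
      also have "(\<Sum>k<?s. (\<Sum>i<?s. ?c i * D $$ (i, k)) * ?X $$ (k, l)) = coords M bs ?w $ l"
        unfolding coords_lin_comb_list[OF fr usM l] using l
        by (intro sum.cong refl) (simp add: coord_mat_index[OF fr])
      also have "coords M bs (g (u \<star>\<^bsub>M\<^esub> a)) $ l + coords M bs ?w $ l = coords M bs (g (u \<star>\<^bsub>M\<^esub> a) \<oplus>\<^bsub>M\<^esub> ?w) $ l"
        unfolding coords_add[OF fr g_closed wM] using coords_carrier[OF fr wM] l by simp
      finally show "coords M bs (g u \<star>\<^bsub>M\<^esub> a) $ l = coords M bs (g (u \<star>\<^bsub>M\<^esub> a) \<oplus>\<^bsub>M\<^esub> ?w) $ l" .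
    qed
    then have "g u \<star>\<^bsub>M\<^esub> a \<ominus>\<^bsub>M\<^esub> g (u \<star>\<^bsub>M\<^esub> a) = ?w"
      using g_closed[of "u \<star>\<^bsub>M\<^esub> a"] wM by (simp add: a_minus_def VM.M.a_ac VM.M.r_neg2)
    then show ?thesis using w by simp
  qed
  have hom: "(\<lambda>u. coset W (g u)) \<in> rmod_hom A ?N (quot_rmod M W)"
    unfolding rmod_hom_iff
  proof (intro conjI ballI allI)
    show "(\<lambda>u. coset W (g u)) \<in> carrier ?N \<rightarrow> carrier (quot_rmod M W)"
      using g_closed by (auto simp: quot_carrier[OF W])
    show "coset W (g (u \<oplus>\<^bsub>?N\<^esub> v)) = coset W (g u) \<oplus>\<^bsub>quot_rmod M W\<^esub> coset W (g v)"
      if "u \<in> carrier ?N" "v \<in> carrier ?N" for u v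
      using that by (simp add: g_add quot_add[OF W] g_closed)
    show "coset W (g (c \<odot>\<^bsub>?N\<^esub> u)) = c \<odot>\<^bsub>quot_rmod M W\<^esub> coset W (g u)" if "u \<in> carrier ?N" for c u
      using that by (simp add: g_smult quot_smult[OF W] g_closed)
    show "coset W (g (u \<star>\<^bsub>?N\<^esub> a)) = coset W (g u) \<star>\<^bsub>quot_rmod M W\<^esub> a"
      if "u \<in> carrier ?N" "a \<in> carrier A" for u a
      using that coset_eq_iff[OF W ract_closed[OF g_closed that(2)] g_closed, of u "u \<star>\<^bsub>M\<^esub> a"] g_act[of u a]
      by (simp add: quot_act[OF W] g_closed)
  qed
  have "\<forall>f\<in>rmod_hom A ?N (quot_rmod M W). \<forall>u\<in>W. f u = \<zero>\<^bsub>quot_rmod M W\<^esub>"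
    using orth by (simp add: hom_orthogonal_submodules_def)
  from bspec[OF bspec[OF this hom]] have g_mem: "g u \<in> W" if "u \<in> W" for u
    using coset_eq_zero_iff[OF W g_closed] that by simp
  \<comment> \<open>Orthogonality puts the values of \<open>g\<close> into \<open>W\<close>, and
    \<open>g\<close> sends \<open>us ! i\<close> to \<open>ys ! i\<close>.\<close>
  have "ys ! i \<in> W" if i: "i < ?s" for i
  proof -
    have "us ! i = lin_comb ?N (\<lambda>k. if k = i then 1 else 0) us"
      by (rule lin_comb_unit[OF N.vectorspace_M _ i, symmetric]) (simp add: us)
    also have "\<dots> = lin_comb ?N (\<lambda>k. vec ?s (\<lambda>k. if k = i then 1 else 0) $ k) us"
      by (rule lin_comb_cong[OF N.vectorspace_M]) simp
    finally have unit: "us ! i = lin_comb ?N (\<lambda>k. vec ?s (\<lambda>k. if k = i then 1 else 0) $ k) us" .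
    have "coords ?N us (us ! i) = vec ?s (\<lambda>k. if k = i then 1 else 0)"
      by (subst unit) (rule coords_lin_comb[OF frW], simp)
    then have "g (us ! i) = lin_comb M (\<lambda>k. if k = i then 1 else 0) ys"
      unfolding g_def using len by (intro lin_comb_cong[OF vectorspace_M]) simp
    also have "\<dots> = ys ! i" using lin_comb_unit[OF vectorspace_M ys] i len by simp
    finally have "g (us ! i) = ys ! i" .
    moreover have "us ! i \<in> W" using us nth_mem[OF i] by blast
    ultimately show ?thesis using g_mem[of "us ! i"] by simp
  qed
  then have "set ys \<subseteq> W" using len by (auto simp: in_set_conv_nth)
  from coords_sub_rows[OF this] have "coord_mat M bs ys = coord_mat ?N us ys * ?X" .
  moreover have "coord_mat M bs ys = Y"
  proof (rule eq_matI)
    fix i l assume "i < dim_row Y" "l < dim_col Y"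
    then have "i < ?s" "l < ?d" using Y by auto
    then show "coord_mat M bs ys $$ (i, l) = Y $$ (i, l)" using Y_index len by (simp add: coord_mat_index[OF fr])
  qed (use Y coord_mat_carrier[OF fr, of ys] len in auto)
  ultimately show ?thesis using coord_mat_carrier[OF frW, of ys] unfolding len
    by (intro bexI[of _ "coord_mat ?N us ys"]) (simp_all only:)
qed

end

section \<open>Forms that isolate the orthogonal submodules\<close>

lemma pluecker_eq: "pluecker M bs us = (\<lambda>I. det (submatrix (coord_mat M bs us) UNIV I))" if "frame M bs"
  unfolding pluecker_def coord_mat_def[OF that] by (rule refl)

text \<open>The row-space criterion is translated back: a factorization through the matrix of
  \<open>U\<close> puts a basis of \<open>W\<close> inside \<open>U\<close>. Quantifying over every
  basis \<open>us\<close> of \<open>W\<close> matches the quantifier in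
  \<open>pluecker_basic_open\<close>.\<close>

lemma isolating_function:
  assumes bs: "ordered_basis M bs" and U: "U \<in> \<S> A M"
    and dim: "vectorspace.dim class_ring (sub_rmod M U) = s"
  shows "\<exists>g\<in>forms (index_sets (length bs) s) (s * length bs + 1).
    \<forall>W\<in>rmod_grassmannian A s M. \<forall>us. ordered_basis (sub_rmod M W) us \<longrightarrow>
      (g (pluecker M bs us) \<noteq> 0 \<longleftrightarrow> W = U)"
proof -
  let ?d = "length bs"
  have fr: "frame M bs" by (rule ordered_basis_imp_frame[OF vectorspace_M bs])
  have subU: "rsubmodule A M U" using U by (simp add: hom_orthogonal_submodules_def)
  interpret U: fd_right_module A "sub_rmod M U" by (rule sub_rmod_module[OF subU])
  obtain us0 where us0: "ordered_basis (sub_rmod M U) us0" "length us0 = s"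
    using ordered_basis_exists[OF U.vectorspace_M U.fin_dim_M] dim by blast
  have frU: "frame (sub_rmod M U) us0" by (rule ordered_basis_imp_frame[OF U.vectorspace_M us0(1)])
  let ?XU = "coord_mat M bs us0"
  have X0: "?XU \<in> carrier_mat s ?d" using coord_mat_carrier[OF fr, of us0] us0(2) by simp
  have CU: "coord_mat (sub_rmod M U) us0 (map (\<lambda>u. u \<star>\<^bsub>M\<^esub> a) us0) \<in> carrier_mat s s" for a
    using coord_mat_carrier[OF frU, of "map (\<lambda>u. u \<star>\<^bsub>M\<^esub> a) us0"] us0(2) by simp
  let ?RR = "act_matrix bs ` carrier A"
  obtain js where js: "length js = s" "set js \<subseteq> {..<?d}" "column_minor ?XU js \<noteq> 0"
    using coord_mat_full_rank[OF subU fr frU] us0(2) by blast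
  have "\<exists>g\<in>forms (index_sets ?d s) (s * ?d + 1).
    isolates_rows ?RR ?d s ?XU g"
  proof (rule rigid_isolated[OF _ X0 js])
    show "?RR \<subseteq> carrier_mat ?d ?d" using act_matrix_carrier[OF fr] by blast
    show "\<exists>C\<in>carrier_mat s s. ?XU * R = C * ?XU" if "R \<in> ?RR" for R
      using that coord_mat_stable[OF subU fr frU] CU by blast
    fix Y assume Y: "Y \<in> carrier_mat s ?d"
      and lin: "\<And>R C. \<lbrakk>R \<in> ?RR; C \<in> carrier_mat s s; ?XU * R = C * ?XU\<rbrakk> \<Longrightarrow>
          \<exists>D\<in>carrier_mat s s. Y * R = C * Y + D * ?XU"
    show "\<exists>D\<in>carrier_mat s s. Y = D * ?XU"
      using coord_mat_rigid[OF subU fr frU U, of Y] Y lin[OF imageI CU coord_mat_stable[OF subU fr frU]]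
      unfolding us0(2) by blast
  qed
  then obtain g where g: "g \<in> forms (index_sets ?d s) (s * ?d + 1)"
    and g_iff: "\<And>X. \<lbrakk>X \<in> carrier_mat s ?d;
      \<exists>js'. length js' = s \<and> set js' \<subseteq> {..<?d} \<and> column_minor X js' \<noteq> 0;
      \<forall>R\<in>?RR. \<exists>C\<in>carrier_mat s s. X * R = C * X\<rbrakk> \<Longrightarrow>
      g (\<lambda>I. det (submatrix X UNIV I)) \<noteq> 0 \<longleftrightarrow> (\<exists>G\<in>carrier_mat s s. X = G * ?XU)"
    by (elim bexE) simp
  have "g (pluecker M bs us) \<noteq> 0 \<longleftrightarrow> W = U"
    if W: "W \<in> rmod_grassmannian A s M" and us: "ordered_basis (sub_rmod M W) us" for W us
  proof -
    have subW: "rsubmodule A M W" and dimW: "vectorspace.dim class_ring (sub_rmod M W) = s"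
      using W by (auto simp: rmod_grassmannian_def grassmannian_def)
    interpret W: fd_right_module A "sub_rmod M W" by (rule sub_rmod_module[OF subW])
    have frW: "frame (sub_rmod M W) us" by (rule ordered_basis_imp_frame[OF W.vectorspace_M us])
    have len: "length us = s" using ordered_basis_length[OF W.vectorspace_M us] dimW by simp
    have usW: "set us \<subseteq> W" using frW by (simp add: frame_def)
    then have usM: "set us \<subseteq> carrier M" using rsubmoduleD(1)[OF subW] by blast
    have us0U: "set us0 \<subseteq> U" using frU by (simp add: frame_def)
    then have us0M: "set us0 \<subseteq> carrier M" using rsubmoduleD(1)[OF subU] by blast
    let ?X = "coord_mat M bs us"
    have X: "?X \<in> carrier_mat s ?d" using coord_mat_carrier[OF fr, of us] len by simp
    have CW: "coord_mat (sub_rmod M W) us (map (\<lambda>u. u \<star>\<^bsub>M\<^esub> a) us) \<in> carrier_mat s s" for a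
      using coord_mat_carrier[OF frW, of "map (\<lambda>u. u \<star>\<^bsub>M\<^esub> a) us"] len by simp
    have "g (pluecker M bs us) \<noteq> 0 \<longleftrightarrow> (\<exists>G\<in>carrier_mat s s. ?X = G * ?XU)"
      unfolding pluecker_eq[OF fr]
    proof (rule g_iff[OF X])
      show "\<exists>js'. length js' = s \<and> set js' \<subseteq> {..<?d} \<and> column_minor ?X js' \<noteq> 0"
        using coord_mat_full_rank[OF subW fr frW] unfolding len .
      show "\<forall>R\<in>?RR. \<exists>C\<in>carrier_mat s s. ?X * R = C * ?X"
        using coord_mat_stable[OF subW fr frW] CW by blast
    qed
    also have "\<dots> \<longleftrightarrow> W = U"
    proof
      assume "\<exists>G\<in>carrier_mat s s. ?X = G * ?XU"
      then obtain G where G: "G \<in> carrier_mat s s" "?X = G * ?XU" by blast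
      have "us ! i \<in> U" if i: "i < s" for i
      proof -
        have "us ! i = lin_comb M (\<lambda>k. G $$ (i, k)) us0"
        proof (rule coord_eqI[OF fr])
          show "us ! i \<in> carrier M" using usM i len nth_mem by blast
          show "lin_comb M (\<lambda>k. G $$ (i, k)) us0 \<in> carrier M" by (rule lin_comb_closed[OF vectorspace_M us0M])
          fix l assume l: "l < ?d"
          have "coords M bs (us ! i) $ l = ?X $$ (i, l)"
            using coord_mat_index[OF fr, of i us l] i l len by simp
          also have "\<dots> = coords M bs (lin_comb M (\<lambda>k. G $$ (i, k)) us0) $ l"
            unfolding G(2) using coords_lin_comb_row[OF fr us0M l _ i, of G] G(1) us0(2) by simp
          finally show "coords M bs (us ! i) $ l = coords M bs (lin_comb M (\<lambda>k. G $$ (i, k)) us0) $ l" .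
        qed
        then show ?thesis using lin_comb_sub_mem[OF subU fr frU] by simp
      qed
      then have "set us \<subseteq> U" using len by (auto simp: in_set_conv_nth)
      have "W \<subseteq> U"
      proof
        fix w assume "w \<in> W"
        then have "w = lin_comb M (\<lambda>i. coords (sub_rmod M W) us w $ i) us"
          by (rule lin_comb_sub_coords[OF subW fr frW, symmetric])
        moreover have "VectorSpace.subspace class_ring U M" using subU by (simp add: rsubmodule_def)
        ultimately show "w \<in> U" using lin_comb_in_subspace[OF vectorspace_M _ \<open>set us \<subseteq> U\<close>] by metis
      qed
      \<comment> \<open>Containment becomes equality because both submodules have dimension
        \<open>s\<close>.\<close>
      have "VectorSpace.subspace class_ring W (sub_rmod M U)"
        using rsubmodule_sub_rmod[OF subU subW \<open>W \<subseteq> U\<close>] by (simp add: rsubmodule_def)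
      from subspace_eq_of_dim[OF U.vectorspace_M U.fin_dim_M this] dimW dim show "W = U" by simp
    next
      assume "W = U"
      then have "?X = coord_mat (sub_rmod M U) us0 us * ?XU"
        using coords_sub_rows[OF subU fr frU] usW by blast
      moreover have "coord_mat (sub_rmod M U) us0 us \<in> carrier_mat s s"
        using coord_mat_carrier[OF frU, of us] len us0(2) by simp
      ultimately show "\<exists>G\<in>carrier_mat s s. ?X = G * ?XU" by blast
    qed
    finally show ?thesis .
  qed
  then show ?thesis using g by blast
qed

lemma mem_rmod_grassmannian:
  "rsubmodule A M U \<Longrightarrow> vectorspace.dim class_ring (sub_rmod M U) = s \<Longrightarrow> U \<in> rmod_grassmannian A s M"
  by (simp add: rmod_grassmannian_def grassmannian_def rsubmodule_def)

lemma rmod_grassmannian_basis_exists: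
  assumes "W \<in> rmod_grassmannian A s M"
  obtains us where "ordered_basis (sub_rmod M W) us"
proof -
  have "rsubmodule A M W" using assms by (simp add: rmod_grassmannian_def)
  then interpret W: fd_right_module A "sub_rmod M W" by (rule sub_rmod_module)
  show thesis using ordered_basis_exists[OF W.vectorspace_M W.fin_dim_M] that by blast
qed

lemma hom_orthogonal_isolated:
  assumes bs: "ordered_basis M bs" and U: "U \<in> \<S> A M"
    and dim: "vectorspace.dim class_ring (sub_rmod M U) = s"
  shows "isolated_point (subtopology (grassmannian_topology M bs s) (rmod_grassmannian A s M)) U"
proof -
  have "rsubmodule A M U" using U by (simp add: hom_orthogonal_submodules_def)
  then have mem: "U \<in> rmod_grassmannian A s M" by (rule mem_rmod_grassmannian[OF _ dim])
  obtain g where g: "g \<in> forms (index_sets (length bs) s) (s * length bs + 1)"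
    and g_iff: "\<forall>W\<in>rmod_grassmannian A s M. \<forall>us. ordered_basis (sub_rmod M W) us \<longrightarrow>
      (g (pluecker M bs us) \<noteq> 0 \<longleftrightarrow> W = U)"
    using isolating_function[OF bs U dim] by (rule bexE)
  obtain f where f: "homogeneous (s * length bs + 1) f" "poly_vars f \<subseteq> index_sets (length bs) s"
    "g = (\<lambda>x. poly_eval x f)"
    using g by (rule formsE)
  let ?O = "pluecker_basic_open M bs s f"
  have "openin (grassmannian_topology M bs s) ?O"
    unfolding grassmannian_topology_def by (rule topology_generated_by_Basis) (use f(1,2) in blast)
  moreover have "{U} = ?O \<inter> rmod_grassmannian A s M"
  proof (intro subset_antisym subsetI)
    fix W assume "W \<in> {U}"
    then show "W \<in> ?O \<inter> rmod_grassmannian A s M"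
      using mem g_iff unfolding f(3) by (simp add: pluecker_basic_open_def rmod_grassmannian_def)
  next
    fix W assume W: "W \<in> ?O \<inter> rmod_grassmannian A s M"
    \<comment> \<open>\<open>pluecker_basic_open\<close> quantifies over all bases of
      \<open>W\<close>; membership says something only once a basis is exhibited.\<close>
    then obtain us where us: "ordered_basis (sub_rmod M W) us" using rmod_grassmannian_basis_exists by blast
    then have "g (pluecker M bs us) \<noteq> 0" using W unfolding f(3) by (simp add: pluecker_basic_open_def)
    then show "W \<in> {U}" using g_iff W us by blast
  qed
  ultimately show ?thesis
    unfolding isolated_point_def openin_subtopology by blast
qed

text \<open>
  All isolating functions of a given dimension live in one finite-dimensional space of homogeneous
  polynomials, and the diagonal shape of their values makes them linearly independent.
\<close>

lemma finite_hom_orthogonal: "finite (\<S> A M)"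
proof -
  obtain bs where bs: "ordered_basis M bs" using ordered_basis_exists[OF vectorspace_M fin_dim_M] by blast
  let ?P = "\<lambda>s. {U \<in> \<S> A M. vectorspace.dim class_ring (sub_rmod M U) = s}"
  have fin: "finite (?P s)" for s
  proof -
    let ?V = "index_sets (length bs) s"
    have mem: "U \<in> rmod_grassmannian A s M" if "U \<in> ?P s" for U
      using that mem_rmod_grassmannian by (simp add: hom_orthogonal_submodules_def)
    have "\<forall>U\<in>?P s. \<exists>g. g \<in> forms ?V (s * length bs + 1) \<and>
      (\<forall>W\<in>rmod_grassmannian A s M. \<forall>us. ordered_basis (sub_rmod M W) us \<longrightarrow>
        (g (pluecker M bs us) \<noteq> 0 \<longleftrightarrow> W = U))"
      using isolating_function[OF bs] unfolding Bex_def by blast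
    from bchoice[OF this] obtain g where g: "\<forall>U\<in>?P s. g U \<in> forms ?V (s * length bs + 1) \<and>
      (\<forall>W\<in>rmod_grassmannian A s M. \<forall>us. ordered_basis (sub_rmod M W) us \<longrightarrow>
        (g U (pluecker M bs us) \<noteq> 0 \<longleftrightarrow> W = U))" ..
    have "\<forall>W\<in>rmod_grassmannian A s M. \<exists>us. ordered_basis (sub_rmod M W) us"
      using rmod_grassmannian_basis_exists by blast
    \<comment> \<open>One fixed basis for each submodule provides the evaluation points of the
      diagonal matrix.\<close>
    from bchoice[OF this] obtain us where us: "\<forall>W\<in>rmod_grassmannian A s M. ordered_basis (sub_rmod M W) (us W)" ..
    show ?thesis
    proof (rule finite_of_diagonal_forms)
      show "finite ?V" by (rule finite_subset[of _ "Pow {..<length bs}"]) auto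
      show "g U \<in> forms ?V (s * length bs + 1)" if "U \<in> ?P s" for U using g that by blast
      show "g U (pluecker M bs (us W)) \<noteq> 0 \<longleftrightarrow> U = W" if "U \<in> ?P s" "W \<in> ?P s" for U W
      proof -
        have "ordered_basis (sub_rmod M W) (us W)" using us mem[OF that(2)] by blast
        then have "g U (pluecker M bs (us W)) \<noteq> 0 \<longleftrightarrow> W = U" using g that(1) mem[OF that(2)] by blast
        then show ?thesis by (simp only: eq_commute)
      qed
    qed
  qed
  have "\<S> A M \<subseteq> (\<Union>s\<in>{..VM.dim}. ?P s)"
    using subspace_dim_le[OF vectorspace_M fin_dim_M] by (auto simp: hom_orthogonal_submodules_def rsubmodule_def)
  then show ?thesis by (rule finite_subset) (use fin in blast)
qed

end

section \<open>Intervals of torsion classes\<close>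

text \<open>The left orthogonal class of \<open>N\<close>; for \<open>N = M/U\<close> it is the
  upper end of the interval. \<open>N\<close> may live on any type, since the elements of a quotient
  are sets.\<close>

definition hom_perp ::
    "('k::field, 'a, 'z) module_scheme \<Rightarrow> ('k, 'a, 'm, 'y) rmod_scheme \<Rightarrow> ('k, 'a, 'k vec) rmod set" where
  "hom_perp A N = {X \<in> mod_cat A. \<forall>f\<in>rmod_hom A X N. \<forall>x\<in>carrier X. f x = \<zero>\<^bsub>N\<^esub>}"

lemma hom_perpD:
  "\<lbrakk>X \<in> hom_perp A N; f \<in> rmod_hom A X N; x \<in> carrier X\<rbrakk> \<Longrightarrow> f x = \<zero>\<^bsub>N\<^esub>"
  by (simp add: hom_perp_def)

text \<open>Vanishing of all maps into \<open>N\<close> is invariant under isomorphism. Membership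
  can therefore be tested on modules outside \<open>mod_cat\<close>, such as the sums and quotients
  in the definition of \<open>tors\<close>.\<close>

lemma in_class_hom_perp_iff:
  assumes X: "fd_right_module A X"
  shows "in_class A (hom_perp A N) X \<longleftrightarrow> (\<forall>f\<in>rmod_hom A X N. \<forall>x\<in>carrier X. f x = \<zero>\<^bsub>N\<^esub>)"
proof
  assume "in_class A (hom_perp A N) X"
  then obtain Y h where Y: "Y \<in> hom_perp A N" and h: "h \<in> rmod_hom A X Y" "bij_betw h (carrier X) (carrier Y)"
    by (auto simp: in_class_def rmod_iso_def)
  obtain g where g: "g \<in> rmod_hom A Y X" "\<And>x. x \<in> carrier X \<Longrightarrow> g (h x) = x"
    by (rule rmod_iso_inverse[OF X h]) blast
  show "\<forall>f\<in>rmod_hom A X N. \<forall>x\<in>carrier X. f x = \<zero>\<^bsub>N\<^esub>"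
  proof (intro ballI)
    fix f x assume f: "f \<in> rmod_hom A X N" and x: "x \<in> carrier X"
    have "f (g (h x)) = \<zero>\<^bsub>N\<^esub>"
      by (rule hom_perpD[OF Y rmod_hom_compose[OF g(1) f] rmod_homD(1)[OF h(1) x]])
    then show "f x = \<zero>\<^bsub>N\<^esub>" using g(2)[OF x] by simp
  qed
next
  assume zero: "\<forall>f\<in>rmod_hom A X N. \<forall>x\<in>carrier X. f x = \<zero>\<^bsub>N\<^esub>"
  obtain Y where Y: "Y \<in> mod_cat A" "rmod_iso A X Y" by (rule mod_cat_copy_exists[OF X])
  then obtain h where h: "h \<in> rmod_hom A X Y" "bij_betw h (carrier X) (carrier Y)"
    by (auto simp: rmod_iso_def)
  have "f y = \<zero>\<^bsub>N\<^esub>" if f: "f \<in> rmod_hom A Y N" and y: "y \<in> carrier Y" for f y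
  proof -
    obtain x where x: "x \<in> carrier X" "y = h x" using h(2) y by (auto simp: bij_betw_def)
    have "f (h x) = \<zero>\<^bsub>N\<^esub>" using bspec[OF bspec[OF zero rmod_hom_compose[OF h(1) f]] x(1)] by simp
    then show ?thesis using x(2) by simp
  qed
  then have "Y \<in> hom_perp A N" using Y(1) by (simp add: hom_perp_def)
  then show "in_class A (hom_perp A N) X" using Y(2) by (auto simp: in_class_def)
qed

lemma mem_hom_perp_iff: "X \<in> mod_cat A \<Longrightarrow> X \<in> hom_perp A N \<longleftrightarrow> in_class A (hom_perp A N) X"
  using in_class_hom_perp_iff[of A X N] by (simp add: mod_cat_def hom_perp_def)

text \<open>This rests on left exactness of \<open>Hom(-, N)\<close>: a map out of a quotient is a
  map out of the module, a map out of a sum is determined on the summands, and a map that vanishes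
  on \<open>U\<close> factors through the quotient by \<open>U\<close>.\<close>

lemma hom_perp_tors:
  assumes N: "fd_right_module A N"
  shows "hom_perp A N \<in> tors A"
proof -
  interpret N: fd_right_module A N by (rule N)
  let ?T = "hom_perp A N"
  have mod: "fd_right_module A X" if "X \<in> mod_cat A" for X using that by (simp add: mod_cat_def)
  have T_mod: "X \<in> mod_cat A" if "X \<in> ?T" for X using that by (simp add: hom_perp_def)
  have sub: "?T \<subseteq> mod_cat A" using T_mod by blast
  have iso: "Y \<in> ?T" if "X \<in> ?T" "Y \<in> mod_cat A" "rmod_iso A X Y" for X Y
    using that in_class_iso'[OF mod[OF T_mod[OF that(1)]] that(3) in_classI] mem_hom_perp_iff by blast
  have zero: "Z \<in> ?T" if Z: "Z \<in> mod_cat A" "carrier Z = {\<zero>\<^bsub>Z\<^esub>}" for Z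
    using Z fd_right_module.hom_zero[OF mod[OF Z(1)] _ N] by (simp add: hom_perp_def)
  have sum: "in_class A ?T (sum_rmod X Y)" if X: "X \<in> ?T" and Y: "Y \<in> ?T" for X Y
  proof -
    interpret X: fd_right_module A X by (rule mod[OF T_mod[OF X]])
    interpret Y: fd_right_module A Y by (rule mod[OF T_mod[OF Y]])
    have i: "(\<lambda>x. (x, \<zero>\<^bsub>Y\<^esub>)) \<in> rmod_hom A X (sum_rmod X Y)"
      unfolding rmod_hom_iff using Y.VM.rmult_0 by (auto simp: sum_rmod_simps Y.ract_zero)
    have j: "(\<lambda>y. (\<zero>\<^bsub>X\<^esub>, y)) \<in> rmod_hom A Y (sum_rmod X Y)"
      unfolding rmod_hom_iff using X.VM.rmult_0 by (auto simp: sum_rmod_simps X.ract_zero)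
    show ?thesis
      unfolding in_class_hom_perp_iff[OF sum_rmod_module[OF X.fd_right_module_axioms Y.fd_right_module_axioms]]
    proof (intro ballI)
      fix f p assume f: "f \<in> rmod_hom A (sum_rmod X Y) N" and p: "p \<in> carrier (sum_rmod X Y)"
      obtain x y where xy: "p = (x, y)" "x \<in> carrier X" "y \<in> carrier Y" using p by (auto simp: sum_rmod_simps)
      have "f (x, \<zero>\<^bsub>Y\<^esub>) = \<zero>\<^bsub>N\<^esub>"
        by (rule hom_perpD[OF X rmod_hom_compose[OF i f] xy(2)])
      moreover have "f (\<zero>\<^bsub>X\<^esub>, y) = \<zero>\<^bsub>N\<^esub>"
        by (rule hom_perpD[OF Y rmod_hom_compose[OF j f] xy(3)])
      moreover have "p = (x, \<zero>\<^bsub>Y\<^esub>) \<oplus>\<^bsub>sum_rmod X Y\<^esub> (\<zero>\<^bsub>X\<^esub>, y)"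
        using xy by (simp add: sum_rmod_simps)
      ultimately show "f p = \<zero>\<^bsub>N\<^esub>"
        using rmod_homD(2)[OF f, of "(x, \<zero>\<^bsub>Y\<^esub>)" "(\<zero>\<^bsub>X\<^esub>, y)"] xy by (simp add: sum_rmod_simps)
    qed
  qed
  have quot: "in_class A ?T (quot_rmod X U)" if X: "X \<in> ?T" and U: "rsubmodule A X U" for X U
  proof -
    interpret X: fd_right_module A X by (rule mod[OF T_mod[OF X]])
    show ?thesis
      unfolding in_class_hom_perp_iff[OF X.quot_rmod_module[OF U]]
    proof (intro ballI)
      fix f C assume f: "f \<in> rmod_hom A (quot_rmod X U) N" and C: "C \<in> carrier (quot_rmod X U)"
      obtain x where "x \<in> carrier X" "C = X.coset U x" using C by (auto simp: X.quot_carrier[OF U])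
      then show "f C = \<zero>\<^bsub>N\<^esub>"
        using hom_perpD[OF X rmod_hom_compose[OF X.coset_hom[OF U] f]] by simp
    qed
  qed
  have ext: "Y \<in> ?T" if Y: "Y \<in> mod_cat A" and U: "rsubmodule A Y U"
    and inU: "in_class A ?T (sub_rmod Y U)" and inQ: "in_class A ?T (quot_rmod Y U)" for Y U
  proof -
    interpret Y: fd_right_module A Y by (rule mod[OF Y])
    have "f y = \<zero>\<^bsub>N\<^esub>" if f: "f \<in> rmod_hom A Y N" and y: "y \<in> carrier Y" for f y
    proof -
      have "f \<in> rmod_hom A (sub_rmod Y U) N"
        using rmod_homD[OF f] Y.rsubmoduleD(1)[OF U] unfolding rmod_hom_iff by (auto simp: subset_iff)
      then have "f u = \<zero>\<^bsub>N\<^esub>" if "u \<in> U" for u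
        using inU that unfolding in_class_hom_perp_iff[OF Y.sub_rmod_module[OF U]] by simp
      then obtain g where g: "g \<in> rmod_hom A (quot_rmod Y U) N" "\<And>x. x \<in> carrier Y \<Longrightarrow> g (Y.coset U x) = f x"
        using Y.hom_factor[OF U f N] by blast
      have "g (Y.coset U y) = \<zero>\<^bsub>N\<^esub>"
        using inQ g(1) rmod_homD(1)[OF Y.coset_hom[OF U] y]
        unfolding in_class_hom_perp_iff[OF Y.quot_rmod_module[OF U]] by blast
      then show ?thesis using g(2)[OF y] by simp
    qed
    then show ?thesis using Y by (simp add: hom_perp_def)
  qed
  show ?thesis
    unfolding tors_def using sub iso zero sum quot ext by blast
qed

section \<open>Intersections of torsion classes\<close>

lemma in_class_mono: "\<lbrakk>T \<subseteq> T'; in_class A T X\<rbrakk> \<Longrightarrow> in_class A T' X"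
  unfolding in_class_def by blast

text \<open>A single copy of \<open>X\<close> in \<open>mod_cat\<close> works for all classes at
  once, because each of them is closed under isomorphism.\<close>

lemma in_class_Inter_iff:
  assumes C: "C \<subseteq> tors A" "C \<noteq> {}" and X: "fd_right_module A X"
  shows "in_class A (\<Inter>C) X \<longleftrightarrow> (\<forall>T\<in>C. in_class A T X)"
proof
  assume "in_class A (\<Inter>C) X"
  then show "\<forall>T\<in>C. in_class A T X" by (meson Inter_lower in_class_mono)
next
  assume all: "\<forall>T\<in>C. in_class A T X"
  obtain Y where Y: "Y \<in> mod_cat A" "rmod_iso A X Y" by (rule mod_cat_copy_exists[OF X])
  have "Y \<in> T" if "T \<in> C" for T
    using in_class_mod_cat[OF _ Y(1)] in_class_iso'[OF X Y(2)] all C(1) that by blast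
  then show "in_class A (\<Inter>C) X" using Y(2) by (auto simp: in_class_def)
qed

text \<open>Sums and quotients pass to the intersection through \<open>in_class_Inter_iff\<close>;
  nonemptiness of \<open>C\<close> keeps the intersection inside \<open>mod_cat\<close>.\<close>

lemma Inter_tors:
  assumes C: "C \<subseteq> tors A" "C \<noteq> {}"
  shows "\<Inter>C \<in> tors A"
proof -
  note iff = in_class_Inter_iff[OF C]
  have mod: "fd_right_module A X" if "X \<in> mod_cat A" for X using that by (simp add: mod_cat_def)
  have T: "X \<in> T" if "X \<in> \<Inter>C" "T \<in> C" for X T using that by blast
  have sub: "\<Inter>C \<subseteq> mod_cat A"
    using C unfolding tors_def by blast
  have mem: "Y \<in> \<Inter>C" if "Y \<in> mod_cat A" "\<forall>T\<in>C. in_class A T Y" for Y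
    using that in_class_mod_cat C(1) by blast
  have iso: "Y \<in> \<Inter>C" if "X \<in> \<Inter>C" "Y \<in> mod_cat A" "rmod_iso A X Y" for X Y
    using that C(1) unfolding tors_def by blast
  have zero: "Z \<in> \<Inter>C" if Z: "Z \<in> mod_cat A" "carrier Z = {\<zero>\<^bsub>Z\<^esub>}" for Z
    using Z C(1) unfolding tors_def by blast
  have sum: "in_class A (\<Inter>C) (sum_rmod X Y)" if X: "X \<in> \<Inter>C" and Y: "Y \<in> \<Inter>C" for X Y
    unfolding iff[OF sum_rmod_module[OF mod mod, OF subsetD[OF sub X] subsetD[OF sub Y]]]
    using X Y C(1) unfolding tors_def by blast
  have quot: "in_class A (\<Inter>C) (quot_rmod X U)" if X: "X \<in> \<Inter>C" and U: "rsubmodule A X U" for X U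
    unfolding iff[OF fd_right_module.quot_rmod_module[OF mod[OF subsetD[OF sub X]] U]]
    using X U C(1) unfolding tors_def by blast
  have ext: "Y \<in> \<Inter>C" if Y: "Y \<in> mod_cat A" and U: "rsubmodule A Y U"
    and inU: "in_class A (\<Inter>C) (sub_rmod Y U)" and inQ: "in_class A (\<Inter>C) (quot_rmod Y U)" for Y U
  proof -
    have "in_class A T (sub_rmod Y U)" "in_class A T (quot_rmod Y U)" if "T \<in> C" for T
      using in_class_mono[OF Inter_lower[OF that]] inU inQ by blast+
    then show ?thesis using Y U C(1) unfolding tors_def by blast
  qed
  show ?thesis
    unfolding tors_def using sub iso zero sum quot ext by blast
qed

context fd_right_module
begin

definition generated_torsion_class :: "'m set \<Rightarrow> ('k, 'a, 'k vec) rmod set" where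
  "generated_torsion_class U = \<Inter>{T \<in> tors A. in_class A T (sub_rmod M U)}"

text \<open>Orthogonality says that \<open>U\<close> lies in the upper class. This makes the family
  defining the lower class nonempty and puts the lower class below the upper one, so every fiber has
  a member; that in turn makes distinct \<open>U\<close> have distinct fibers.\<close>

lemma torsion_interval:
  assumes U: "U \<in> \<S> A M"
  shows "generated_torsion_class U \<in> tors A" "hom_perp A (quot_rmod M U) \<in> tors A"
    and "{T \<in> tors A. torsion_part A T M = U} =
      tors_interval A (generated_torsion_class U) (hom_perp A (quot_rmod M U))"
    and "generated_torsion_class U \<in> {T \<in> tors A. torsion_part A T M = U}"
proof -
  let ?T1 = "generated_torsion_class U" and ?T2 = "hom_perp A (quot_rmod M U)"
  have sub: "rsubmodule A M U"
    and orth: "\<And>f u. \<lbrakk>f \<in> rmod_hom A (sub_rmod M U) (quot_rmod M U); u \<in> U\<rbrakk> \<Longrightarrow> f u = \<zero>\<^bsub>quot_rmod M U\<^esub>"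
    using U by (auto simp: hom_orthogonal_submodules_def)
  let ?U = "sub_rmod M U"
  have mU: "fd_right_module A ?U" by (rule sub_rmod_module[OF sub])
  have mQ: "fd_right_module A (quot_rmod M U)" by (rule quot_rmod_module[OF sub])
  show T2: "?T2 \<in> tors A" by (rule hom_perp_tors[OF mQ])
  have U2: "in_class A ?T2 ?U"
    unfolding in_class_hom_perp_iff[OF mU] using orth by simp
  let ?C = "{T \<in> tors A. in_class A T ?U}"
  have C: "?C \<subseteq> tors A" "?C \<noteq> {}" using T2 U2 by blast+
  show T1: "?T1 \<in> tors A" unfolding generated_torsion_class_def by (rule Inter_tors[OF C])
  have U1: "in_class A ?T1 ?U"
    unfolding generated_torsion_class_def in_class_Inter_iff[OF C mU] by blast
  show eq: "{T \<in> tors A. torsion_part A T M = U} = tors_interval A ?T1 ?T2"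
  proof (intro subset_antisym subsetI)
    fix T assume "T \<in> {T \<in> tors A. torsion_part A T M = U}"
    then have T: "T \<in> tors A" "torsion_part A T M = U" by auto
    note gr = torsion_part_greatest[OF T(1), unfolded T(2)]
    have "?T1 \<subseteq> T" unfolding generated_torsion_class_def using T(1) gr(2) by blast
    moreover have "T \<subseteq> ?T2"
    proof
      fix X assume X: "X \<in> T"
      have mX: "fd_right_module A X" by (rule tors_mod_cat[OF T(1) X])
      have "f x = \<zero>\<^bsub>quot_rmod M U\<^esub>" if "f \<in> rmod_hom A X (quot_rmod M U)" "x \<in> carrier X" for f x
        by (rule hom_into_quotient_zero[OF T(1) gr mX in_classI[OF X] that])
      then show "X \<in> ?T2" using mX by (simp add: hom_perp_def mod_cat_def)
    qed
    ultimately show "T \<in> tors_interval A ?T1 ?T2" using T(1) by (simp add: tors_interval_def)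
  next
    fix T assume "T \<in> tors_interval A ?T1 ?T2"
    then have T: "T \<in> tors A" "?T1 \<subseteq> T" "T \<subseteq> ?T2" by (auto simp: tors_interval_def)
    let ?V = "torsion_part A T M"
    note gr = torsion_part_greatest[OF T(1)]
    have "U \<subseteq> ?V" by (rule gr(3)[OF sub in_class_mono[OF T(2) U1]])
    moreover have "?V \<subseteq> U"
    proof
      fix v assume v: "v \<in> ?V"
      have V: "?V \<subseteq> carrier M" by (rule rsubmoduleD(1)[OF gr(1)])
      \<comment> \<open>The torsion part lies in the upper class, so the projection to
        \<open>M/U\<close> restricts to zero on it.\<close>
      have "coset U \<in> rmod_hom A (sub_rmod M ?V) (quot_rmod M U)"
        using rmod_homD[OF coset_hom[OF sub]] V unfolding rmod_hom_iff by (auto simp: subset_iff)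
      moreover have "in_class A ?T2 (sub_rmod M ?V)" by (rule in_class_mono[OF T(3) gr(2)])
      ultimately have "coset U v = \<zero>\<^bsub>quot_rmod M U\<^esub>"
        using v unfolding in_class_hom_perp_iff[OF sub_rmod_module[OF gr(1)]] by simp
      then show "v \<in> U" using coset_eq_zero_iff[OF sub, of v] v V by blast
    qed
    ultimately show "T \<in> {T \<in> tors A. torsion_part A T M = U}" using T(1) by blast
  qed
  have "?T1 \<subseteq> ?T2" unfolding generated_torsion_class_def using T2 U2 by blast
  then show "?T1 \<in> {T \<in> tors A. torsion_part A T M = U}"
    unfolding eq using T1 by (simp add: tors_interval_def)
qed

end

theorem theorem2p5:
  fixes A :: "('k::field, 'a, 'z) module_scheme"
    and M :: "('k, 'a, 'm, 'y) rmod_scheme"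
    and d :: nat
  assumes "fd_algebra A"
    and "fd_right_module A M"
    and "d = vectorspace.dim class_ring M"
  shows
    "(\<forall>bs. ordered_basis M bs \<longrightarrow>
        (\<forall>s\<le>d. \<forall>U \<in> \<S> A M. vectorspace.dim class_ring (M\<lparr>carrier := U\<rparr>) = s \<longrightarrow>
           U \<in> rmod_grassmannian A s M \<and>
           isolated_point
             (subtopology (grassmannian_topology M bs s) (rmod_grassmannian A s M)) U))
     \<and> finite (\<S> A M)
     \<and> (let fiber = (\<lambda>U. {\<T> \<in> tors A. torsion_part A \<T> M = U}) in
          partition_on (tors A) (fiber ` \<S> A M)
          \<and> inj_on fiber (\<S> A M)
          \<and> finite (fiber ` \<S> A M)
          \<and> (\<forall>U \<in> \<S> A M. \<exists>\<T>\<^sub>1 \<in> tors A. \<exists>\<T>\<^sub>2 \<in> tors A.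
                fiber U = tors_interval A \<T>\<^sub>1 \<T>\<^sub>2))"
proof -
  interpret fd_right_module A M by (rule assms(2))
  define fiber where "fiber U = {\<T> \<in> tors A. torsion_part A \<T> M = U}" for U
  have sub: "rsubmodule A M U" if "U \<in> \<S> A M" for U
    using that by (simp add: hom_orthogonal_submodules_def)
  have nonempty: "fiber U \<noteq> {}" if "U \<in> \<S> A M" for U
    using torsion_interval(4)[OF that] unfolding fiber_def by blast
  have "partition_on (tors A) (fiber ` \<S> A M)"
  proof (rule partition_onI)
    show "\<Union> (fiber ` \<S> A M) = tors A"
      using torsion_part_hom_orthogonal by (auto simp: fiber_def)
    show "disjnt p q" if "p \<in> fiber ` \<S> A M" "q \<in> fiber ` \<S> A M" "p \<noteq> q" for p q
      using that by (auto simp: fiber_def disjnt_def)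
    show "{} \<notin> fiber ` \<S> A M" using nonempty by blast
  qed
  \<comment> \<open>A nonempty fiber determines \<open>U\<close> as the torsion part of any of its
    members.\<close>
  moreover have "inj_on fiber (\<S> A M)"
  proof (rule inj_onI)
    fix U V assume UV: "U \<in> \<S> A M" "V \<in> \<S> A M" "fiber U = fiber V"
    obtain T where "T \<in> fiber U" using nonempty[OF UV(1)] by blast
    then show "U = V" using UV(3) by (auto simp: fiber_def)
  qed
  moreover have "\<exists>\<T>\<^sub>1\<in>tors A. \<exists>\<T>\<^sub>2\<in>tors A. fiber U = tors_interval A \<T>\<^sub>1 \<T>\<^sub>2" if "U \<in> \<S> A M" for U
    using torsion_interval(1,2,3)[OF that] unfolding fiber_def by blast
  moreover have "U \<in> rmod_grassmannian A s M \<and>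
      isolated_point (subtopology (grassmannian_topology M bs s) (rmod_grassmannian A s M)) U"
    if "ordered_basis M bs" "U \<in> \<S> A M" "vectorspace.dim class_ring (M\<lparr>carrier := U\<rparr>) = s" for bs s U
    using mem_rmod_grassmannian[OF sub[OF that(2)] that(3)] hom_orthogonal_isolated[OF that] by blast
  ultimately show ?thesis
    using finite_hom_orthogonal unfolding fiber_def[abs_def] Let_def by blast
qed

end
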